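(* Assume that A1, A2 and A3 hold, let $f(\theta)=\mathcal{T}_c(\rho(\cdot,\theta),\rho^* )$ for $\theta\in\Theta$, let $\theta_0\in\Theta$, and assume that $c\in C^1(\Omega^2)$. Suppose that $\rho=\rho(\cdot,\theta_0)$ satisfies $\operatorname{supp}(\rho)=\operatorname{cl}(\operatorname{int}(\operatorname{supp}(\rho)))$ and that, with $\{O_k\}$ the connected components of $\operatorname{int}(\operatorname{supp}(\rho))$, all the sets $\{\operatorname{cl}(O_k)\}$ are mutually linked in the optimal transportation from $\rho$ to $\rho^*$ with transport cost $c$. Then $f$ is Gâteaux differentiable at $\theta_0$. In particular (still under A1, A2, A3 and $c\in C^1(\Omega^2)$), if the support of $\rho(\cdot,\theta_0)$ is the closure of an open connected set, then $f$ is Gâteaux differentiable at $\theta_0$.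
   Context: Setting: $\Omega\subset\mathbb{R}^d$ is compact, $\mathscr{P}(\Omega)$ is the set of Borel probability measures on $\Omega$, and $\rho^*\in\mathscr{P}(\Omega)$ is arbitrary; $\operatorname{int}$ and $\operatorname{cl}$ denote interior and closure. Assumptions. A1: $\Theta\subset\mathbb{R}^m$ is open, and $\{\rho(\cdot,\theta)\}_{\theta\in\Theta}\subset\mathscr{P}(\Omega)$ is a family of absolutely continuous (w.r.t. Lebesgue measure) probability measures; the same symbol denotes the measure and its density. A2: for a.e. $x\in\Omega$ the map $\theta\mapsto\rho(x,\theta)$ is differentiable, and $|\nabla_\theta\rho(x,\theta)|\le\eta(x)$ for all $\theta\in\Theta$, for some $\eta\in L^1(\Omega)$. A3: $c:\Omega^2\to\mathbb{R}$ is continuous and nonnegative. Optimal transport: for $\mu,\nu\in\mathscr{P}(\Omega)$, $\mathcal{T}_c(\mu,\nu)=\inf_\pi\int_{\Omega\times\Omega}c\,d\pi$ over all $\pi\in\mathscr{P}(\Omega\times\Omega)$ with marginals $\mu$ and $\nu$; $\Gamma_0(\mu,\nu)$ is the set of minimizers (optimal transport plans). Linked components: for $\rho\in\mathscr{P}(\Omega)$ with $\operatorname{int}(\operatorname{supp}(\rho))\neq\emptyset$, write $\operatorname{int}(\operatorname{supp}(\rho))=\bigcup_kO_k$ with $O_k$ disjoint, open and connected (the connected components), and set $$E_k=\operatorname{cl}\big(\{y:(x,y)\in\operatorname{supp}(\pi)\text{ for some }x\in\operatorname{cl}(O_k),\ \pi\in\Gamma_0(\rho,\rho^* )\}\big).$$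 $\operatorname{cl}(O_k)$ and $\operatorname{cl}(O_l)$ are linked in the optimal transportation from $\rho$ to $\rho^*$ with transport cost $c$ if there exist indices $i_1,\dots,i_N$ with $k=i_1$, $l=i_N$, and $E_{i_j}\cap E_{i_{j+1}}\ne\emptyset$ for $1\le j\le N-1$. Differentiability: $f$ is Gâteaux differentiable at $\theta_0$ if $f'(\theta_0,\Delta\theta)=\lim_{t\to0+}\frac{f(\theta_0+t\Delta\theta)-f(\theta_0)}{t}$ exists for all $\Delta\theta\in\mathbb{R}^m$ and is linear in $\Delta\theta$. *)

theory Defs
  imports "HOL-Probability.Probability"
begin

section \<open>Borel probability measures and their supports\<close>

definition borel_probs :: "'a::topological_space set \<Rightarrow> 'a measure set" where
  "borel_probs S = {\<mu>. prob_space \<mu> \<and> sets \<mu> = sets (restrict_space borel S)}"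

text \<open>A measure in \<^term>\<open>borel_probs S\<close> has space \<^term>\<open>S\<close>, so the neighbourhoods below are
  the relatively open subsets of \<^term>\<open>S\<close>.\<close>

definition msupport :: "'a::topological_space measure \<Rightarrow> 'a set" where
  "msupport \<mu> = {x \<in> space \<mu>. \<forall>U. open U \<and> x \<in> U \<longrightarrow> emeasure \<mu> (U \<inter> space \<mu>) > 0}"

section \<open>Optimal transport\<close>

definition transport_plans ::
    "'a::euclidean_space set \<Rightarrow> 'a measure \<Rightarrow> 'a measure \<Rightarrow> ('a \<times> 'a) measure set" where
  "transport_plans \<Omega> \<mu> \<nu> = {\<pi> \<in> borel_probs (\<Omega> \<times> \<Omega>).
     distr \<pi> (restrict_space borel \<Omega>) fst = \<mu> \<and> distr \<pi> (restrict_space borel \<Omega>) snd = \<nu>}"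

text \<open>For compact \<^term>\<open>\<Omega>\<close> and continuous nonnegative \<^term>\<open>c\<close> the integrals are finite and
  bounded below by 0, and the product measure is a plan; so the real-valued infimum is taken over
  a nonempty set that is bounded below.\<close>

definition transport_cost ::
    "'a::euclidean_space set \<Rightarrow> ('a \<times> 'a \<Rightarrow> real) \<Rightarrow> 'a measure \<Rightarrow> 'a measure \<Rightarrow> real" where
  "transport_cost \<Omega> c \<mu> \<nu> = (INF \<pi>\<in>transport_plans \<Omega> \<mu> \<nu>. \<integral>z. c z \<partial>\<pi>)"

definition optimal_plans ::
    "'a::euclidean_space set \<Rightarrow> ('a \<times> 'a \<Rightarrow> real) \<Rightarrow> 'a measure \<Rightarrow> 'a measure
      \<Rightarrow> ('a \<times> 'a) measure set" where
  "optimal_plans \<Omega> c \<mu> \<nu> =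
     {\<pi> \<in> transport_plans \<Omega> \<mu> \<nu>. (\<integral>z. c z \<partial>\<pi>) = transport_cost \<Omega> c \<mu> \<nu>}"

section \<open>Linked components of the support\<close>

text \<open>The sets \<open>O\<^sub>k\<close> are the members of \<^term>\<open>components (interior (msupport \<mu>))\<close> and serve as
  their own indices; \<open>E\<^sub>k\<close> is \<open>linked_image \<Omega> c \<mu> \<nu> O\<^sub>k\<close>.\<close>

definition linked_image ::
    "'a::euclidean_space set \<Rightarrow> ('a \<times> 'a \<Rightarrow> real) \<Rightarrow> 'a measure \<Rightarrow> 'a measure
      \<Rightarrow> 'a set \<Rightarrow> 'a set" where
  "linked_image \<Omega> c \<mu> \<nu> C =
     closure {y. \<exists>x \<in> closure C. \<exists>\<pi> \<in> optimal_plans \<Omega> c \<mu> \<nu>. (x, y) \<in> msupport \<pi>}"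

definition linked ::
    "'a::euclidean_space set \<Rightarrow> ('a \<times> 'a \<Rightarrow> real) \<Rightarrow> 'a measure \<Rightarrow> 'a measure
      \<Rightarrow> 'a set \<Rightarrow> 'a set \<Rightarrow> bool" where
  "linked \<Omega> c \<mu> \<nu> A B \<longleftrightarrow>
     (\<exists>Cs. Cs \<noteq> [] \<and> set Cs \<subseteq> components (interior (msupport \<mu>)) \<and> hd Cs = A \<and> last Cs = B \<and>
       (\<forall>j. Suc j < length Cs \<longrightarrow>
          linked_image \<Omega> c \<mu> \<nu> (Cs ! j) \<inter> linked_image \<Omega> c \<mu> \<nu> (Cs ! Suc j) \<noteq> {}))"

section \<open>Parametric densities\<close>

definition density_on :: "'a::euclidean_space set \<Rightarrow> ('a \<Rightarrow> real) \<Rightarrow> 'a measure" where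
  "density_on \<Omega> g = density (restrict_space lborel \<Omega>) (\<lambda>x. ennreal (g x))"

text \<open>The family is given by the densities \<open>\<lambda>x. \<rho> x \<theta>\<close>, from which the measures are recovered by
  \<^const>\<open>density_on\<close>. The nonnegativity clause is needed because \<^const>\<open>ennreal\<close> truncates
  negative values to 0.\<close>

definition assumption_A1 ::
    "'a::euclidean_space set \<Rightarrow> 'b::euclidean_space set \<Rightarrow> ('a \<Rightarrow> 'b \<Rightarrow> real) \<Rightarrow> bool" where
  "assumption_A1 \<Omega> \<Theta> \<rho> \<longleftrightarrow> open \<Theta> \<and>
     (\<forall>\<theta>\<in>\<Theta>. (\<lambda>x. \<rho> x \<theta>) \<in> borel_measurable (restrict_space borel \<Omega>) \<and>
            (AE x in lebesgue_on \<Omega>. \<rho> x \<theta> \<ge> 0) \<and>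
            density_on \<Omega> (\<lambda>x. \<rho> x \<theta>) \<in> borel_probs \<Omega>)"

definition assumption_A2 ::
    "'a::euclidean_space set \<Rightarrow> 'b::euclidean_space set \<Rightarrow> ('a \<Rightarrow> 'b \<Rightarrow> real) \<Rightarrow> bool" where
  "assumption_A2 \<Omega> \<Theta> \<rho> \<longleftrightarrow>
     (\<exists>\<eta>. integrable (lebesgue_on \<Omega>) \<eta> \<and>
       (AE x in lebesgue_on \<Omega>. \<forall>\<theta>\<in>\<Theta>. \<exists>D. (GDERIV (\<lambda>\<theta>'. \<rho> x \<theta>') \<theta> :> D) \<and> norm D \<le> \<eta> x))"

definition assumption_A3 :: "'a::euclidean_space set \<Rightarrow> ('a \<times> 'a \<Rightarrow> real) \<Rightarrow> bool" where
  "assumption_A3 \<Omega> c \<longleftrightarrow> continuous_on (\<Omega> \<times> \<Omega>) c \<and> (\<forall>z \<in> \<Omega> \<times> \<Omega>. c z \<ge> 0)"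

section \<open>Differentiability\<close>

text \<open>Continuous differentiability on a set that need not be open: the derivative is taken
  relative to \<^term>\<open>S\<close>. At points where the relative derivative is not unique, some choice of it has
  to be continuous. Restrictions of functions that are continuously differentiable on an open
  neighbourhood of \<^term>\<open>S\<close> satisfy this.\<close>

definition C1_on :: "'a::euclidean_space set \<Rightarrow> ('a \<Rightarrow> real) \<Rightarrow> bool" where
  "C1_on S f \<longleftrightarrow>
     (\<exists>f' :: 'a \<Rightarrow> 'a \<Rightarrow>\<^sub>L real. continuous_on S f' \<and>
       (\<forall>z\<in>S. (f has_derivative blinfun_apply (f' z)) (at z within S)))"

definition gateaux_differentiable :: "('b::euclidean_space \<Rightarrow> real) \<Rightarrow> 'b \<Rightarrow> bool" where
  "gateaux_differentiable f \<theta>\<^sub>0 \<longleftrightarrow>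
     (\<exists>f'. linear f' \<and>
       (\<forall>v. ((\<lambda>t. (f (\<theta>\<^sub>0 + t *\<^sub>R v) - f \<theta>\<^sub>0) / t) \<longlongrightarrow> f' v) (at_right 0)))"

end

theory Submission
  imports Defs "HOL-Complex_Analysis.Great_Picard"
begin

text \<open>
  By Kantorovich duality, \<open>f \<theta>\<close> is the maximum, over all pairs \<open>(\<phi>, \<psi>)\<close> of potentials with
  \<open>\<phi> x + \<psi> y \<le> c (x, y)\<close>, of \<open>\<integral>\<phi> d\<rho>(\<theta>) + \<integral>\<psi> d\<rho>star\<close>. For a fixed pair this value is differentiable in \<open>\<theta>\<close>, with
  derivative \<open>\<integral>\<phi> \<partial>\<^sub>v\<rho>\<close> in direction \<open>v\<close>. The optimal pairs form a compact set, up to additive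
  constants, and limits of optimal pairs are optimal (\<open>optimal_pair_limit\<close>). So \<open>f\<close> is Gateaux differentiable at
  \<open>\<theta>\<^sub>0\<close> as soon as \<open>\<integral>\<phi> \<partial>\<^sub>v\<rho>\<close> is the same for all \<open>\<phi>\<close> that are optimal at \<open>\<theta>\<^sub>0\<close>. Where the density vanishes at
  \<open>\<theta>\<^sub>0\<close> it has a minimum there, hence \<open>\<partial>\<^sub>v\<rho> = 0\<close>; moreover \<open>\<partial>\<^sub>v\<rho>\<close> has integral 0. It is therefore enough that the
  optimal \<open>\<phi>\<close> is unique on the support up to an additive constant (\<open>gateaux_differentiable_transport_cost\<close>).

  For this uniqueness let \<open>(\<phi>1, \<psi>1)\<close> and \<open>(\<phi>2, \<psi>2)\<close> be optimal. Each point \<open>x\<close> of the support has a point \<open>y\<close> with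
  equality for both pairs (\<open>optimal_pairs_common_contact\<close>): near \<open>x\<close> both potentials lie below \<open>c (_, y)\<close> up to
  a constant, and touch it at \<open>x\<close>. If \<open>c\<close> is continuously differentiable, the increments of \<open>\<phi>1 - \<phi>2\<close>
  along a finely subdivided segment in the support are bounded by a telescoping sum that tends to 0
  (\<open>potentials_segment_le\<close>). So \<open>\<phi>1 - \<phi>2\<close> is constant on each component of the interior of the support. On
  the image of a component under optimal plans, \<open>\<psi>1 - \<psi>2\<close> is the opposite constant, so linked components share
  their constant (\<open>optimal_potential_unique\<close>).

  Duality itself is obtained up to \<open>\<epsilon>\<close> by discretization. On a finite set it is a separation argument
  (\<open>gordan_alternative\<close>, \<open>finite_transport_duality\<close>); a discrete plan is spread over small cells to
  a plan with the right marginals, and discrete dual variables are improved to a pair of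
  \<open>c\<close>-conjugate functions (\<open>kantorovich_duality_approx\<close>). Exact optimizers then come from compactness.
\<close>

section \<open>Pairs of c-conjugate potentials\<close>

text \<open>The two attainment clauses say that \<open>\<phi>\<close> and \<open>\<psi>\<close> are the \<open>c\<close>-transforms of each other on \<open>\<Omega>\<close>.
  Stated as contact conditions they are symmetric in \<open>\<phi>\<close> and \<open>\<psi>\<close>, and no infimum has to be unfolded.\<close>

definition conj_pair ::
    "'a::euclidean_space set \<Rightarrow> ('a \<times> 'a \<Rightarrow> real) \<Rightarrow> ('a \<Rightarrow> real) \<Rightarrow> ('a \<Rightarrow> real) \<Rightarrow> bool" where
  "conj_pair \<Omega> c \<phi> \<psi> \<longleftrightarrow>
     (\<forall>x\<in>\<Omega>. \<forall>y\<in>\<Omega>. \<phi> x + \<psi> y \<le> c (x, y)) \<and>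
     (\<forall>x\<in>\<Omega>. \<exists>y\<in>\<Omega>. \<phi> x + \<psi> y = c (x, y)) \<and>
     (\<forall>y\<in>\<Omega>. \<exists>x\<in>\<Omega>. \<phi> x + \<psi> y = c (x, y))"

lemma conj_pair_swap: "conj_pair \<Omega> (c \<circ> prod.swap) \<psi> \<phi> \<longleftrightarrow> conj_pair \<Omega> c \<phi> \<psi>"
  unfolding conj_pair_def by (auto simp: add.commute)

lemma conj_pair_le: "conj_pair \<Omega> c \<phi> \<psi> \<Longrightarrow> x \<in> \<Omega> \<Longrightarrow> y \<in> \<Omega> \<Longrightarrow> \<phi> x + \<psi> y \<le> c (x, y)"
  unfolding conj_pair_def by blast

lemma conj_pair_shift: "conj_pair \<Omega> c \<phi> \<psi> \<Longrightarrow> conj_pair \<Omega> c (\<lambda>x. \<phi> x - k) (\<lambda>y. \<psi> y + k)"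
  unfolding conj_pair_def by simp

lemma continuous_on_swapped:
  assumes "continuous_on (\<Omega> \<times> \<Omega>) c"
  shows "continuous_on (\<Omega> \<times> \<Omega>) (c \<circ> prod.swap)"
  by (rule continuous_on_compose) (auto intro!: continuous_intros continuous_on_subset[OF assms])

lemma cost_uniform_modulus:
  fixes c :: "'a::euclidean_space \<times> 'a \<Rightarrow> real"
  assumes "compact \<Omega>" "continuous_on (\<Omega> \<times> \<Omega>) c" "e > 0"
  obtains d where "d > 0"
    "\<And>x x' y y'. x \<in> \<Omega> \<Longrightarrow> x' \<in> \<Omega> \<Longrightarrow> y \<in> \<Omega> \<Longrightarrow> y' \<in> \<Omega> \<Longrightarrow> dist x x' < d \<Longrightarrow> dist y y' < d \<Longrightarrow>
       \<bar>c (x, y) - c (x', y')\<bar> < e"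
proof -
  have "uniformly_continuous_on (\<Omega> \<times> \<Omega>) c"
    using assms by (intro compact_uniformly_continuous compact_Times)
  then obtain d where d: "d > 0"
    "\<And>z z'. z \<in> \<Omega> \<times> \<Omega> \<Longrightarrow> z' \<in> \<Omega> \<times> \<Omega> \<Longrightarrow> dist z z' < d \<Longrightarrow> \<bar>c z - c z'\<bar> < e"
    using \<open>e > 0\<close> unfolding uniformly_continuous_on_def dist_real_def by metis
  show thesis
  proof (rule that[of "d / 2"])
    show "d / 2 > 0" using d by simp
    fix x x' y y' assume *: "x \<in> \<Omega>" "x' \<in> \<Omega>" "y \<in> \<Omega>" "y' \<in> \<Omega>" "dist x x' < d / 2" "dist y y' < d / 2"
    have "dist (x, y) (x', y') \<le> dist x x' + dist y y'"
      unfolding dist_Pair_Pair by (rule sqrt_sum_squares_le_sum) auto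
    then have "dist (x, y) (x', y') < d" using * by simp
    then show "\<bar>c (x, y) - c (x', y')\<bar> < e" using d(2) * by auto
  qed
qed

text \<open>A potential inherits the modulus of continuity of the cost, because an upper bound for
  \<open>\<phi> x - \<phi> x'\<close> comes from a contact point of \<open>x'\<close>. The modulus is common to all conjugate pairs,
  which is what makes them compact.\<close>

lemma conj_pair_modulus_fst:
  assumes "conj_pair \<Omega> c \<phi> \<psi>" "x \<in> \<Omega>" "x' \<in> \<Omega>"
    and "\<And>y. y \<in> \<Omega> \<Longrightarrow> \<bar>c (x, y) - c (x', y)\<bar> \<le> e"
  shows "\<bar>\<phi> x - \<phi> x'\<bar> \<le> e"
proof -
  have one: "\<phi> x - \<phi> x' \<le> e"
    if a: "x \<in> \<Omega>" "x' \<in> \<Omega>" "\<And>y. y \<in> \<Omega> \<Longrightarrow> \<bar>c (x, y) - c (x', y)\<bar> \<le> e" for x x'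
  proof -
    obtain y where "y \<in> \<Omega>" "\<phi> x' + \<psi> y = c (x', y)"
      using assms(1) a(2) unfolding conj_pair_def by blast
    moreover have "\<phi> x + \<psi> y \<le> c (x, y)" using conj_pair_le[OF assms(1) a(1) \<open>y \<in> \<Omega>\<close>] .
    ultimately show ?thesis using a(3)[of y] by linarith
  qed
  show ?thesis using one[of x x'] one[of x' x] assms by (auto simp: abs_le_iff abs_minus_commute)
qed

lemma conj_pair_modulus_snd:
  assumes "conj_pair \<Omega> c \<phi> \<psi>" "y \<in> \<Omega>" "y' \<in> \<Omega>"
    and "\<And>x. x \<in> \<Omega> \<Longrightarrow> \<bar>c (x, y) - c (x, y')\<bar> \<le> e"
  shows "\<bar>\<psi> y - \<psi> y'\<bar> \<le> e"
  using conj_pair_modulus_fst[of \<Omega> "c \<circ> prod.swap" \<psi> \<phi> y y' e] assms by (simp add: conj_pair_swap)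

lemma conj_pair_continuous_fst:
  assumes "compact \<Omega>" "continuous_on (\<Omega> \<times> \<Omega>) c" "conj_pair \<Omega> c \<phi> \<psi>"
  shows "continuous_on \<Omega> \<phi>"
  unfolding continuous_on_iff
proof (intro ballI allI impI)
  fix x and e :: real assume "x \<in> \<Omega>" "e > 0"
  obtain d where d: "d > 0"
    "\<And>x x' y y'. x \<in> \<Omega> \<Longrightarrow> x' \<in> \<Omega> \<Longrightarrow> y \<in> \<Omega> \<Longrightarrow> y' \<in> \<Omega> \<Longrightarrow> dist x x' < d \<Longrightarrow> dist y y' < d \<Longrightarrow>
       \<bar>c (x, y) - c (x', y')\<bar> < e / 2"
    using cost_uniform_modulus[OF assms(1,2), of "e / 2"] \<open>e > 0\<close> by auto
  have "\<bar>\<phi> x' - \<phi> x\<bar> \<le> e / 2" if "x' \<in> \<Omega>" "dist x' x < d" for x'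
    by (rule conj_pair_modulus_fst[OF assms(3) that(1) \<open>x \<in> \<Omega>\<close>])
      (use d that \<open>x \<in> \<Omega>\<close> in \<open>simp add: less_imp_le\<close>)
  with d(1) \<open>e > 0\<close> show "\<exists>d>0. \<forall>x'\<in>\<Omega>. dist x' x < d \<longrightarrow> dist (\<phi> x') (\<phi> x) < e"
    by (intro exI[of _ d]) (force simp: dist_real_def)
qed

lemma conj_pair_continuous_snd:
  assumes "compact \<Omega>" "continuous_on (\<Omega> \<times> \<Omega>) c" "conj_pair \<Omega> c \<phi> \<psi>"
  shows "continuous_on \<Omega> \<psi>"
  by (rule conj_pair_continuous_fst[OF assms(1) continuous_on_swapped[OF assms(2)]
        conj_pair_swap[THEN iffD2, OF assms(3)]])

definition c_transform :: "'a set \<Rightarrow> ('a \<times> 'a \<Rightarrow> real) \<Rightarrow> ('a \<Rightarrow> real) \<Rightarrow> 'a \<Rightarrow> real" where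
  "c_transform \<Omega> c g x = (INF y\<in>\<Omega>. c (x, y) - g y)"

lemma c_transform_le:
  assumes "\<And>y. y \<in> \<Omega> \<Longrightarrow> h x + g y \<le> c (x, y)" "y \<in> \<Omega>"
  shows "c_transform \<Omega> c g x + g y \<le> c (x, y)"
proof -
  have "bdd_below ((\<lambda>y. c (x, y) - g y) ` \<Omega>)"
    by (rule bdd_belowI2[of _ "h x"]) (use assms in \<open>auto simp: algebra_simps\<close>)
  from cINF_lower[OF this assms(2)] show ?thesis unfolding c_transform_def by simp
qed

lemma c_transform_ge:
  assumes "\<And>y. y \<in> \<Omega> \<Longrightarrow> r + g y \<le> c (x, y)" "\<Omega> \<noteq> {}"
  shows "r \<le> c_transform \<Omega> c g x"
  unfolding c_transform_def by (rule cINF_greatest) (use assms in \<open>auto simp: algebra_simps\<close>)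

lemma c_transform_continuous:
  fixes \<Omega> :: "'a::euclidean_space set"
  assumes "compact \<Omega>" "\<Omega> \<noteq> {}" "continuous_on (\<Omega> \<times> \<Omega>) c"
    and le: "\<And>x y. x \<in> \<Omega> \<Longrightarrow> y \<in> \<Omega> \<Longrightarrow> h x + g y \<le> c (x, y)"
  shows "continuous_on \<Omega> (c_transform \<Omega> c g)"
  unfolding continuous_on_iff
proof (intro ballI allI impI)
  fix x and e :: real assume "x \<in> \<Omega>" "e > 0"
  obtain d where d: "d > 0"
    "\<And>x x' y y'. x \<in> \<Omega> \<Longrightarrow> x' \<in> \<Omega> \<Longrightarrow> y \<in> \<Omega> \<Longrightarrow> y' \<in> \<Omega> \<Longrightarrow> dist x x' < d \<Longrightarrow> dist y y' < d \<Longrightarrow>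
       \<bar>c (x, y) - c (x', y')\<bar> < e / 2"
    using cost_uniform_modulus[OF assms(1,3), of "e / 2"] \<open>e > 0\<close> by auto
  have one: "c_transform \<Omega> c g x - e / 2 \<le> c_transform \<Omega> c g x'"
    if "x \<in> \<Omega>" "x' \<in> \<Omega>" "dist x x' < d" for x x'
  proof (rule c_transform_ge)
    fix y assume "y \<in> \<Omega>"
    then have "c_transform \<Omega> c g x + g y \<le> c (x, y)"
      using c_transform_le[of \<Omega> h x g c y] le that by blast
    moreover have "\<bar>c (x, y) - c (x', y)\<bar> < e / 2" using d that \<open>y \<in> \<Omega>\<close> by simp
    ultimately show "c_transform \<Omega> c g x - e / 2 + g y \<le> c (x', y)" by linarith
  qed fact
  have "\<bar>c_transform \<Omega> c g x' - c_transform \<Omega> c g x\<bar> < e" if "x' \<in> \<Omega>" "dist x' x < d" for x'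
    using one[of x x'] one[of x' x] that \<open>x \<in> \<Omega>\<close> \<open>e > 0\<close> by (simp add: dist_commute abs_if)
  with d(1) show "\<exists>d>0. \<forall>x'\<in>\<Omega>. dist x' x < d \<longrightarrow> dist (c_transform \<Omega> c g x') (c_transform \<Omega> c g x) < e"
    by (auto simp: dist_real_def)
qed

lemma c_transform_attained:
  fixes \<Omega> :: "'a::euclidean_space set"
  assumes "compact \<Omega>" "\<Omega> \<noteq> {}" "continuous_on (\<Omega> \<times> \<Omega>) c" "continuous_on \<Omega> g" "x \<in> \<Omega>"
  obtains y where "y \<in> \<Omega>" "c_transform \<Omega> c g x + g y = c (x, y)"
proof -
  have "continuous_on \<Omega> (\<lambda>y. c (x, y) - g y)"
    by (intro continuous_intros assms continuous_on_compose2[OF assms(3)]) (use assms in auto)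
  then obtain y where y: "y \<in> \<Omega>" "\<And>y'. y' \<in> \<Omega> \<Longrightarrow> c (x, y) - g y \<le> c (x, y') - g y'"
    using continuous_attains_inf[OF assms(1,2)] by blast
  have "c (x, y) - g y \<le> c_transform \<Omega> c g x"
    by (rule c_transform_ge) (use y assms in \<open>auto simp: algebra_simps\<close>)
  moreover have "c_transform \<Omega> c g x + g y \<le> c (x, y)"
    by (rule c_transform_le[where h = "\<lambda>_. c (x, y) - g y"]) (use y in \<open>auto simp: algebra_simps\<close>)
  ultimately show thesis using that y by force
qed

text \<open>Replacing \<open>u\<close> and \<open>v\<close> by iterated \<open>c\<close>-transforms only increases them. For step functions \<open>v\<close> the
  infimum in the first transform need not be attained, but the transform is continuous; this is why two
  further transforms are taken.\<close>

lemma conj_pair_above: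
  fixes \<Omega> :: "'a::euclidean_space set"
  assumes "compact \<Omega>" "\<Omega> \<noteq> {}" and c: "continuous_on (\<Omega> \<times> \<Omega>) c"
    and le: "\<And>x y. x \<in> \<Omega> \<Longrightarrow> y \<in> \<Omega> \<Longrightarrow> u x + v y \<le> c (x, y)"
  obtains \<phi> \<psi> where "conj_pair \<Omega> c \<phi> \<psi>" "\<And>x. x \<in> \<Omega> \<Longrightarrow> u x \<le> \<phi> x" "\<And>y. y \<in> \<Omega> \<Longrightarrow> v y \<le> \<psi> y"
proof -
  define \<phi>0 where "\<phi>0 = c_transform \<Omega> c v"
  define \<psi> where "\<psi> = c_transform \<Omega> (c \<circ> prod.swap) \<phi>0"
  define \<phi> where "\<phi> = c_transform \<Omega> c \<psi>"
  note c' = continuous_on_swapped[OF c]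
  have le0: "\<phi>0 x + v y \<le> c (x, y)" if "x \<in> \<Omega>" "y \<in> \<Omega>" for x y
    unfolding \<phi>0_def by (rule c_transform_le[where h = u]) (use le that in auto)
  have "u x \<le> \<phi>0 x" if "x \<in> \<Omega>" for x
    unfolding \<phi>0_def by (rule c_transform_ge) (use le that assms in auto)
  have le1: "\<phi>0 x + \<psi> y \<le> c (x, y)" if "x \<in> \<Omega>" "y \<in> \<Omega>" for x y
    using c_transform_le[of \<Omega> v y \<phi>0 "c \<circ> prod.swap" x] le0 that
    unfolding \<psi>_def by (auto simp: add.commute)
  have v\<psi>: "v y \<le> \<psi> y" if "y \<in> \<Omega>" for y
    unfolding \<psi>_def by (rule c_transform_ge) (use le0 that assms in \<open>auto simp: add.commute\<close>)
  have \<phi>0\<phi>: "\<phi>0 x \<le> \<phi> x" if "x \<in> \<Omega>" for x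
    unfolding \<phi>_def by (rule c_transform_ge) (use le1 that assms in \<open>auto simp: add.commute\<close>)
  have le2: "\<phi> x + \<psi> y \<le> c (x, y)" if "x \<in> \<Omega>" "y \<in> \<Omega>" for x y
    unfolding \<phi>_def by (rule c_transform_le[where h = \<phi>0]) (use le1 that in auto)
  have cont0: "continuous_on \<Omega> \<phi>0"
    unfolding \<phi>0_def by (rule c_transform_continuous[where h = u]) (use assms in auto)
  have cont1: "continuous_on \<Omega> \<psi>"
    unfolding \<psi>_def by (rule c_transform_continuous[where h = v])
      (use assms c' le0 in \<open>auto simp: add.commute\<close>)
  have "\<exists>y\<in>\<Omega>. \<phi> x + \<psi> y = c (x, y)" if "x \<in> \<Omega>" for x
    using c_transform_attained[OF assms(1,2) c cont1 that] unfolding \<phi>_def by metis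
  moreover have "\<exists>x\<in>\<Omega>. \<phi> x + \<psi> y = c (x, y)" if y: "y \<in> \<Omega>" for y
  proof -
    obtain x where x: "x \<in> \<Omega>" "\<psi> y + \<phi>0 x = c (x, y)"
      using c_transform_attained[OF assms(1,2) c' cont0 y] unfolding \<psi>_def by auto
    then show ?thesis using \<phi>0\<phi>[of x] le2[of x y] y by (intro bexI[of _ x]) auto
  qed
  ultimately have "conj_pair \<Omega> c \<phi> \<psi>" using le2 unfolding conj_pair_def by blast
  then show thesis using that v\<psi> \<phi>0\<phi> \<open>\<And>x. x \<in> \<Omega> \<Longrightarrow> u x \<le> \<phi>0 x\<close> by (meson order_trans)
qed

text \<open>If the limiting gap \<open>c (x, y) - \<phi> x - \<psi> y\<close> had a positive minimum over \<open>y\<close>, then the gaps late in the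
  sequence would be bounded away from 0, while each of them vanishes at some \<open>y\<close>.\<close>

lemma contact_limit:
  fixes \<Omega> :: "'a::euclidean_space set" and \<Phi> \<Psi> :: "nat \<Rightarrow> 'a \<Rightarrow> real"
  assumes "compact \<Omega>" "\<Omega> \<noteq> {}" and c: "continuous_on (\<Omega> \<times> \<Omega>) c" and x: "x \<in> \<Omega>"
    and eq: "\<And>n. \<exists>y\<in>\<Omega>. \<Phi> n x + \<Psi> n y = c (x, y)"
    and le: "\<And>y. y \<in> \<Omega> \<Longrightarrow> \<phi> x + \<psi> y \<le> c (x, y)"
    and lim: "uniform_limit \<Omega> \<Phi> \<phi> sequentially" "uniform_limit \<Omega> \<Psi> \<psi> sequentially"
    and cont: "continuous_on \<Omega> \<psi>"
  shows "\<exists>y\<in>\<Omega>. \<phi> x + \<psi> y = c (x, y)"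
proof -
  have "continuous_on \<Omega> (\<lambda>y. c (x, y) - (\<phi> x + \<psi> y))"
    by (intro continuous_intros cont continuous_on_compose2[OF c]) (use x in auto)
  then obtain y where y: "y \<in> \<Omega>" "\<And>y'. y' \<in> \<Omega> \<Longrightarrow> c (x, y) - (\<phi> x + \<psi> y) \<le> c (x, y') - (\<phi> x + \<psi> y')"
    using continuous_attains_inf[OF assms(1,2)] by blast
  define m where "m = c (x, y) - (\<phi> x + \<psi> y)"
  have "\<not> m > 0"
  proof
    assume "m > 0"
    then have half: "m / 2 > 0" by simp
    have "\<forall>\<^sub>F n in sequentially. \<forall>x\<in>\<Omega>. \<bar>\<Phi> n x - \<phi> x\<bar> < m / 2 \<and> \<bar>\<Psi> n x - \<psi> x\<bar> < m / 2"
      using uniform_limitD[OF lim(1) half] uniform_limitD[OF lim(2) half]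
      unfolding dist_real_def by eventually_elim blast
    then obtain n where n: "\<And>x. x \<in> \<Omega> \<Longrightarrow> \<bar>\<Phi> n x - \<phi> x\<bar> < m / 2 \<and> \<bar>\<Psi> n x - \<psi> x\<bar> < m / 2"
      using eventually_happens by fastforce
    obtain y' where "y' \<in> \<Omega>" "\<Phi> n x + \<Psi> n y' = c (x, y')" using eq by blast
    moreover have "m \<le> c (x, y') - (\<phi> x + \<psi> y')" using y(2)[OF \<open>y' \<in> \<Omega>\<close>] unfolding m_def .
    moreover have "\<bar>\<Phi> n x - \<phi> x\<bar> < m / 2" "\<bar>\<Psi> n y' - \<psi> y'\<bar> < m / 2"
      using n x \<open>y' \<in> \<Omega>\<close> by blast+
    ultimately show False by linarith
  qed
  then show ?thesis using le[OF y(1)] y(1) unfolding m_def by (intro bexI[of _ y]) auto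
qed

lemma conj_pair_limit:
  fixes \<Omega> :: "'a::euclidean_space set"
  assumes "compact \<Omega>" "\<Omega> \<noteq> {}" and c: "continuous_on (\<Omega> \<times> \<Omega>) c" and cp: "\<And>n. conj_pair \<Omega> c (\<Phi> n) (\<Psi> n)"
    and lim: "uniform_limit \<Omega> \<Phi> \<phi> sequentially" "uniform_limit \<Omega> \<Psi> \<psi> sequentially"
    and cont: "continuous_on \<Omega> \<phi>" "continuous_on \<Omega> \<psi>"
  shows "conj_pair \<Omega> c \<phi> \<psi>"
proof -
  have ptw: "(\<lambda>n. \<Phi> n x) \<longlonglongrightarrow> \<phi> x" "(\<lambda>n. \<Psi> n x) \<longlonglongrightarrow> \<psi> x" if "x \<in> \<Omega>" for x
    by (rule tendsto_uniform_limitI[OF lim(1) that], rule tendsto_uniform_limitI[OF lim(2) that])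
  have le: "\<phi> x + \<psi> y \<le> c (x, y)" if "x \<in> \<Omega>" "y \<in> \<Omega>" for x y
    by (rule tendsto_upperbound[OF tendsto_add[OF ptw(1)[OF that(1)] ptw(2)[OF that(2)]]])
      (use cp that in \<open>auto intro!: always_eventually conj_pair_le\<close>)
  have "\<exists>y\<in>\<Omega>. \<phi> x + \<psi> y = c (x, y)" if "x \<in> \<Omega>" for x
    by (rule contact_limit[OF assms(1,2) c that _ le[OF that] lim cont(2)])
      (use cp that in \<open>simp add: conj_pair_def\<close>)
  moreover have "\<exists>x\<in>\<Omega>. \<psi> y + \<phi> x = (c \<circ> prod.swap) (y, x)" if "y \<in> \<Omega>" for y
  proof (rule contact_limit[OF assms(1,2) continuous_on_swapped[OF c] that _ _ lim(2,1) cont(1)])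
    show "\<exists>x\<in>\<Omega>. \<Psi> n y + \<Phi> n x = (c \<circ> prod.swap) (y, x)" for n
      using cp[of n] that by (simp add: conj_pair_def add.commute)
    show "\<psi> y + \<phi> x \<le> (c \<circ> prod.swap) (y, x)" if "x \<in> \<Omega>" for x
      using le[OF that \<open>y \<in> \<Omega>\<close>] by (simp add: add.commute)
  qed
  ultimately show ?thesis unfolding conj_pair_def using le by (simp add: add.commute)
qed

text \<open>Arzela--Ascoli, applied to both potentials at once as a map into the plane. Fixing the value at
  one point removes the freedom to shift a constant between \<open>\<phi>\<close> and \<open>\<psi>\<close>, and turns the common modulus
  into a common bound.\<close>

lemma conj_pairs_compact:
  fixes \<Omega> :: "'a::euclidean_space set"
  assumes "compact \<Omega>" and c: "continuous_on (\<Omega> \<times> \<Omega>) c"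
    and cp: "\<And>n. conj_pair \<Omega> c (\<Phi> n) (\<Psi> n)" and "x\<^sub>0 \<in> \<Omega>" and norm0: "\<And>n. \<Phi> n x\<^sub>0 = 0"
  obtains \<phi> \<psi> and r :: "nat \<Rightarrow> nat" where "strict_mono r" "conj_pair \<Omega> c \<phi> \<psi>"
    "uniform_limit \<Omega> (\<Phi> \<circ> r) \<phi> sequentially" "uniform_limit \<Omega> (\<Psi> \<circ> r) \<psi> sequentially"
proof -
  have "compact (c ` (\<Omega> \<times> \<Omega>))" using assms by (intro compact_continuous_image compact_Times)
  then obtain B where B: "\<And>z. z \<in> \<Omega> \<times> \<Omega> \<Longrightarrow> \<bar>c z\<bar> \<le> B"
    using compact_imp_bounded[THEN bounded_iff[THEN iffD1]] by (metis imageI real_norm_def)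
  have b1: "\<bar>\<Phi> n x\<bar> \<le> 2 * B" if "x \<in> \<Omega>" for n x
  proof -
    have "\<bar>\<Phi> n x - \<Phi> n x\<^sub>0\<bar> \<le> 2 * B"
    proof (rule conj_pair_modulus_fst[OF cp that assms(4)])
      fix y assume "y \<in> \<Omega>"
      then show "\<bar>c (x, y) - c (x\<^sub>0, y)\<bar> \<le> 2 * B"
        using B[of "(x, y)"] B[of "(x\<^sub>0, y)"] that assms(4) by auto
    qed
    then show ?thesis by (simp add: norm0)
  qed
  have b2: "\<bar>\<Psi> n y\<bar> \<le> 3 * B" if y: "y \<in> \<Omega>" for n y
  proof -
    obtain x where x: "x \<in> \<Omega>" "\<Phi> n x + \<Psi> n y = c (x, y)"
      using cp[of n] y unfolding conj_pair_def by blast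
    then show ?thesis using b1[OF x(1), of n] B[of "(x, y)"] y by auto
  qed
  define F where "F n x = (\<Phi> n x, \<Psi> n x)" for n x
  have nF: "norm (p :: real \<times> real) \<le> \<bar>fst p\<bar> + \<bar>snd p\<bar>" for p
    unfolding norm_prod_def by (simp add: sqrt_sum_squares_le_sum_abs)
  obtain g k where g: "continuous_on \<Omega> g" "strict_mono (k :: nat \<Rightarrow> nat)"
    "\<And>e. 0 < e \<Longrightarrow> \<exists>N. \<forall>n x. n \<ge> N \<and> x \<in> \<Omega> \<longrightarrow> norm (F (k n) x - g x) < e"
  proof (rule Arzela_Ascoli[OF assms(1), of F "5 * B"])
    fix n x assume "x \<in> \<Omega>"
    then show "norm (F n x) \<le> 5 * B" using nF[of "F n x"] b1[of x n] b2[of x n] by (simp add: F_def)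
  next
    fix x and e :: real assume x: "x \<in> \<Omega>" and "0 < e"
    obtain d where d: "d > 0"
      "\<And>x x' y y'. x \<in> \<Omega> \<Longrightarrow> x' \<in> \<Omega> \<Longrightarrow> y \<in> \<Omega> \<Longrightarrow> y' \<in> \<Omega> \<Longrightarrow> dist x x' < d \<Longrightarrow> dist y y' < d \<Longrightarrow>
         \<bar>c (x, y) - c (x', y')\<bar> < e / 3"
      using cost_uniform_modulus[OF assms(1) c, of "e / 3"] \<open>e > 0\<close> by auto
    show "\<exists>d. 0 < d \<and> (\<forall>n y. y \<in> \<Omega> \<and> norm (x - y) < d \<longrightarrow> norm (F n x - F n y) < e)"
    proof (intro exI[of _ d] conjI allI impI)
      show "d > 0" by fact
      fix n y assume y: "y \<in> \<Omega> \<and> norm (x - y) < d"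
      have "\<bar>\<Phi> n x - \<Phi> n y\<bar> \<le> e / 3"
        by (rule conj_pair_modulus_fst[OF cp x]) (use d x y in \<open>force simp: dist_norm\<close>)+
      moreover have "\<bar>\<Psi> n x - \<Psi> n y\<bar> \<le> e / 3"
        by (rule conj_pair_modulus_snd[OF cp x]) (use d x y in \<open>force simp: dist_norm\<close>)+
      ultimately show "norm (F n x - F n y) < e"
        using nF[of "F n x - F n y"] \<open>e > 0\<close> by (simp add: F_def)
    qed
  qed blast
  have close: "\<exists>N. \<forall>n\<ge>N. \<forall>x\<in>\<Omega>. dist (F (k n) x) (g x) < e" if "e > 0" for e
    using g(3)[OF that] by (auto simp: dist_norm)
  have lim: "uniform_limit \<Omega> (\<lambda>n. F (k n)) g sequentially"
    unfolding uniform_limit_sequentially_iff using close by blast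
  have l1: "uniform_limit \<Omega> (\<Phi> \<circ> k) (fst \<circ> g) sequentially"
    unfolding uniform_limit_sequentially_iff
  proof (intro allI impI)
    fix e :: real assume "e > 0"
    from close[OF this] show "\<exists>N. \<forall>n\<ge>N. \<forall>x\<in>\<Omega>. dist ((\<Phi> \<circ> k) n x) ((fst \<circ> g) x) < e"
      by (metis F_def comp_apply dist_fst_le fst_conv order_le_less_trans)
  qed
  have l2: "uniform_limit \<Omega> (\<Psi> \<circ> k) (snd \<circ> g) sequentially"
    unfolding uniform_limit_sequentially_iff
  proof (intro allI impI)
    fix e :: real assume "e > 0"
    from close[OF this] show "\<exists>N. \<forall>n\<ge>N. \<forall>x\<in>\<Omega>. dist ((\<Psi> \<circ> k) n x) ((snd \<circ> g) x) < e"
      by (metis F_def comp_apply dist_snd_le snd_conv order_le_less_trans)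
  qed
  have "conj_pair \<Omega> c (fst \<circ> g) (snd \<circ> g)"
    by (rule conj_pair_limit[OF assms(1) _ c _ l1 l2])
      (use cp assms(4) in \<open>auto simp: o_def intro!: continuous_intros g\<close>)
  with that g(2) l1 l2 show thesis by blast
qed

section \<open>Finite transport duality\<close>

lemma compact_finite_simplex:
  assumes "finite V"
  shows "compact {p :: 'v \<Rightarrow> real. (\<forall>z. 0 \<le> p z) \<and> (\<forall>z. z \<notin> V \<longrightarrow> p z = 0) \<and> sum p V = 1}"
    (is "compact ?S")
proof -
  let ?P = "PiE UNIV (\<lambda>z :: 'v. if z \<in> V then {0..1::real} else {0})"
  have "compactin (product_topology (\<lambda>_ :: 'v. euclideanreal) UNIV) ?P"
    unfolding compactin_PiE by auto
  then have cP: "compact ?P" by (simp add: euclidean_product_topology)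
  have "closed {p :: 'v \<Rightarrow> real. sum p V = 1}"
    by (intro closed_Collect_eq continuous_intros continuous_on_sum) auto
  moreover have eq: "?S = ?P \<inter> {p. sum p V = 1}"
  proof -
    have "p z \<le> 1" if "\<forall>z. 0 \<le> p z" "sum p V = 1" "z \<in> V" for p :: "'v \<Rightarrow> real" and z
      using member_le_sum[of z V p] that assms by auto
    then have "p \<in> ?P" if "p \<in> ?S" for p using that by (auto simp: PiE_iff)
    moreover have "p \<in> ?S" if "p \<in> ?P" "sum p V = 1" for p
    proof -
      have m: "p z \<in> (if z \<in> V then {0..1::real} else {0})" for z using PiE_mem[OF that(1), of z] by simp
      have "0 \<le> p z" "z \<notin> V \<longrightarrow> p z = 0" for z using m[of z] by (auto split: if_splits)
      with that(2) show ?thesis by simp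
    qed
    ultimately show ?thesis by blast
  qed
  ultimately show ?thesis unfolding eq by (intro compact_Int_closed[OF cP])
qed

text \<open>Gordan's theorem of the alternative. The vectors are indexed by an arbitrary finite set, so that
  the dimension may vary inside a proof. The separating functional \<open>h\<close> is the point of least norm in the
  convex hull of the vectors: moving from it towards a vertex cannot decrease the norm.\<close>

lemma gordan_alternative:
  fixes g :: "'v \<Rightarrow> 'k \<Rightarrow> real"
  assumes V: "finite V" "V \<noteq> {}" and K: "finite K"
    and no: "\<And>p. (\<And>z. z \<in> V \<Longrightarrow> 0 \<le> p z) \<Longrightarrow> sum p V = 1 \<Longrightarrow> (\<exists>k\<in>K. (\<Sum>z\<in>V. p z * g z k) \<noteq> 0)"
  obtains h where "\<And>z. z \<in> V \<Longrightarrow> (\<Sum>k\<in>K. h k * g z k) > 0"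
proof -
  define S where "S = {p :: 'v \<Rightarrow> real. (\<forall>z. 0 \<le> p z) \<and> (\<forall>z. z \<notin> V \<longrightarrow> p z = 0) \<and> sum p V = 1}"
  define r where "r p k = (\<Sum>z\<in>V. p z * g z k)" for p k
  define Q where "Q p = (\<Sum>k\<in>K. (r p k)\<^sup>2)" for p
  obtain z0 where "z0 \<in> V" using V by auto
  have vert: "(\<lambda>w. if w = z then 1 else 0) \<in> S" if "z \<in> V" for z
    unfolding S_def using that V by auto
  have cS: "compact S" unfolding S_def by (rule compact_finite_simplex[OF V(1)])
  have "continuous_on S Q" unfolding Q_def r_def
    by (intro continuous_intros continuous_on_subset[OF continuous_on_product_coordinates]) auto
  then obtain p where p: "p \<in> S" "\<And>q. q \<in> S \<Longrightarrow> Q p \<le> Q q"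
    using continuous_attains_inf[OF cS _ \<open>continuous_on S Q\<close>] vert[OF \<open>z0 \<in> V\<close>] by blast
  obtain k where "k \<in> K" "r p k \<noteq> 0" using no[of p] p(1) unfolding S_def r_def by auto
  then have Qpos: "Q p > 0" unfolding Q_def by (intro sum_pos2[OF K]) auto
  have "(\<Sum>k\<in>K. r p k * g z k) > 0" if z: "z \<in> V" for z
  proof -
    define e where "e = (\<lambda>w. if w = z then 1 else 0 :: real)"
    have e: "e \<in> S" using vert[OF z] unfolding e_def .
    have re: "r e k = g z k" for k
      unfolding r_def e_def using V z by (simp add: if_distrib[of "\<lambda>x. x * _"] cong: if_cong)
    define A where "A = (\<Sum>k\<in>K. r p k * (g z k - r p k))"
    define B where "B = (\<Sum>k\<in>K. (g z k - r p k)\<^sup>2)"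
    have step: "0 \<le> 2 * s * A + s\<^sup>2 * B" if s: "0 < s" "s \<le> 1" for s
    proof -
      define q where "q w = (1 - s) * p w + s * e w" for w
      have "q \<in> S" using p(1) e s unfolding S_def q_def
        by (auto simp: sum.distrib sum_distrib_left[symmetric])
      have rq: "r q k = r p k + s * (g z k - r p k)" for k
      proof -
        have "r q k = (1 - s) * r p k + s * r e k"
          unfolding r_def q_def by (simp add: algebra_simps sum.distrib sum_distrib_left sum_subtractf)
        then show ?thesis by (simp add: re algebra_simps)
      qed
      have "Q q = (\<Sum>k\<in>K. (r p k)\<^sup>2 + 2 * s * (r p k * (g z k - r p k)) + s\<^sup>2 * (g z k - r p k)\<^sup>2)"
        unfolding Q_def rq by (intro sum.cong refl) (simp add: power2_eq_square algebra_simps)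
      then have "Q q = Q p + 2 * s * A + s\<^sup>2 * B"
        unfolding Q_def A_def B_def by (simp add: sum.distrib sum_distrib_left)
      then show ?thesis using p(2)[OF \<open>q \<in> S\<close>] by simp
    qed
    have "A \<ge> 0"
    proof (rule ccontr)
      assume "\<not> A \<ge> 0"
      have "B \<ge> 0" unfolding B_def by (intro sum_nonneg) auto
      \<comment> \<open>a step so short that the linear term dominates the quadratic one\<close>
      define s where "s = min 1 (- A / (B + 1))"
      have s: "0 < s" "s \<le> 1" using \<open>\<not> A \<ge> 0\<close> \<open>B \<ge> 0\<close> unfolding s_def by (auto simp: divide_less_0_iff)
      have "s \<le> - A / (B + 1)" unfolding s_def by simp
      then have "s * (B + 1) \<le> - A" using \<open>B \<ge> 0\<close> by (subst (asm) pos_le_divide_eq) auto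
      then have "s * B < - 2 * A" using \<open>\<not> A \<ge> 0\<close> s by (simp add: algebra_simps)
      then have "s * (2 * A + s * B) < 0" using s by (simp add: mult_pos_neg)
      then show False using step[OF s] by (simp add: algebra_simps power2_eq_square)
    qed
    moreover have "A = (\<Sum>k\<in>K. r p k * g z k) - Q p"
      unfolding A_def Q_def by (simp add: algebra_simps power2_eq_square sum_subtractf)
    ultimately show ?thesis using Qpos by simp
  qed
  then show thesis using that by blast
qed

definition finite_plan :: "'i set \<Rightarrow> ('i \<Rightarrow> real) \<Rightarrow> ('i \<Rightarrow> real) \<Rightarrow> ('i \<times> 'i \<Rightarrow> real) \<Rightarrow> bool" where
  "finite_plan F a b p \<longleftrightarrow> (\<forall>z\<in>F \<times> F. 0 \<le> p z) \<and>
     (\<forall>i\<in>F. (\<Sum>j\<in>F. p (i, j)) = a i) \<and> (\<forall>j\<in>F. (\<Sum>i\<in>F. p (i, j)) = b j)"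

text \<open>The marginal constraints together with the constraint that the cost equals \<open>\<tau>\<close>, a number slightly
  below the infimum, have no common solution. Gordan's alternative turns this into multipliers; the
  multiplier \<open>w\<close> of the cost is positive because plans exist, and dividing by it gives the dual
  variables, whose value is exactly \<open>\<tau>\<close>.\<close>

lemma finite_transport_duality:
  fixes C :: "'i \<times> 'i \<Rightarrow> real"
  assumes F: "finite F" and a: "\<And>i. i \<in> F \<Longrightarrow> 0 \<le> a i" "sum a F = 1"
    and b: "\<And>i. i \<in> F \<Longrightarrow> 0 \<le> b i" "sum b F = 1" and "\<epsilon> > 0"
  obtains p u v where "finite_plan F a b p" "\<And>i j. i \<in> F \<Longrightarrow> j \<in> F \<Longrightarrow> u i + v j \<le> C (i, j)"
    "(\<Sum>z\<in>F \<times> F. p z * C z) \<le> (\<Sum>i\<in>F. u i * a i) + (\<Sum>j\<in>F. v j * b j) + \<epsilon>"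
proof -
  define cost where "cost p = (\<Sum>z\<in>F \<times> F. p z * C z)" for p
  define P where "P = {p. finite_plan F a b p}"
  have Fne: "F \<noteq> {}" using a by auto
  have prod: "(\<lambda>(i, j). a i * b j) \<in> P"
    unfolding P_def finite_plan_def using a b
    by (auto simp: sum_distrib_left[symmetric] sum_distrib_right[symmetric])
  have tot: "sum p (F \<times> F) = 1" if "finite_plan F a b p" for p
  proof -
    have "sum p (F \<times> F) = (\<Sum>i\<in>F. \<Sum>j\<in>F. p (i, j))" by (simp add: sum.cartesian_product)
    also have "\<dots> = sum a F" using that unfolding finite_plan_def by (intro sum.cong) auto
    finally show ?thesis using a by simp
  qed
  have bdd: "bdd_below (cost ` P)"
  proof (rule bdd_belowI2)
    fix p assume "p \<in> P"
    then have p: "finite_plan F a b p" unfolding P_def by simp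
    have le1: "p z \<le> 1" if "z \<in> F \<times> F" for z
      using member_le_sum[of z "F \<times> F" p] tot[OF p] p F that unfolding finite_plan_def by auto
    show "- (\<Sum>z\<in>F \<times> F. \<bar>C z\<bar>) \<le> cost p"
      unfolding cost_def sum_negf[symmetric]
    proof (rule sum_mono)
      fix z assume z: "z \<in> F \<times> F"
      have "\<bar>p z * C z\<bar> \<le> 1 * \<bar>C z\<bar>" unfolding abs_mult
        by (rule mult_right_mono) (use le1[OF z] p z in \<open>auto simp: finite_plan_def\<close>)
      then show "- \<bar>C z\<bar> \<le> p z * C z" by simp
    qed
  qed
  define m where "m = Inf (cost ` P)"
  define \<tau> where "\<tau> = m - \<epsilon> / 2"
  obtain p where p: "p \<in> P" "cost p < m + \<epsilon> / 2"
    using cInf_lessD[of "cost ` P" "m + \<epsilon> / 2"] prod \<open>\<epsilon> > 0\<close> unfolding m_def by auto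
  have low: "m \<le> cost q" if "q \<in> P" for q
    unfolding m_def by (rule cINF_lower[OF bdd that])
  define V where "V = F \<times> F"
  \<comment> \<open>None is the cost constraint, Inl and Inr are the two families of marginal constraints\<close>
  define K where "K = insert None (Some ` (Inl ` F \<union> Inr ` F :: ('i + 'i) set))"
  define g where "g z k = (case k of None \<Rightarrow> C z - \<tau>
      | Some (Inl i) \<Rightarrow> (if fst z = i then 1 else 0) - a i
      | Some (Inr j) \<Rightarrow> (if snd z = j then 1 else 0) - b j)" for z k
  have finV: "finite V" "V \<noteq> {}" using F Fne unfolding V_def by auto
  have finK: "finite K" using F unfolding K_def by auto
  have sumK: "(\<Sum>k\<in>K. h k) = h None + (\<Sum>i\<in>F. h (Some (Inl i))) + (\<Sum>j\<in>F. h (Some (Inr j)))" for h :: "_ \<Rightarrow> real"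
  proof -
    have "(\<Sum>k\<in>K. h k) = h None + (\<Sum>k\<in>Some ` (Inl ` F \<union> Inr ` F). h k)"
      unfolding K_def using F by (subst sum.insert) auto
    also have "(\<Sum>k\<in>Some ` (Inl ` F \<union> Inr ` F). h k) = (\<Sum>k\<in>(Inl ` F \<union> Inr ` F). h (Some k))"
      by (subst sum.reindex) (auto simp: inj_on_def)
    also have "\<dots> = (\<Sum>k\<in>Inl ` F. h (Some k)) + (\<Sum>k\<in>Inr ` F. h (Some k))"
      using F by (intro sum.union_disjoint) auto
    also have "\<dots> = (\<Sum>i\<in>F. h (Some (Inl i))) + (\<Sum>j\<in>F. h (Some (Inr j)))"
      by (simp add: sum.reindex inj_on_def)
    finally show ?thesis by simp
  qed
  have row: "(\<Sum>z\<in>V. q z * (if fst z = i then 1 else 0)) = (\<Sum>j\<in>F. q (i, j))" if "i \<in> F" for q :: "_ \<Rightarrow> real" and i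
  proof -
    have "(\<Sum>z\<in>V. q z * (if fst z = i then 1 else 0)) = (\<Sum>i'\<in>F. \<Sum>j\<in>F. q (i', j) * (if i' = i then 1 else 0))"
      unfolding V_def by (simp add: sum.cartesian_product case_prod_unfold)
    also have "\<dots> = (\<Sum>i'\<in>F. if i' = i then \<Sum>j\<in>F. q (i', j) else 0)"
      by (intro sum.cong) auto
    finally show ?thesis using that F by simp
  qed
  have col: "(\<Sum>z\<in>V. q z * (if snd z = j then 1 else 0)) = (\<Sum>i\<in>F. q (i, j))" if "j \<in> F" for q :: "_ \<Rightarrow> real" and j
  proof -
    have "(\<Sum>z\<in>V. q z * (if snd z = j then 1 else 0)) = (\<Sum>i\<in>F. \<Sum>j'\<in>F. q (i, j') * (if j' = j then 1 else 0))"
      unfolding V_def by (simp add: sum.cartesian_product case_prod_unfold)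
    also have "\<dots> = (\<Sum>i\<in>F. \<Sum>j'\<in>F. if j' = j then q (i, j') else 0)"
      by (intro sum.cong) auto
    finally show ?thesis using that F by simp
  qed
  have comb: "(\<Sum>z\<in>V. q z * g z None) = cost q - \<tau>"
    "\<And>i. i \<in> F \<Longrightarrow> (\<Sum>z\<in>V. q z * g z (Some (Inl i))) = (\<Sum>j\<in>F. q (i, j)) - a i"
    "\<And>j. j \<in> F \<Longrightarrow> (\<Sum>z\<in>V. q z * g z (Some (Inr j))) = (\<Sum>i\<in>F. q (i, j)) - b j"
    if "sum q V = 1" for q
    using that row[of _ q] col[of _ q] unfolding g_def cost_def V_def[symmetric]
    by (auto simp: right_diff_distrib sum_subtractf sum_distrib_right[symmetric])
  obtain h where h: "\<And>z. z \<in> V \<Longrightarrow> (\<Sum>k\<in>K. h k * g z k) > 0"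
  proof (rule gordan_alternative[OF finV finK, of g])
    fix q :: "'i \<times> 'i \<Rightarrow> real" assume q: "\<And>z. z \<in> V \<Longrightarrow> 0 \<le> q z" "sum q V = 1"
    show "\<exists>k\<in>K. (\<Sum>z\<in>V. q z * g z k) \<noteq> 0"
    proof (rule ccontr)
      assume "\<not> ?thesis"
      then have all0: "\<And>k. k \<in> K \<Longrightarrow> (\<Sum>z\<in>V. q z * g z k) = 0" by blast
      have "finite_plan F a b q" unfolding finite_plan_def
        using q comb(2,3)[OF q(2)] all0 unfolding K_def V_def by auto
      moreover have "cost q = \<tau>" using comb(1)[OF q(2)] all0[of None] by (simp add: K_def)
      ultimately show False using low[of q] \<open>\<epsilon> > 0\<close> unfolding P_def \<tau>_def by simp
    qed
  qed blast
  define w where "w = h None"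
  define R where "R = (\<Sum>i\<in>F. h (Some (Inl i)) * a i) + (\<Sum>j\<in>F. h (Some (Inr j)) * b j)"
  have hz: "w * (C (i, j) - \<tau>) + h (Some (Inl i)) + h (Some (Inr j)) - R > 0" if "i \<in> F" "j \<in> F" for i j
  proof -
    have s1: "(\<Sum>i'\<in>F. h (Some (Inl i')) * g (i, j) (Some (Inl i'))) = h (Some (Inl i)) - (\<Sum>i\<in>F. h (Some (Inl i)) * a i)"
      unfolding g_def using F that by (simp add: right_diff_distrib sum_subtractf mult_delta_right)
    have s2: "(\<Sum>j'\<in>F. h (Some (Inr j')) * g (i, j) (Some (Inr j'))) = h (Some (Inr j)) - (\<Sum>j\<in>F. h (Some (Inr j)) * b j)"
      unfolding g_def using F that by (simp add: right_diff_distrib sum_subtractf mult_delta_right)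
    show ?thesis using h[of "(i, j)"] that unfolding sumK s1 s2 R_def w_def V_def by (simp add: g_def)
  qed
  have "w > 0"
  proof -
    have pp: "finite_plan F a b p" using p unfolding P_def by simp
    note t = tot[OF pp, folded V_def]
    have "0 < (\<Sum>z\<in>V. p z * (\<Sum>k\<in>K. h k * g z k))"
    proof -
      obtain z where "z \<in> V" "p z \<noteq> 0" using t by (metis sum.neutral zero_neq_one)
      then show ?thesis using pp h
        by (intro sum_pos2[OF finV(1) \<open>z \<in> V\<close>]) (auto simp: finite_plan_def V_def[symmetric] less_le)
    qed
    also have "\<dots> = (\<Sum>k\<in>K. h k * (\<Sum>z\<in>V. p z * g z k))"
      by (simp add: sum_distrib_left mult.left_commute) (rule sum.swap)
    also have "\<dots> = w * (cost p - \<tau>)"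
      unfolding sumK using comb[OF t] pp by (simp add: w_def finite_plan_def)
    finally show ?thesis using low[OF p(1)] \<open>\<epsilon> > 0\<close> unfolding \<tau>_def by (simp add: zero_less_mult_iff)
  qed
  define u where "u i = R / w + \<tau> - h (Some (Inl i)) / w" for i
  define v where "v j = - h (Some (Inr j)) / w" for j
  show thesis
  proof (rule that[of p u v])
    show "finite_plan F a b p" using p unfolding P_def by simp
    show "u i + v j \<le> C (i, j)" if "i \<in> F" "j \<in> F" for i j
    proof -
      have "u i + v j = (R + \<tau> * w - h (Some (Inl i)) - h (Some (Inr j))) / w"
        using \<open>w > 0\<close> unfolding u_def v_def by (simp add: add_divide_distrib diff_divide_distrib)
      also have "\<dots> \<le> C (i, j)"
        using hz[OF that] \<open>w > 0\<close> by (simp add: pos_divide_le_eq algebra_simps)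
      finally show ?thesis .
    qed
    have "(\<Sum>i\<in>F. u i * a i) = (R / w + \<tau>) - (\<Sum>i\<in>F. h (Some (Inl i)) * a i) / w"
      unfolding u_def by (simp add: left_diff_distrib sum_subtractf sum_distrib_left[symmetric] a sum_divide_distrib)
    moreover have "(\<Sum>j\<in>F. v j * b j) = - (\<Sum>j\<in>F. h (Some (Inr j)) * b j) / w"
      unfolding v_def by (simp add: sum_negf sum_divide_distrib)
    ultimately have "(\<Sum>i\<in>F. u i * a i) + (\<Sum>j\<in>F. v j * b j) = \<tau>"
      unfolding R_def by (simp add: add_divide_distrib)
    then show "(\<Sum>z\<in>F \<times> F. p z * C z) \<le> (\<Sum>i\<in>F. u i * a i) + (\<Sum>j\<in>F. v j * b j) + \<epsilon>"
      using p(2) unfolding cost_def \<tau>_def by simp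
  qed
qed

section \<open>Kantorovich duality up to an error\<close>

lemma borel_probs_prob: "\<mu> \<in> borel_probs S \<Longrightarrow> prob_space \<mu>"
  and borel_probs_sets: "\<mu> \<in> borel_probs S \<Longrightarrow> sets \<mu> = sets (restrict_space borel S)"
  and borel_probs_space: "\<mu> \<in> borel_probs S \<Longrightarrow> space \<mu> = S"
proof -
  show "\<mu> \<in> borel_probs S \<Longrightarrow> prob_space \<mu>" "\<mu> \<in> borel_probs S \<Longrightarrow> sets \<mu> = sets (restrict_space borel S)"
    unfolding borel_probs_def by auto
  then show "\<mu> \<in> borel_probs S \<Longrightarrow> space \<mu> = S"
    using sets_eq_imp_space_eq[of \<mu> "restrict_space borel S"] by (simp add: space_restrict_space)
qed

lemma borel_probs_measurable:
  fixes h :: "'a::topological_space \<Rightarrow> real"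
  assumes "\<mu> \<in> borel_probs S" "continuous_on S h"
  shows "h \<in> borel_measurable \<mu>"
  using borel_measurable_continuous_on_restrict[OF assms(2)] borel_probs_sets[OF assms(1)]
  by (simp cong: measurable_cong_sets)

lemma borel_probs_integrable:
  fixes h :: "'a::euclidean_space \<Rightarrow> real"
  assumes "\<mu> \<in> borel_probs S" "compact S" "continuous_on S h"
  shows "integrable \<mu> h"
proof -
  interpret prob_space \<mu> by (rule borel_probs_prob[OF assms(1)])
  obtain B where "\<And>x. x \<in> S \<Longrightarrow> norm (h x) \<le> B"
    using compact_imp_bounded[OF compact_continuous_image[OF assms(3,2)]]
    unfolding bounded_iff by auto
  then show ?thesis
    by (intro integrable_const_bound[of _ B] borel_probs_measurable[OF assms(1,3)])
      (auto simp: borel_probs_space[OF assms(1)])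
qed

text \<open>A finite measurable quantization \<open>s\<close>. Its cells \<open>{x \<in> \<Omega>. s x = p}\<close> carry the discrete transport
  problem, with the points \<open>p\<close> themselves as representatives.\<close>

lemma measurable_finite_net:
  fixes \<Omega> :: "'a::euclidean_space set"
  assumes "compact \<Omega>" "\<delta> > 0"
  obtains F and s :: "'a \<Rightarrow> 'a" where "finite F" "F \<subseteq> \<Omega>" "\<And>p. {x. s x = p} \<in> sets borel"
    "\<And>x. x \<in> \<Omega> \<Longrightarrow> s x \<in> F" "\<And>x. x \<in> \<Omega> \<Longrightarrow> dist x (s x) < \<delta>"
proof -
  have net: "\<exists>s. (\<forall>p. {x. s x = p} \<in> sets borel) \<and>
      (\<forall>x. (\<exists>p\<in>F. dist x p < \<delta>) \<longrightarrow> s x \<in> F \<and> dist x (s x) < \<delta>)" if "finite F" for F :: "'a set"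
    using that
  proof induction
    case empty
    have "{x :: 'a. 0 = p} \<in> sets borel" for p :: 'a by simp
    then show ?case by (intro exI[of _ "\<lambda>_. 0"]) simp
  next
    case (insert r F)
    then obtain s where s: "\<And>p. {x. s x = p} \<in> sets borel"
      "\<And>x. (\<exists>p\<in>F. dist x p < \<delta>) \<Longrightarrow> s x \<in> F \<and> dist x (s x) < \<delta>" by blast
    define s' where "s' x = (if dist x r < \<delta> then r else s x)" for x
    have "{x. s' x = p} \<in> sets borel" for p
    proof -
      have "{x. s' x = p} = (if p = r then ball r \<delta> else {}) \<union> ({x. s x = p} - ball r \<delta>)"
        unfolding s'_def by (auto simp: dist_commute)
      also have "\<dots> \<in> sets borel" using s(1) by auto
      finally show ?thesis .
    qed
    moreover have "s' x \<in> insert r F \<and> dist x (s' x) < \<delta>" if "\<exists>p\<in>insert r F. dist x p < \<delta>" for x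
      using that s(2)[of x] unfolding s'_def by auto
    ultimately show ?case by blast
  qed
  obtain F where F: "finite F" "F \<subseteq> \<Omega>" "\<Omega> \<subseteq> (\<Union>p\<in>F. ball p \<delta>)"
    using compactE_image[OF assms(1), of \<Omega> "\<lambda>p. ball p \<delta>"] assms(2) by (metis UN_I centre_in_ball open_ball subsetI)
  obtain s where s: "\<And>p. {x. s x = p} \<in> sets borel"
      "\<And>x. (\<exists>p\<in>F. dist x p < \<delta>) \<Longrightarrow> s x \<in> F \<and> dist x (s x) < \<delta>" using net[OF F(1)] by blast
  have "\<exists>p\<in>F. dist x p < \<delta>" if x: "x \<in> \<Omega>" for x
  proof -
    obtain p where "p \<in> F" "x \<in> ball p \<delta>" using F(3) x by blast
    then show ?thesis by (auto simp: dist_commute)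
  qed
  with s that[OF F(1,2), of s] show thesis by blast
qed

lemma borel_probs_cell:
  assumes "m \<in> borel_probs S" "{x. P x} \<in> sets borel"
  shows "{x \<in> S. P x} \<in> sets m"
proof -
  have "{x \<in> S. P x} = S \<inter> {x. P x}" by auto
  then show ?thesis
    unfolding borel_probs_sets[OF assms(1)] sets_restrict_space using assms(2) by (metis imageI)
qed

lemma borel_probs_projections:
  fixes S :: "'a::euclidean_space set"
  assumes "\<pi> \<in> borel_probs (S \<times> S)"
  shows "fst \<in> \<pi> \<rightarrow>\<^sub>M restrict_space borel S" "snd \<in> \<pi> \<rightarrow>\<^sub>M restrict_space borel S"
proof -
  have "(fst :: 'a \<times> 'a \<Rightarrow> 'a) \<in> restrict_space borel (S \<times> S) \<rightarrow>\<^sub>M borel"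
    "(snd :: 'a \<times> 'a \<Rightarrow> 'a) \<in> restrict_space borel (S \<times> S) \<rightarrow>\<^sub>M borel"
    by (rule borel_measurable_continuous_on_restrict, intro continuous_intros)+
  then have "fst \<in> \<pi> \<rightarrow>\<^sub>M (borel :: 'a measure)" "snd \<in> \<pi> \<rightarrow>\<^sub>M (borel :: 'a measure)"
    unfolding measurable_cong_sets[OF borel_probs_sets[OF assms] refl] .
  moreover have "fst \<in> space \<pi> \<rightarrow> S" "snd \<in> space \<pi> \<rightarrow> S"
    unfolding borel_probs_space[OF assms] by auto
  ultimately show "fst \<in> \<pi> \<rightarrow>\<^sub>M restrict_space borel S" "snd \<in> \<pi> \<rightarrow>\<^sub>M restrict_space borel S"
    by (simp_all only: measurable_restrict_space2)
qed

text \<open>Cells of measure 0 are harmless: there the plan vanishes as well, and division by 0 gives 0.\<close>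

lemma finite_plan_density:
  assumes "finite_plan F a b P" "finite F" "p \<in> F" "q \<in> F"
  shows "P (p, q) / (a p * b q) * a p * b q = P (p, q)"
proof -
  have nn: "\<And>p q. p \<in> F \<Longrightarrow> q \<in> F \<Longrightarrow> 0 \<le> P (p, q)" using assms(1) unfolding finite_plan_def by auto
  have "P (p, q) \<le> a p" "P (p, q) \<le> b q"
    using member_le_sum[of q F "\<lambda>q. P (p, q)"] member_le_sum[of p F "\<lambda>p. P (p, q)"] nn assms
    unfolding finite_plan_def by auto
  then show ?thesis using nn[of p q] assms by auto
qed

text \<open>A discrete plan \<open>P\<close> between the masses of the cells is spread over the cells: inside the product of two
  cells the coupling is proportional to \<open>\<mu> \<Otimes>\<^sub>M \<nu>\<close>, with density \<open>P (p, q) / (\<mu>(cell p) \<nu>(cell q))\<close>.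
  This keeps the exact marginals \<open>\<mu>\<close> and \<open>\<nu>\<close>.\<close>

lemma glued_plan:
  fixes \<Omega> :: "'a::euclidean_space set"
  assumes \<mu>: "\<mu> \<in> borel_probs \<Omega>" and \<nu>: "\<nu> \<in> borel_probs \<Omega>"
    and F: "finite F" and s: "\<And>p. {x. s x = p} \<in> sets borel" "\<And>x. x \<in> \<Omega> \<Longrightarrow> s x \<in> F"
    and P: "finite_plan F (\<lambda>p. measure \<mu> {x \<in> \<Omega>. s x = p}) (\<lambda>p. measure \<nu> {x \<in> \<Omega>. s x = p}) P"
  obtains \<pi> where "\<pi> \<in> transport_plans \<Omega> \<mu> \<nu>"
    "\<And>p q. p \<in> F \<Longrightarrow> q \<in> F \<Longrightarrow> measure \<pi> ({x \<in> \<Omega>. s x = p} \<times> {x \<in> \<Omega>. s x = q}) = P (p, q)"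
proof -
  interpret \<mu>: prob_space \<mu> by (rule borel_probs_prob[OF \<mu>])
  interpret \<nu>: prob_space \<nu> by (rule borel_probs_prob[OF \<nu>])
  interpret pair_prob_space \<mu> \<nu> ..
  note sp = borel_probs_space[OF \<mu>] borel_probs_space[OF \<nu>]
  define cell where "cell p = {x \<in> \<Omega>. s x = p}" for p
  define a where "a p = measure \<mu> (cell p)" for p
  define b where "b p = measure \<nu> (cell p)" for p
  note P' = P[folded cell_def, folded a_def b_def]
  have P0: "0 \<le> P (p, q)" if "p \<in> F" "q \<in> F" for p q using P that unfolding finite_plan_def by auto
  have cell\<mu>: "cell p \<in> sets \<mu>" and cell\<nu>: "cell p \<in> sets \<nu>" for p
    unfolding cell_def by (rule borel_probs_cell[OF \<mu> s(1)], rule borel_probs_cell[OF \<nu> s(1)])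
  define G where "G p q = P (p, q) / (a p * b q)" for p q
  have G0: "0 \<le> G p q" if "p \<in> F" "q \<in> F" for p q
    using P0[OF that] unfolding G_def a_def b_def by simp
  define g where "g z = (\<Sum>p\<in>F. \<Sum>q\<in>F. ennreal (G p q) * indicator (cell p \<times> cell q) z)" for z :: "'a \<times> 'a"
  have cells: "cell p \<times> cell q \<in> sets (\<mu> \<Otimes>\<^sub>M \<nu>)" for p q using cell\<mu> cell\<nu> by simp
  have g_meas: "g \<in> borel_measurable (\<mu> \<Otimes>\<^sub>M \<nu>)"
    unfolding g_def using cells by measurable
  define D where "D = density (\<mu> \<Otimes>\<^sub>M \<nu>) g"
  \<comment> \<open>pushing forward by the identity replaces the product sigma-algebra by the Borel sets of the square\<close>
  define \<pi> where "\<pi> = distr D (restrict_space borel (\<Omega> \<times> \<Omega>)) (\<lambda>z. z)"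
  have idm: "(\<lambda>z. z) \<in> D \<rightarrow>\<^sub>M restrict_space borel (\<Omega> \<times> \<Omega>)"
  proof (rule measurable_restrict_space2)
    show "(\<lambda>z. z) \<in> space D \<rightarrow> \<Omega> \<times> \<Omega>" by (auto simp: D_def space_pair_measure sp)
    have "(\<lambda>x. x) \<in> \<mu> \<rightarrow>\<^sub>M borel" "(\<lambda>x. x) \<in> \<nu> \<rightarrow>\<^sub>M borel"
      using borel_probs_sets[OF \<mu>] borel_probs_sets[OF \<nu>]
      by (auto simp: measurable_restrict_space1 cong: measurable_cong_sets)
    then have "(\<lambda>z. (fst z, snd z)) \<in> (\<mu> \<Otimes>\<^sub>M \<nu>) \<rightarrow>\<^sub>M borel \<Otimes>\<^sub>M borel"
      by (intro measurable_Pair measurable_compose[OF measurable_fst] measurable_compose[OF measurable_snd])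
    then show "(\<lambda>z. z) \<in> D \<rightarrow>\<^sub>M borel" unfolding borel_prod by (simp add: D_def)
  qed
  \<comment> \<open>everything about the plan is read off from its values on rectangles\<close>
  have rect: "emeasure \<pi> (X \<times> Y) = ennreal (\<Sum>p\<in>F. \<Sum>q\<in>F. G p q * measure \<mu> (X \<inter> cell p) * measure \<nu> (Y \<inter> cell q))"
    if X: "X \<in> sets \<mu>" and Y: "Y \<in> sets \<nu>" for X Y
  proof -
    have XY: "X \<times> Y \<in> sets (\<mu> \<Otimes>\<^sub>M \<nu>)" using X Y by simp
    have XYr: "X \<times> Y \<in> sets (restrict_space borel (\<Omega> \<times> \<Omega>))"
    proof -
      obtain X' Y' where "X' \<in> sets borel" "X = \<Omega> \<inter> X'" "Y' \<in> sets borel" "Y = \<Omega> \<inter> Y'"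
        using X Y unfolding borel_probs_sets[OF \<mu>] borel_probs_sets[OF \<nu>] sets_restrict_space by auto
      then have "X \<times> Y = (\<Omega> \<times> \<Omega>) \<inter> (X' \<times> Y')" "X' \<times> Y' \<in> sets borel"
        by (auto simp: borel_Times)
      then show ?thesis unfolding sets_restrict_space by blast
    qed
    have "emeasure \<pi> (X \<times> Y) = emeasure D ((\<lambda>z. z) -` (X \<times> Y) \<inter> space D)"
      unfolding \<pi>_def using idm XYr by (rule emeasure_distr)
    also have "(\<lambda>z. z) -` (X \<times> Y) \<inter> space D = X \<times> Y"
      using sets.sets_into_space[OF XY] by (auto simp: D_def)
    also have "emeasure D (X \<times> Y) = (\<integral>\<^sup>+z. g z * indicator (X \<times> Y) z \<partial>(\<mu> \<Otimes>\<^sub>M \<nu>))"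
      unfolding D_def using g_meas XY by (rule emeasure_density)
    also have "\<dots> = (\<integral>\<^sup>+z. (\<Sum>p\<in>F. \<Sum>q\<in>F. ennreal (G p q) * indicator ((X \<inter> cell p) \<times> (Y \<inter> cell q)) z) \<partial>(\<mu> \<Otimes>\<^sub>M \<nu>))"
      unfolding g_def sum_distrib_right
      by (intro nn_integral_cong sum.cong refl) (auto simp: indicator_def split: if_splits)
    also have "\<dots> = (\<Sum>p\<in>F. \<Sum>q\<in>F. ennreal (G p q) * emeasure (\<mu> \<Otimes>\<^sub>M \<nu>) ((X \<inter> cell p) \<times> (Y \<inter> cell q)))"
      using X Y cell\<mu> cell\<nu>
      by (subst nn_integral_sum, measurable)+ (auto intro!: sum.cong nn_integral_cmult_indicator)
    also have "\<dots> = (\<Sum>p\<in>F. \<Sum>q\<in>F. ennreal (G p q * measure \<mu> (X \<inter> cell p) * measure \<nu> (Y \<inter> cell q)))"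
      using X Y cell\<mu> cell\<nu> G0
      by (intro sum.cong refl) (simp add: \<nu>.emeasure_pair_measure_Times \<mu>.emeasure_eq_measure \<nu>.emeasure_eq_measure ennreal_mult mult.assoc)
    also have "\<dots> = (\<Sum>p\<in>F. ennreal (\<Sum>q\<in>F. G p q * measure \<mu> (X \<inter> cell p) * measure \<nu> (Y \<inter> cell q)))"
      by (intro sum.cong refl sum_ennreal) (auto intro!: mult_nonneg_nonneg G0)
    also have "\<dots> = ennreal (\<Sum>p\<in>F. \<Sum>q\<in>F. G p q * measure \<mu> (X \<inter> cell p) * measure \<nu> (Y \<inter> cell q))"
      by (intro sum_ennreal) (auto intro!: sum_nonneg mult_nonneg_nonneg G0)
    finally show ?thesis .
  qed
  have cellI: "cell p \<inter> cell q = (if p = q then cell p else {})" for p q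
    unfolding cell_def by auto
  have GP: "G p q * a p * b q = P (p, q)" if "p \<in> F" "q \<in> F" for p q
    unfolding G_def using finite_plan_density[OF P' F that] .
  have cellP: "measure \<pi> (cell p \<times> cell q) = P (p, q)" if "p \<in> F" "q \<in> F" for p q
  proof -
    have "emeasure \<pi> (cell p \<times> cell q) = ennreal (\<Sum>p'\<in>F. if p' = p then \<Sum>q'\<in>F. if q' = q then G p q * a p * b q else 0 else 0)"
      unfolding rect[OF cell\<mu> cell\<nu>] cellI a_def b_def
      by (intro arg_cong[where f = ennreal] sum.cong refl) (auto intro!: sum.cong)
    also have "\<dots> = ennreal (P (p, q))" using that F GP[OF that] by simp
    finally show ?thesis using P0[OF that] by (simp add: measure_def)
  qed
  have UN: "\<Omega> = (\<Union>p\<in>F. cell p)" using s(2) unfolding cell_def by auto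
  have split: "measure m X = (\<Sum>p\<in>F. measure m (X \<inter> cell p))" if m: "m \<in> borel_probs \<Omega>" and X: "X \<in> sets m" for m X
  proof -
    interpret m: prob_space m by (rule borel_probs_prob[OF m])
    have cells_m: "cell p \<in> sets m" for p unfolding cell_def by (rule borel_probs_cell[OF m s(1)])
    have "X = (\<Union>p\<in>F. X \<inter> cell p)" using UN sets.sets_into_space[OF X] borel_probs_space[OF m] by auto
    also have "measure m \<dots> = (\<Sum>p\<in>F. measure m (X \<inter> cell p))"
      using X cells_m F by (intro m.finite_measure_finite_Union) (auto simp: disjoint_family_on_def cell_def)
    finally show ?thesis .
  qed
  have \<Omega>m: "\<Omega> \<in> sets \<mu>" "\<Omega> \<in> sets \<nu>" using sets.top[of \<mu>] sets.top[of \<nu>] sp by auto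
  have \<Omega>cell: "\<Omega> \<inter> cell p = cell p" for p unfolding cell_def by auto
  have m1: "emeasure \<pi> (X \<times> \<Omega>) = emeasure \<mu> X" if X: "X \<in> sets \<mu>" for X
  proof -
    have "(\<Sum>q\<in>F. G p q * measure \<mu> (X \<inter> cell p) * measure \<nu> (\<Omega> \<inter> cell q)) = measure \<mu> (X \<inter> cell p)" if "p \<in> F" for p
    proof (cases "a p = 0")
      case True
      then have "measure \<mu> (X \<inter> cell p) = 0"
        using \<mu>.finite_measure_mono[of "X \<inter> cell p" "cell p"] cell\<mu> unfolding a_def
        by (simp add: measure_le_0_iff)
      then show ?thesis by simp
    next
      case False
      have "(\<Sum>q\<in>F. G p q * measure \<mu> (X \<inter> cell p) * measure \<nu> (\<Omega> \<inter> cell q)) =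
            (\<Sum>q\<in>F. P (p, q)) * (measure \<mu> (X \<inter> cell p) / a p)"
        unfolding \<Omega>cell sum_distrib_right b_def[symmetric]
        by (intro sum.cong refl) (use GP[OF that] False in \<open>simp add: field_simps\<close>)
      also have "(\<Sum>q\<in>F. P (p, q)) = a p" using P' that unfolding finite_plan_def by blast
      finally show ?thesis using False by simp
    qed
    then have "(\<Sum>p\<in>F. \<Sum>q\<in>F. G p q * measure \<mu> (X \<inter> cell p) * measure \<nu> (\<Omega> \<inter> cell q)) = measure \<mu> X"
      using split[OF \<mu> X] by simp
    then show ?thesis
      unfolding rect[OF X \<Omega>m(2)] \<mu>.emeasure_eq_measure by simp
  qed
  have m2: "emeasure \<pi> (\<Omega> \<times> Y) = emeasure \<nu> Y" if Y: "Y \<in> sets \<nu>" for Y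
  proof -
    have "(\<Sum>p\<in>F. G p q * measure \<mu> (\<Omega> \<inter> cell p) * measure \<nu> (Y \<inter> cell q)) = measure \<nu> (Y \<inter> cell q)" if "q \<in> F" for q
    proof (cases "b q = 0")
      case True
      then have "measure \<nu> (Y \<inter> cell q) = 0"
        using \<nu>.finite_measure_mono[of "Y \<inter> cell q" "cell q"] cell\<nu> unfolding b_def
        by (simp add: measure_le_0_iff)
      then show ?thesis by simp
    next
      case False
      have "(\<Sum>p\<in>F. G p q * measure \<mu> (\<Omega> \<inter> cell p) * measure \<nu> (Y \<inter> cell q)) =
            (\<Sum>p\<in>F. P (p, q)) * (measure \<nu> (Y \<inter> cell q) / b q)"
        unfolding \<Omega>cell sum_distrib_right a_def[symmetric]
        by (intro sum.cong refl) (use GP[OF _ that] False in \<open>simp add: field_simps\<close>)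
      also have "(\<Sum>p\<in>F. P (p, q)) = b q" using P' that unfolding finite_plan_def by blast
      finally show ?thesis using False by simp
    qed
    then have "(\<Sum>q\<in>F. \<Sum>p\<in>F. G p q * measure \<mu> (\<Omega> \<inter> cell p) * measure \<nu> (Y \<inter> cell q)) = measure \<nu> Y"
      using split[OF \<nu> Y] by simp
    then show ?thesis
      unfolding rect[OF \<Omega>m(1) Y] \<nu>.emeasure_eq_measure by (subst sum.swap) (rule arg_cong[where f = ennreal])
  qed
  have sets\<pi>: "sets \<pi> = sets (restrict_space borel (\<Omega> \<times> \<Omega>))" unfolding \<pi>_def by simp
  have space\<pi>: "space \<pi> = \<Omega> \<times> \<Omega>" unfolding \<pi>_def by (simp add: space_restrict_space)
  have "prob_space \<pi>"
    using m1[OF \<Omega>m(1)] \<mu>.emeasure_space_1 sp space\<pi> by (intro prob_spaceI) simp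
  then have "\<pi> \<in> borel_probs (\<Omega> \<times> \<Omega>)" using sets\<pi> unfolding borel_probs_def by simp
  note fstm = borel_probs_projections(1)[OF \<open>\<pi> \<in> borel_probs (\<Omega> \<times> \<Omega>)\<close>]
  note sndm = borel_probs_projections(2)[OF \<open>\<pi> \<in> borel_probs (\<Omega> \<times> \<Omega>)\<close>]
  have "distr \<pi> (restrict_space borel \<Omega>) fst = \<mu>"
  proof (rule measure_eqI)
    fix X assume "X \<in> sets (distr \<pi> (restrict_space borel \<Omega>) fst)"
    then have X: "X \<in> sets (restrict_space borel \<Omega>)" by simp
    then have X\<mu>: "X \<in> sets \<mu>" using borel_probs_sets[OF \<mu>] by simp
    have "fst -` X \<inter> space \<pi> = X \<times> \<Omega>" using sets.sets_into_space[OF X\<mu>] sp space\<pi> by auto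
    then show "emeasure (distr \<pi> (restrict_space borel \<Omega>) fst) X = emeasure \<mu> X"
      using emeasure_distr[OF fstm X] m1[OF X\<mu>] by simp
  qed (simp add: borel_probs_sets[OF \<mu>])
  moreover have "distr \<pi> (restrict_space borel \<Omega>) snd = \<nu>"
  proof (rule measure_eqI)
    fix X assume "X \<in> sets (distr \<pi> (restrict_space borel \<Omega>) snd)"
    then have X: "X \<in> sets (restrict_space borel \<Omega>)" by simp
    then have X\<nu>: "X \<in> sets \<nu>" using borel_probs_sets[OF \<nu>] by simp
    have "snd -` X \<inter> space \<pi> = \<Omega> \<times> X" using sets.sets_into_space[OF X\<nu>] sp space\<pi> by auto
    then show "emeasure (distr \<pi> (restrict_space borel \<Omega>) snd) X = emeasure \<nu> X"
      using emeasure_distr[OF sndm X] m2[OF X\<nu>] by simp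
  qed (simp add: borel_probs_sets[OF \<nu>])
  ultimately have "\<pi> \<in> transport_plans \<Omega> \<mu> \<nu>"
    using \<open>\<pi> \<in> borel_probs (\<Omega> \<times> \<Omega>)\<close> unfolding transport_plans_def by simp
  with that cellP show thesis unfolding cell_def by blast
qed

lemma transport_cost_le:
  assumes "assumption_A3 \<Omega> c" "\<pi> \<in> transport_plans \<Omega> \<mu> \<nu>"
  shows "transport_cost \<Omega> c \<mu> \<nu> \<le> (\<integral>z. c z \<partial>\<pi>)"
  unfolding transport_cost_def
proof (rule cINF_lower[OF _ assms(2)], rule bdd_belowI2)
  fix \<pi> assume "\<pi> \<in> transport_plans \<Omega> \<mu> \<nu>"
  then have "space \<pi> = \<Omega> \<times> \<Omega>" using borel_probs_space unfolding transport_plans_def by blast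
  then show "0 \<le> (\<integral>z. c z \<partial>\<pi>)"
    using assms(1) unfolding assumption_A3_def by (intro integral_nonneg_AE) auto
qed

lemma integral_simple_fn:
  fixes m :: "'z measure" and h :: "'i \<Rightarrow> real"
  assumes "finite_measure m" "finite I" "\<And>i. i \<in> I \<Longrightarrow> E i \<in> sets m"
    and "\<And>z. z \<in> space m \<Longrightarrow> t z \<in> I" and "\<And>z i. z \<in> space m \<Longrightarrow> i \<in> I \<Longrightarrow> z \<in> E i \<longleftrightarrow> t z = i"
  shows "integrable m (\<lambda>z. h (t z))" "(\<integral>z. h (t z) \<partial>m) = (\<Sum>i\<in>I. h i * measure m (E i))"
proof -
  interpret finite_measure m by fact
  have eq: "h (t z) = (\<Sum>i\<in>I. h i * indicator (E i) z)" if "z \<in> space m" for z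
  proof -
    have "(\<Sum>i\<in>I. h i * indicator (E i) z) = (\<Sum>i\<in>I. if t z = i then h i else 0)"
      using assms(5)[OF that] by (intro sum.cong refl) (auto simp: indicator_def)
    then show ?thesis using assms(2) assms(4)[OF that] by simp
  qed
  have int: "integrable m (\<lambda>z. h i * indicator (E i) z :: real)" if "i \<in> I" for i
    using assms(3)[OF that] by (intro integrable_mult_right integrable_real_indicator) (auto simp: less_top[symmetric])
  then have "integrable m (\<lambda>z. \<Sum>i\<in>I. h i * indicator (E i) z :: real)" by (rule Bochner_Integration.integrable_sum)
  then show "integrable m (\<lambda>z. h (t z))"
    by (subst Bochner_Integration.integrable_cong[OF refl eq])
  have "(\<integral>z. h (t z) \<partial>m) = (\<integral>z. (\<Sum>i\<in>I. h i * indicator (E i) z) \<partial>m)"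
    by (rule Bochner_Integration.integral_cong[OF refl eq])
  also have "\<dots> = (\<Sum>i\<in>I. h i * measure m (E i))"
    by (subst Bochner_Integration.integral_sum[OF int])
      (auto intro!: sum.cong simp: assms(3) Int_absorb2[OF sets.sets_into_space[OF assms(3)]])
  finally show "(\<integral>z. h (t z) \<partial>m) = (\<Sum>i\<in>I. h i * measure m (E i))" .
qed

text \<open>Strong duality up to \<open>\<epsilon>\<close>. On cells so small that the cost varies by less than \<open>\<epsilon> / 3\<close>, the problem
  reduces to finite transport duality. One third of \<open>\<epsilon>\<close> is lost there, one when the discrete plan is
  glued, and one when the discrete dual variables are lowered to satisfy the constraint for \<open>c\<close>.\<close>

theorem kantorovich_duality_approx:
  fixes \<Omega> :: "'a::euclidean_space set"
  assumes "compact \<Omega>" and A3: "assumption_A3 \<Omega> c"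
    and \<mu>: "\<mu> \<in> borel_probs \<Omega>" and \<nu>: "\<nu> \<in> borel_probs \<Omega>" and "\<epsilon> > 0"
  obtains \<phi> \<psi> where "conj_pair \<Omega> c \<phi> \<psi>"
    "transport_cost \<Omega> c \<mu> \<nu> \<le> (\<integral>x. \<phi> x \<partial>\<mu>) + (\<integral>y. \<psi> y \<partial>\<nu>) + \<epsilon>"
proof -
  interpret \<mu>: prob_space \<mu> by (rule borel_probs_prob[OF \<mu>])
  interpret \<nu>: prob_space \<nu> by (rule borel_probs_prob[OF \<nu>])
  have c: "continuous_on (\<Omega> \<times> \<Omega>) c" using A3 unfolding assumption_A3_def by blast
  have ne: "\<Omega> \<noteq> {}" using \<mu>.not_empty borel_probs_space[OF \<mu>] by simp
  define e where "e = \<epsilon> / 3"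
  have "e > 0" using \<open>\<epsilon> > 0\<close> unfolding e_def by simp
  obtain d where d: "d > 0"
    "\<And>x x' y y'. x \<in> \<Omega> \<Longrightarrow> x' \<in> \<Omega> \<Longrightarrow> y \<in> \<Omega> \<Longrightarrow> y' \<in> \<Omega> \<Longrightarrow> dist x x' < d \<Longrightarrow> dist y y' < d \<Longrightarrow>
       \<bar>c (x, y) - c (x', y')\<bar> < e"
    using cost_uniform_modulus[OF assms(1) c \<open>e > 0\<close>] by blast
  obtain F s where F: "finite F" "F \<subseteq> \<Omega>" and sm: "\<And>p. {x. s x = p} \<in> sets borel"
    and s: "\<And>x. x \<in> \<Omega> \<Longrightarrow> s x \<in> F" "\<And>x. x \<in> \<Omega> \<Longrightarrow> dist x (s x) < d"
    using measurable_finite_net[OF assms(1) d(1)] by blast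
  define cell where "cell p = {x \<in> \<Omega>. s x = p}" for p
  have cell_in: "cell p \<in> sets m" if "m \<in> borel_probs \<Omega>" for m p
    unfolding cell_def by (rule borel_probs_cell[OF that sm])
  have int1: "integrable m (\<lambda>x. h (s x))" "(\<integral>x. h (s x) \<partial>m) = (\<Sum>p\<in>F. h p * measure m (cell p))"
    if "m \<in> borel_probs \<Omega>" for m and h :: "'a \<Rightarrow> real"
    using integral_simple_fn[of m F cell s h] that F(1) cell_in[OF that] s
      borel_probs_space[OF that] prob_space.finite_measure[OF borel_probs_prob[OF that]]
    by (auto simp: cell_def)
  have tot: "(\<Sum>p\<in>F. measure m (cell p)) = 1" if "m \<in> borel_probs \<Omega>" for m
    using int1(2)[OF that, of "\<lambda>_. 1"] prob_space.prob_space[OF borel_probs_prob[OF that]] by simp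
  obtain P u v where P: "finite_plan F (\<lambda>p. measure \<mu> (cell p)) (\<lambda>p. measure \<nu> (cell p)) P"
    and uv: "\<And>p q. p \<in> F \<Longrightarrow> q \<in> F \<Longrightarrow> u p + v q \<le> c (p, q)"
    and val: "(\<Sum>z\<in>F \<times> F. P z * c z) \<le> (\<Sum>p\<in>F. u p * measure \<mu> (cell p)) + (\<Sum>p\<in>F. v p * measure \<nu> (cell p)) + e"
    using finite_transport_duality[OF F(1) measure_nonneg tot[OF \<mu>] measure_nonneg tot[OF \<nu>] \<open>e > 0\<close>, of c]
    by blast
  obtain \<pi> where \<pi>: "\<pi> \<in> transport_plans \<Omega> \<mu> \<nu>"
    and \<pi>cell: "\<And>p q. p \<in> F \<Longrightarrow> q \<in> F \<Longrightarrow> measure \<pi> (cell p \<times> cell q) = P (p, q)"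
    using glued_plan[OF \<mu> \<nu> F(1) sm s(1), of P] P unfolding cell_def by blast
  have \<pi>p: "\<pi> \<in> borel_probs (\<Omega> \<times> \<Omega>)" using \<pi> unfolding transport_plans_def by blast
  interpret \<pi>: prob_space \<pi> by (rule borel_probs_prob[OF \<pi>p])
  have space\<pi>: "space \<pi> = \<Omega> \<times> \<Omega>" by (rule borel_probs_space[OF \<pi>p])
  define t where "t z = (s (fst z), s (snd z))" for z
  define E where "E z = cell (fst z) \<times> cell (snd z)" for z
  have E: "E z \<in> sets \<pi>" for z
  proof -
    have "E z = (\<Omega> \<times> \<Omega>) \<inter> ({x. s x = fst z} \<times> {x. s x = snd z})" unfolding E_def cell_def by auto
    moreover have "{x. s x = fst z} \<times> {x. s x = snd z} \<in> sets borel" by (intro borel_Times sm)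
    ultimately show ?thesis unfolding borel_probs_sets[OF \<pi>p] sets_restrict_space by blast
  qed
  have int\<pi>: "integrable \<pi> (\<lambda>z. c (t z))" "(\<integral>z. c (t z) \<partial>\<pi>) = (\<Sum>z\<in>F \<times> F. c z * measure \<pi> (E z))"
    using integral_simple_fn[of \<pi> "F \<times> F" E t c] F(1) E s \<pi>.finite_measure_axioms
    unfolding space\<pi> by (auto simp: t_def E_def cell_def)
  have cint: "integrable \<pi> c" by (rule borel_probs_integrable[OF \<pi>p compact_Times[OF assms(1,1)] c])
  have near: "\<bar>c z - c (t z)\<bar> < e" if "z \<in> \<Omega> \<times> \<Omega>" for z
  proof -
    have "fst z \<in> \<Omega>" "snd z \<in> \<Omega>" using that by auto
    then have "\<bar>c (fst z, snd z) - c (s (fst z), s (snd z))\<bar> < e" using s F(2) by (intro d(2)) auto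
    then show ?thesis by (simp add: t_def)
  qed
  have "(\<integral>z. c z \<partial>\<pi>) \<le> (\<integral>z. c (t z) + e \<partial>\<pi>)"
    using near int\<pi>(1) cint by (intro integral_mono) (auto simp: space\<pi> abs_less_iff less_imp_le dest!: near)
  also have "\<dots> = (\<Sum>z\<in>F \<times> F. P z * c z) + e"
    using int\<pi> \<pi>cell by (auto simp: E_def \<pi>.prob_space intro!: sum.cong)
  finally have up: "(\<integral>z. c z \<partial>\<pi>) \<le> (\<Sum>z\<in>F \<times> F. P z * c z) + e" .
  have "u (s x) - e + v (s y) \<le> c (x, y)" if "x \<in> \<Omega>" "y \<in> \<Omega>" for x y
    using uv[OF s(1)[OF that(1)] s(1)[OF that(2)]] near[of "(x, y)"] that unfolding t_def by auto
  then obtain \<phi> \<psi> where cp: "conj_pair \<Omega> c \<phi> \<psi>"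
    and ge: "\<And>x. x \<in> \<Omega> \<Longrightarrow> u (s x) - e \<le> \<phi> x" "\<And>y. y \<in> \<Omega> \<Longrightarrow> v (s y) \<le> \<psi> y"
    using conj_pair_above[OF assms(1) ne c, of "\<lambda>x. u (s x) - e" "\<lambda>y. v (s y)"] by blast
  have "(\<integral>x. u (s x) - e \<partial>\<mu>) \<le> (\<integral>x. \<phi> x \<partial>\<mu>)"
    by (rule integral_mono[OF _ borel_probs_integrable[OF \<mu> assms(1) conj_pair_continuous_fst[OF assms(1) c cp]]])
      (use ge int1(1)[OF \<mu>, of u] in \<open>auto simp: borel_probs_space[OF \<mu>]\<close>)
  moreover have "(\<integral>x. u (s x) - e \<partial>\<mu>) = (\<Sum>p\<in>F. u p * measure \<mu> (cell p)) - e"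
    using int1[OF \<mu>, of u] by (simp add: \<mu>.prob_space)
  moreover have "(\<integral>y. v (s y) \<partial>\<nu>) \<le> (\<integral>y. \<psi> y \<partial>\<nu>)"
    by (rule integral_mono[OF _ borel_probs_integrable[OF \<nu> assms(1) conj_pair_continuous_snd[OF assms(1) c cp]]])
      (use ge int1(1)[OF \<nu>, of v] in \<open>auto simp: borel_probs_space[OF \<nu>]\<close>)
  ultimately have "transport_cost \<Omega> c \<mu> \<nu> \<le> (\<integral>x. \<phi> x \<partial>\<mu>) + (\<integral>y. \<psi> y \<partial>\<nu>) + 3 * e"
    using transport_cost_le[OF A3 \<pi>] up val int1(2)[OF \<nu>, of v] by linarith
  with that cp show thesis unfolding e_def by simp
qed

section \<open>Optimal pairs of potentials\<close>

definition optimal_pair ::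
    "'a::euclidean_space set \<Rightarrow> ('a \<times> 'a \<Rightarrow> real) \<Rightarrow> 'a measure \<Rightarrow> 'a measure
      \<Rightarrow> ('a \<Rightarrow> real) \<Rightarrow> ('a \<Rightarrow> real) \<Rightarrow> bool" where
  "optimal_pair \<Omega> c \<mu> \<nu> \<phi> \<psi> \<longleftrightarrow> conj_pair \<Omega> c \<phi> \<psi> \<and>
     transport_cost \<Omega> c \<mu> \<nu> = (\<integral>x. \<phi> x \<partial>\<mu>) + (\<integral>y. \<psi> y \<partial>\<nu>)"

lemma transport_plan_integral:
  fixes \<phi> \<psi> :: "'a::euclidean_space \<Rightarrow> real"
  assumes "compact \<Omega>" "\<mu> \<in> borel_probs \<Omega>" "\<nu> \<in> borel_probs \<Omega>" "\<pi> \<in> transport_plans \<Omega> \<mu> \<nu>"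
    and "continuous_on \<Omega> \<phi>" "continuous_on \<Omega> \<psi>"
  shows "integrable \<pi> (\<lambda>z. \<phi> (fst z) + \<psi> (snd z))"
    and "(\<integral>z. \<phi> (fst z) + \<psi> (snd z) \<partial>\<pi>) = (\<integral>x. \<phi> x \<partial>\<mu>) + (\<integral>y. \<psi> y \<partial>\<nu>)"
proof -
  have \<pi>: "\<pi> \<in> borel_probs (\<Omega> \<times> \<Omega>)"
    and m: "distr \<pi> (restrict_space borel \<Omega>) fst = \<mu>" "distr \<pi> (restrict_space borel \<Omega>) snd = \<nu>"
    using assms(4) unfolding transport_plans_def by auto
  note pr = borel_probs_projections[OF \<pi>]
  have meas: "\<phi> \<in> borel_measurable (restrict_space borel \<Omega>)" "\<psi> \<in> borel_measurable (restrict_space borel \<Omega>)"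
    by (rule borel_measurable_continuous_on_restrict, fact)+
  have i: "integrable \<pi> (\<lambda>z. \<phi> (fst z))" "integrable \<pi> (\<lambda>z. \<psi> (snd z))"
    using integrable_distr[OF pr(1), of \<phi>] integrable_distr[OF pr(2), of \<psi>] unfolding m
    using borel_probs_integrable[OF assms(2,1,5)] borel_probs_integrable[OF assms(3,1,6)] by auto
  then show "integrable \<pi> (\<lambda>z. \<phi> (fst z) + \<psi> (snd z))" by simp
  show "(\<integral>z. \<phi> (fst z) + \<psi> (snd z) \<partial>\<pi>) = (\<integral>x. \<phi> x \<partial>\<mu>) + (\<integral>y. \<psi> y \<partial>\<nu>)"
    using integral_distr[OF pr(1) meas(1)] integral_distr[OF pr(2) meas(2)] i unfolding m by simp
qed

lemma transport_plans_nonempty: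
  fixes \<Omega> :: "'a::euclidean_space set"
  assumes "\<mu> \<in> borel_probs \<Omega>" "\<nu> \<in> borel_probs \<Omega>"
  shows "transport_plans \<Omega> \<mu> \<nu> \<noteq> {}"
proof -
  have one: "measure m \<Omega> = 1" if "m \<in> borel_probs \<Omega>" for m
    using prob_space.prob_space[OF borel_probs_prob[OF that]] borel_probs_space[OF that] by simp
  have "{x::'a. 0 = p} \<in> sets borel" for p :: 'a by simp
  moreover have "finite_plan {0} (\<lambda>p. measure \<mu> {x \<in> \<Omega>. 0 = p}) (\<lambda>p. measure \<nu> {x \<in> \<Omega>. 0 = p}) (\<lambda>_. 1)"
    unfolding finite_plan_def using one[OF assms(1)] one[OF assms(2)] by simp
  ultimately show ?thesis
    using glued_plan[OF assms, of "{0}" "\<lambda>_. 0" "\<lambda>_. 1"] by blast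
qed

text \<open>Both marginals of a plan are fixed, so the dual value is an integral against the plan itself.\<close>

lemma weak_duality:
  fixes \<Omega> :: "'a::euclidean_space set"
  assumes "compact \<Omega>" "\<mu> \<in> borel_probs \<Omega>" "\<nu> \<in> borel_probs \<Omega>" and c: "continuous_on (\<Omega> \<times> \<Omega>) c"
    and "continuous_on \<Omega> \<phi>" "continuous_on \<Omega> \<psi>"
    and le: "\<And>x y. x \<in> \<Omega> \<Longrightarrow> y \<in> \<Omega> \<Longrightarrow> \<phi> x + \<psi> y \<le> c (x, y)"
  shows "(\<integral>x. \<phi> x \<partial>\<mu>) + (\<integral>y. \<psi> y \<partial>\<nu>) \<le> transport_cost \<Omega> c \<mu> \<nu>"
  unfolding transport_cost_def
proof (rule cINF_greatest[OF transport_plans_nonempty[OF assms(2,3)]])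
  fix \<pi> assume p: "\<pi> \<in> transport_plans \<Omega> \<mu> \<nu>"
  then have \<pi>: "\<pi> \<in> borel_probs (\<Omega> \<times> \<Omega>)" unfolding transport_plans_def by auto
  note i = transport_plan_integral[OF assms(1-3) p assms(5,6)]
  show "(\<integral>x. \<phi> x \<partial>\<mu>) + (\<integral>y. \<psi> y \<partial>\<nu>) \<le> (\<integral>z. c z \<partial>\<pi>)"
    unfolding i(2)[symmetric]
    by (rule integral_mono[OF i(1) borel_probs_integrable[OF \<pi> compact_Times[OF assms(1,1)] c]])
      (use le in \<open>auto simp: borel_probs_space[OF \<pi>]\<close>)
qed

text \<open>Where \<open>h\<close> is positive it is positive on a neighbourhood, and neighbourhoods of points of the support have
  positive measure.\<close>

lemma vanishes_on_msupport:
  fixes h :: "'a::euclidean_space \<Rightarrow> real"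
  assumes "\<mu> \<in> borel_probs S" "compact S" "continuous_on S h" "\<And>x. x \<in> S \<Longrightarrow> 0 \<le> h x"
    and "(\<integral>x. h x \<partial>\<mu>) = 0" "x \<in> msupport \<mu>"
  shows "h x = 0"
proof (rule ccontr)
  assume "h x \<noteq> 0"
  note sp = borel_probs_space[OF assms(1)]
  have x: "x \<in> S" using assms(6) sp unfolding msupport_def by auto
  have "openin (top_of_set S) (S \<inter> h -` {0<..})"
    using assms(3) by (rule continuous_openin_preimage_gen) auto
  then obtain U where U: "open U" "S \<inter> h -` {0<..} = S \<inter> U" unfolding openin_open by blast
  have "x \<in> U" using U(2) x assms(4)[OF x] \<open>h x \<noteq> 0\<close> by auto
  then have pos: "emeasure \<mu> (U \<inter> S) > 0" using assms(6) U(1) sp unfolding msupport_def by auto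
  have "AE x in \<mu>. h x = 0"
    using assms(5) integral_nonneg_eq_0_iff_AE[OF borel_probs_integrable[OF assms(1-3)]] assms(4) sp by auto
  moreover have "h x > 0" if "x \<in> U \<inter> S" for x
  proof -
    have "x \<in> S \<inter> h -` {0<..}" using that unfolding U(2) by blast
    then show ?thesis by simp
  qed
  ultimately have "AE x in \<mu>. x \<notin> U \<inter> S" by (metis (mono_tags, lifting) AE_mp AE_I2 less_irrefl)
  moreover have "U \<inter> S \<in> sets \<mu>"
    using borel_probs_cell[OF assms(1), of "\<lambda>x. x \<in> U"] U(1) by (simp add: Int_def conj_commute)
  ultimately have "U \<inter> S \<in> null_sets \<mu>" using AE_iff_null_sets by blast
  with pos show False by (auto simp: null_sets_def)
qed

text \<open>A point outside the support lies in a basic open set of measure 0, and a countable basis has only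
  countably many of these.\<close>

lemma AE_in_msupport:
  fixes \<mu> :: "'a::euclidean_space measure"
  assumes "\<mu> \<in> borel_probs S"
  shows "AE x in \<mu>. x \<in> msupport \<mu>"
proof -
  note sp = borel_probs_space[OF assms]
  obtain B :: "'a set set" where B: "countable B" "topological_basis B"
    using ex_countable_basis by blast
  have "AE x in \<mu>. x \<notin> b" if "b \<in> B" "emeasure \<mu> (b \<inter> S) = 0" for b
  proof -
    have "open b" using B(2) that(1) topological_basis_open by blast
    then have "b \<inter> S \<in> sets \<mu>"
      using borel_probs_cell[OF assms, of "\<lambda>x. x \<in> b"] by (simp add: Int_def conj_commute)
    then have "b \<inter> S \<in> null_sets \<mu>" using that(2) by auto
    from AE_not_in[OF this] show ?thesis using AE_space by eventually_elim (auto simp: sp)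
  qed
  then have "AE x in \<mu>. \<forall>b\<in>{b\<in>B. emeasure \<mu> (b \<inter> S) = 0}. x \<notin> b"
    using B(1) by (subst AE_ball_countable) auto
  with AE_space show ?thesis
  proof eventually_elim
    case (elim x)
    have "emeasure \<mu> (U \<inter> S) > 0" if U: "open U" "x \<in> U" for U
    proof -
      obtain b where b: "b \<in> B" "x \<in> b" "b \<subseteq> U" using topological_basisE[OF B(2) U] by blast
      have "b \<inter> S \<subseteq> U \<inter> S" using b by auto
      moreover have "U \<inter> S \<in> sets \<mu>"
        using borel_probs_cell[OF assms, of "\<lambda>x. x \<in> U"] U(1) by (simp add: Int_def conj_commute)
      ultimately have "emeasure \<mu> (b \<inter> S) \<le> emeasure \<mu> (U \<inter> S)" by (rule emeasure_mono)
      moreover have "emeasure \<mu> (b \<inter> S) \<noteq> 0" using elim(2) b by auto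
      ultimately show ?thesis by (metis not_gr_zero le_zero_eq)
    qed
    then show ?case using elim(1) unfolding msupport_def sp by auto
  qed
qed

text \<open>Complementary slackness: the gap \<open>c - \<phi> - \<psi>\<close> is continuous, nonnegative and has integral 0
  against an optimal plan.\<close>

lemma optimal_plan_contact:
  fixes \<Omega> :: "'a::euclidean_space set"
  assumes "compact \<Omega>" "\<mu> \<in> borel_probs \<Omega>" "\<nu> \<in> borel_probs \<Omega>" and c: "continuous_on (\<Omega> \<times> \<Omega>) c"
    and opt: "optimal_pair \<Omega> c \<mu> \<nu> \<phi> \<psi>" and p: "\<pi> \<in> optimal_plans \<Omega> c \<mu> \<nu>" and "(x, y) \<in> msupport \<pi>"
  shows "\<phi> x + \<psi> y = c (x, y)"
proof -
  have p': "\<pi> \<in> transport_plans \<Omega> \<mu> \<nu>" "(\<integral>z. c z \<partial>\<pi>) = transport_cost \<Omega> c \<mu> \<nu>"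
    using p unfolding optimal_plans_def by auto
  then have \<pi>: "\<pi> \<in> borel_probs (\<Omega> \<times> \<Omega>)" unfolding transport_plans_def by auto
  have cp: "conj_pair \<Omega> c \<phi> \<psi>" using opt unfolding optimal_pair_def by simp
  note cont = conj_pair_continuous_fst[OF assms(1) c cp] conj_pair_continuous_snd[OF assms(1) c cp]
  note i = transport_plan_integral[OF assms(1-3) p'(1) cont]
  have "c (x, y) - (\<phi> (fst (x, y)) + \<psi> (snd (x, y))) = 0"
  proof (rule vanishes_on_msupport[OF \<pi> compact_Times[OF assms(1,1)] _ _ _ assms(7)])
    show "continuous_on (\<Omega> \<times> \<Omega>) (\<lambda>z. c z - (\<phi> (fst z) + \<psi> (snd z)))"
      by (intro continuous_intros c continuous_on_compose2[OF cont(1)] continuous_on_compose2[OF cont(2)]) auto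
    show "0 \<le> c z - (\<phi> (fst z) + \<psi> (snd z))" if "z \<in> \<Omega> \<times> \<Omega>" for z
      using conj_pair_le[OF cp, of "fst z" "snd z"] that by auto
    show "(\<integral>z. c z - (\<phi> (fst z) + \<psi> (snd z)) \<partial>\<pi>) = 0"
      using i opt p'(2) borel_probs_integrable[OF \<pi> compact_Times[OF assms(1,1)] c]
      unfolding optimal_pair_def by simp
  qed
  then show ?thesis by simp
qed

text \<open>The average of two optimal pairs is feasible with the optimal value. Taking the \<open>c\<close>-transform of
  the averaged \<open>\<psi>\<close> cannot improve this value, so it changes the averaged \<open>\<phi>\<close> nowhere on the support. A point \<open>y\<close> where the
  transform is attained is then a contact point of the average, hence of both pairs.\<close>

lemma optimal_pairs_common_contact:
  fixes \<Omega> :: "'a::euclidean_space set"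
  assumes "compact \<Omega>" "\<mu> \<in> borel_probs \<Omega>" "\<nu> \<in> borel_probs \<Omega>" and c: "continuous_on (\<Omega> \<times> \<Omega>) c"
    and opt: "optimal_pair \<Omega> c \<mu> \<nu> \<phi>1 \<psi>1" "optimal_pair \<Omega> c \<mu> \<nu> \<phi>2 \<psi>2" and x: "x \<in> msupport \<mu>"
  obtains y where "y \<in> \<Omega>" "\<phi>1 x + \<psi>1 y = c (x, y)" "\<phi>2 x + \<psi>2 y = c (x, y)"
proof -
  have cp: "conj_pair \<Omega> c \<phi>1 \<psi>1" "conj_pair \<Omega> c \<phi>2 \<psi>2" using opt unfolding optimal_pair_def by simp_all
  note cont1 = conj_pair_continuous_fst[OF assms(1) c cp(1)] conj_pair_continuous_fst[OF assms(1) c cp(2)]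
  note cont2 = conj_pair_continuous_snd[OF assms(1) c cp(1)] conj_pair_continuous_snd[OF assms(1) c cp(2)]
  have x\<Omega>: "x \<in> \<Omega>" using x borel_probs_space[OF assms(2)] unfolding msupport_def by auto
  then have ne: "\<Omega> \<noteq> {}" by auto
  define u where "u x = (\<phi>1 x + \<phi>2 x) / 2" for x
  define v where "v y = (\<psi>1 y + \<psi>2 y) / 2" for y
  have cu: "continuous_on \<Omega> u" and cv: "continuous_on \<Omega> v"
    unfolding u_def v_def by (intro continuous_intros cont1 cont2; simp)+
  have le: "u x + v y \<le> c (x, y)" if "x \<in> \<Omega>" "y \<in> \<Omega>" for x y
    using conj_pair_le[OF cp(1) that] conj_pair_le[OF cp(2) that] unfolding u_def v_def by argo
  define \<phi> where "\<phi> = c_transform \<Omega> c v"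
  have le\<phi>: "\<phi> x + v y \<le> c (x, y)" if "x \<in> \<Omega>" "y \<in> \<Omega>" for x y
    unfolding \<phi>_def by (rule c_transform_le[where h = u]) (use le that in auto)
  have u\<phi>: "u x \<le> \<phi> x" if "x \<in> \<Omega>" for x
    unfolding \<phi>_def by (rule c_transform_ge) (use le that ne in auto)
  have c\<phi>: "continuous_on \<Omega> \<phi>"
    unfolding \<phi>_def by (rule c_transform_continuous[OF assms(1) ne c, of u]) (use le in auto)
  note int = borel_probs_integrable[OF assms(2,1) cont1(1)] borel_probs_integrable[OF assms(2,1) cont1(2)]
    borel_probs_integrable[OF assms(3,1) cont2(1)] borel_probs_integrable[OF assms(3,1) cont2(2)]
  have iu: "(\<integral>x. u x \<partial>\<mu>) = ((\<integral>x. \<phi>1 x \<partial>\<mu>) + (\<integral>x. \<phi>2 x \<partial>\<mu>)) / 2"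
    and iv: "(\<integral>y. v y \<partial>\<nu>) = ((\<integral>y. \<psi>1 y \<partial>\<nu>) + (\<integral>y. \<psi>2 y \<partial>\<nu>)) / 2"
    unfolding u_def v_def using int by simp_all
  have "(\<integral>x. u x \<partial>\<mu>) + (\<integral>y. v y \<partial>\<nu>) = transport_cost \<Omega> c \<mu> \<nu>"
    using opt unfolding optimal_pair_def iu iv by argo
  moreover have "(\<integral>x. \<phi> x \<partial>\<mu>) + (\<integral>y. v y \<partial>\<nu>) \<le> transport_cost \<Omega> c \<mu> \<nu>"
    by (rule weak_duality[OF assms(1-4) c\<phi> cv le\<phi>])
  moreover have "(\<integral>x. u x \<partial>\<mu>) \<le> (\<integral>x. \<phi> x \<partial>\<mu>)"
    by (rule integral_mono[OF borel_probs_integrable[OF assms(2,1) cu] borel_probs_integrable[OF assms(2,1) c\<phi>]])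
      (use u\<phi> borel_probs_space[OF assms(2)] in auto)
  ultimately have "(\<integral>x. \<phi> x - u x \<partial>\<mu>) = 0"
    using borel_probs_integrable[OF assms(2,1) cu] borel_probs_integrable[OF assms(2,1) c\<phi>] by simp
  then have eq: "\<phi> x - u x = 0"
    by (rule vanishes_on_msupport[OF assms(2,1) _ _ _ x, rotated -1])
      (use u\<phi> in \<open>auto intro!: continuous_intros c\<phi> cu\<close>)
  obtain y where y: "y \<in> \<Omega>" "\<phi> x + v y = c (x, y)"
    using c_transform_attained[OF assms(1) ne c cv x\<Omega>] unfolding \<phi>_def by blast
  have "\<phi>1 x + \<psi>1 y = c (x, y)" "\<phi>2 x + \<psi>2 y = c (x, y)"
    using conj_pair_le[OF cp(1) x\<Omega> y(1)] conj_pair_le[OF cp(2) x\<Omega> y(1)] y(2) eq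
    unfolding u_def v_def by argo+
  with that y(1) show thesis by blast
qed

lemma integral_uniform_limit:
  fixes h :: "'a::euclidean_space \<Rightarrow> real"
  assumes "compact \<Omega>" "\<And>n. m n \<in> borel_probs \<Omega>" "\<And>n. continuous_on \<Omega> (H n)" "continuous_on \<Omega> h"
    and lim: "uniform_limit \<Omega> H h sequentially"
    and weak: "(\<lambda>n. \<integral>x. h x \<partial>(m n)) \<longlonglongrightarrow> I"
  shows "(\<lambda>n. \<integral>x. H n x \<partial>(m n)) \<longlonglongrightarrow> I"
proof -
  have "(\<lambda>n. (\<integral>x. H n x \<partial>(m n)) - (\<integral>x. h x \<partial>(m n))) \<longlonglongrightarrow> 0"
  proof (rule LIMSEQ_I)
    fix e :: real assume "e > 0"
    have "\<forall>\<^sub>F n in sequentially. \<forall>x\<in>\<Omega>. dist (H n x) (h x) < e / 2"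
      using uniform_limitD[OF lim, of "e / 2"] \<open>e > 0\<close> by simp
    then obtain N where N: "\<And>n x. n \<ge> N \<Longrightarrow> x \<in> \<Omega> \<Longrightarrow> \<bar>H n x - h x\<bar> < e / 2"
      unfolding eventually_sequentially dist_real_def by blast
    show "\<exists>N. \<forall>n\<ge>N. norm ((\<integral>x. H n x \<partial>(m n)) - (\<integral>x. h x \<partial>(m n)) - 0) < e"
    proof (intro exI allI impI)
      fix n assume "n \<ge> N"
      interpret prob_space "m n" by (rule borel_probs_prob[OF assms(2)])
      note i = borel_probs_integrable[OF assms(2,1,3)] borel_probs_integrable[OF assms(2,1,4)]
      have "\<bar>(\<integral>x. H n x - h x \<partial>(m n))\<bar> \<le> (\<integral>x. \<bar>H n x - h x\<bar> \<partial>(m n))" by (rule integral_abs_bound)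
      also have "\<dots> \<le> (\<integral>x. e / 2 \<partial>(m n))"
        using N[OF \<open>n \<ge> N\<close>] i[of n] by (intro integral_mono) (auto simp: borel_probs_space[OF assms(2)] less_imp_le)
      also have "\<dots> = e / 2" by (simp add: prob_space)
      finally show "norm ((\<integral>x. H n x \<partial>(m n)) - (\<integral>x. h x \<partial>(m n)) - 0) < e"
        using i[of n] \<open>e > 0\<close> by simp
    qed
  qed
  from tendsto_add[OF this weak] show ?thesis by simp
qed

text \<open>Stability of optimality. The optimal cost is lower semicontinuous along \<open>m\<close>, since any pair that is
  nearly optimal for \<open>\<mu>\<close> is feasible for each \<open>m n\<close>; therefore a uniform limit of nearly optimal pairs is
  optimal. The shifts \<open>k n\<close> normalize the potentials.\<close>

lemma optimal_pair_limit:
  fixes \<Omega> :: "'a::euclidean_space set"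
  assumes "compact \<Omega>" and A3: "assumption_A3 \<Omega> c"
    and \<mu>: "\<mu> \<in> borel_probs \<Omega>" and \<nu>: "\<nu> \<in> borel_probs \<Omega>" and m: "\<And>n. m n \<in> borel_probs \<Omega>"
    and weak: "\<And>h :: 'a \<Rightarrow> real. continuous_on \<Omega> h \<Longrightarrow> (\<lambda>n. \<integral>x. h x \<partial>(m n)) \<longlonglongrightarrow> (\<integral>x. h x \<partial>\<mu>)"
    and cp: "\<And>n. conj_pair \<Omega> c (\<Phi> n) (\<Psi> n)"
    and near: "\<And>n. transport_cost \<Omega> c (m n) \<nu> \<le> (\<integral>x. \<Phi> n x \<partial>(m n)) + (\<integral>y. \<Psi> n y \<partial>\<nu>) + \<epsilon> n"
    and "\<epsilon> \<longlonglongrightarrow> 0"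
  obtains \<phi> \<psi> and k :: "nat \<Rightarrow> real" and r :: "nat \<Rightarrow> nat" where "strict_mono r"
    "optimal_pair \<Omega> c \<mu> \<nu> \<phi> \<psi>" "uniform_limit \<Omega> (\<lambda>n x. \<Phi> (r n) x - k n) \<phi> sequentially"
proof -
  have c: "continuous_on (\<Omega> \<times> \<Omega>) c" using A3 unfolding assumption_A3_def by blast
  have "\<Omega> \<noteq> {}" using prob_space.not_empty[OF borel_probs_prob[OF \<mu>]] borel_probs_space[OF \<mu>] by simp
  then obtain x0 where "x0 \<in> \<Omega>" by blast
  define \<Phi>' where "\<Phi>' n x = \<Phi> n x - \<Phi> n x0" for n x
  define \<Psi>' where "\<Psi>' n y = \<Psi> n y + \<Phi> n x0" for n y
  have cp': "conj_pair \<Omega> c (\<Phi>' n) (\<Psi>' n)" for n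
    unfolding \<Phi>'_def \<Psi>'_def by (rule conj_pair_shift[OF cp])
  have zero: "\<Phi>' n x0 = 0" for n unfolding \<Phi>'_def by simp
  obtain \<phi> \<psi> and r :: "nat \<Rightarrow> nat" where r: "strict_mono r" and lim_cp: "conj_pair \<Omega> c \<phi> \<psi>"
    and lim: "uniform_limit \<Omega> (\<Phi>' \<circ> r) \<phi> sequentially" "uniform_limit \<Omega> (\<Psi>' \<circ> r) \<psi> sequentially"
    using conj_pairs_compact[where \<Phi> = \<Phi>' and \<Psi> = \<Psi>', OF assms(1) c cp' \<open>x0 \<in> \<Omega>\<close> zero]
    by blast
  note cont' = conj_pair_continuous_fst[OF assms(1) c cp'] conj_pair_continuous_snd[OF assms(1) c cp']
  note cont = conj_pair_continuous_fst[OF assms(1) c lim_cp] conj_pair_continuous_snd[OF assms(1) c lim_cp]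
  have near': "transport_cost \<Omega> c (m n) \<nu> \<le> (\<integral>x. \<Phi>' n x \<partial>(m n)) + (\<integral>y. \<Psi>' n y \<partial>\<nu>) + \<epsilon> n" for n
  proof -
    interpret m: prob_space "m n" by (rule borel_probs_prob[OF m])
    interpret \<nu>: prob_space \<nu> by (rule borel_probs_prob[OF \<nu>])
    have "(\<integral>x. \<Phi>' n x \<partial>(m n)) = (\<integral>x. \<Phi> n x \<partial>(m n)) - \<Phi> n x0"
      unfolding \<Phi>'_def
      using borel_probs_integrable[OF m assms(1) conj_pair_continuous_fst[OF assms(1) c cp]]
      by (simp add: m.prob_space)
    moreover have "(\<integral>y. \<Psi>' n y \<partial>\<nu>) = (\<integral>y. \<Psi> n y \<partial>\<nu>) + \<Phi> n x0"
      unfolding \<Psi>'_def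
      using borel_probs_integrable[OF \<nu> assms(1) conj_pair_continuous_snd[OF assms(1) c cp]]
      by (simp add: \<nu>.prob_space)
    ultimately show ?thesis using near[of n] by simp
  qed
  have "(\<lambda>n. \<integral>x. \<phi> x \<partial>(m (r n))) \<longlonglongrightarrow> (\<integral>x. \<phi> x \<partial>\<mu>)"
    using LIMSEQ_subseq_LIMSEQ[OF weak[OF cont(1)] r] by (simp add: o_def)
  from integral_uniform_limit[OF assms(1) _ _ cont(1) lim(1) this]
  have l1: "(\<lambda>n. \<integral>x. \<Phi>' (r n) x \<partial>(m (r n))) \<longlonglongrightarrow> (\<integral>x. \<phi> x \<partial>\<mu>)"
    using m cont'(1) by simp
  from integral_uniform_limit[OF assms(1) _ _ cont(2) lim(2), of "\<lambda>_. \<nu>" "\<integral>y. \<psi> y \<partial>\<nu>"]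
  have l2: "(\<lambda>n. \<integral>y. \<Psi>' (r n) y \<partial>\<nu>) \<longlonglongrightarrow> (\<integral>y. \<psi> y \<partial>\<nu>)"
    using \<nu> cont'(2) by simp
  have l3: "(\<lambda>n. \<epsilon> (r n)) \<longlonglongrightarrow> 0"
    using LIMSEQ_subseq_LIMSEQ[OF \<open>\<epsilon> \<longlonglongrightarrow> 0\<close> r] by (simp add: o_def)
  have "transport_cost \<Omega> c \<mu> \<nu> \<le> (\<integral>x. \<phi> x \<partial>\<mu>) + (\<integral>y. \<psi> y \<partial>\<nu>) + e" if "e > 0" for e
  proof -
    obtain \<phi>0 \<psi>0 where p0: "conj_pair \<Omega> c \<phi>0 \<psi>0"
      and v0: "transport_cost \<Omega> c \<mu> \<nu> \<le> (\<integral>x. \<phi>0 x \<partial>\<mu>) + (\<integral>y. \<psi>0 y \<partial>\<nu>) + e"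
      using kantorovich_duality_approx[OF assms(1) A3 \<mu> \<nu> \<open>e > 0\<close>] by blast
    note cont0 = conj_pair_continuous_fst[OF assms(1) c p0] conj_pair_continuous_snd[OF assms(1) c p0]
    have l0: "(\<lambda>n. \<integral>x. \<phi>0 x \<partial>(m (r n))) \<longlonglongrightarrow> (\<integral>x. \<phi>0 x \<partial>\<mu>)"
      using LIMSEQ_subseq_LIMSEQ[OF weak[OF cont0(1)] r] by (simp add: o_def)
    have "(\<integral>x. \<phi>0 x \<partial>\<mu>) + (\<integral>y. \<psi>0 y \<partial>\<nu>) \<le> (\<integral>x. \<phi> x \<partial>\<mu>) + (\<integral>y. \<psi> y \<partial>\<nu>) + 0"
    proof (rule LIMSEQ_le[OF tendsto_add[OF l0 tendsto_const] tendsto_add[OF tendsto_add[OF l1 l2] l3]],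
        intro exI allI impI)
      fix n :: nat
      show "(\<integral>x. \<phi>0 x \<partial>(m (r n))) + (\<integral>y. \<psi>0 y \<partial>\<nu>)
          \<le> (\<integral>x. \<Phi>' (r n) x \<partial>(m (r n))) + (\<integral>y. \<Psi>' (r n) y \<partial>\<nu>) + \<epsilon> (r n)"
        using weak_duality[OF assms(1) m \<nu> c cont0 conj_pair_le[OF p0], of "r n"] near'[of "r n"] by linarith
    qed
    with v0 show ?thesis by linarith
  qed
  then have "transport_cost \<Omega> c \<mu> \<nu> \<le> (\<integral>x. \<phi> x \<partial>\<mu>) + (\<integral>y. \<psi> y \<partial>\<nu>)" by (rule field_le_epsilon)
  with weak_duality[OF assms(1) \<mu> \<nu> c cont conj_pair_le[OF lim_cp]] lim_cp
  have "optimal_pair \<Omega> c \<mu> \<nu> \<phi> \<psi>" unfolding optimal_pair_def by simp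
  moreover have "uniform_limit \<Omega> (\<lambda>n x. \<Phi> (r n) x - \<Phi> (r n) x0) \<phi> sequentially"
    using lim(1) unfolding \<Phi>'_def o_def .
  ultimately show thesis by (rule that[OF r, of \<phi> \<psi> "\<lambda>n. \<Phi> (r n) x0"])
qed

lemma optimal_pair_exists:
  fixes \<Omega> :: "'a::euclidean_space set"
  assumes "compact \<Omega>" "assumption_A3 \<Omega> c" "\<mu> \<in> borel_probs \<Omega>" "\<nu> \<in> borel_probs \<Omega>"
  obtains \<phi> \<psi> where "optimal_pair \<Omega> c \<mu> \<nu> \<phi> \<psi>"
proof -
  have "\<exists>\<phi> \<psi>. conj_pair \<Omega> c \<phi> \<psi> \<and>
      transport_cost \<Omega> c \<mu> \<nu> \<le> (\<integral>x. \<phi> x \<partial>\<mu>) + (\<integral>y. \<psi> y \<partial>\<nu>) + inverse (real (Suc n))" for n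
  proof -
    have "inverse (real (Suc n)) > 0" by simp
    from kantorovich_duality_approx[OF assms this] show ?thesis by blast
  qed
  then obtain \<Phi> \<Psi> where pairs: "\<And>n. conj_pair \<Omega> c (\<Phi> n) (\<Psi> n)"
      "\<And>n. transport_cost \<Omega> c \<mu> \<nu> \<le> (\<integral>x. \<Phi> n x \<partial>\<mu>) + (\<integral>y. \<Psi> n y \<partial>\<nu>) + inverse (real (Suc n))"
    by metis
  show thesis
    by (rule optimal_pair_limit[OF assms assms(3) tendsto_const pairs LIMSEQ_inverse_real_of_nat])
      (rule that)
qed

section \<open>Uniqueness of optimal potentials on the support\<close>

text \<open>The mean value theorem along a segment that may run through the boundary of \<open>S\<close>, where only the
  derivative relative to \<open>S\<close> is available.\<close>

lemma segment_increment:
  fixes S :: "'a::euclidean_space set" and f' :: "'a \<times> 'a \<Rightarrow> ('a \<times> 'a) \<Rightarrow>\<^sub>L real"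
  assumes der: "\<And>z. z \<in> S \<times> S \<Longrightarrow> (c has_derivative blinfun_apply (f' z)) (at z within S \<times> S)"
    and "closed_segment a b \<subseteq> S" "y \<in> S"
  obtains \<xi> where "\<xi> \<in> closed_segment a b" "c (b, y) - c (a, y) = f' (\<xi>, y) (b - a, 0)"
proof -
  define p where "p s = (a + s *\<^sub>R (b - a), y)" for s :: real
  have p_seg: "fst (p s) \<in> closed_segment a b" if "s \<in> {0..1}" for s
  proof -
    have "fst (p s) = (1 - s) *\<^sub>R a + s *\<^sub>R b" unfolding p_def by (simp add: algebra_simps)
    then show ?thesis unfolding in_segment using that by (intro exI[of _ s]) auto
  qed
  have pS: "p s \<in> S \<times> S" if "s \<in> {0..1}" for s
    using p_seg[OF that] assms(2,3) unfolding p_def by auto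
  then have im: "p ` {0..1} \<subseteq> S \<times> S" by blast
  have "\<exists>s\<in>{0<..<1}. c (p 1) - c (p 0) = f' (p s) ((1 - 0) *\<^sub>R (b - a), 0)"
  proof (rule mvt_simple[where f = "\<lambda>s. c (p s)" and f' = "\<lambda>s h. f' (p s) (h *\<^sub>R (b - a), 0)"])
    fix s :: real assume s: "0 \<le> s" "s \<le> 1"
    have pd: "(p has_derivative (\<lambda>h. (h *\<^sub>R (b - a), 0))) (at s within {0..1})"
      unfolding p_def by (auto intro!: derivative_eq_intros)
    show "((\<lambda>s. c (p s)) has_derivative (\<lambda>h. f' (p s) (h *\<^sub>R (b - a), 0))) (at s within {0..1})"
      by (rule has_derivative_in_compose2[where f = p and g = c, OF der im _ pd]) (use s in auto)
  qed simp
  then obtain s where s: "s \<in> {0<..<1}" "c (p 1) - c (p 0) = f' (p s) (b - a, 0)" by auto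
  show thesis
  proof (rule that[of "fst (p s)"])
    show "fst (p s) \<in> closed_segment a b"
      using s(1) by (intro p_seg) auto
    show "c (b, y) - c (a, y) = f' (fst (p s), y) (b - a, 0)" using s(2) unfolding p_def by simp
  qed
qed

text \<open>Let \<open>p w\<close> be the derivative of \<open>c\<close> in its first variable at \<open>(w, Y w)\<close>, where \<open>Y w\<close> is a common contact point.
  Both potentials lie below \<open>c (_, Y w)\<close> up to a constant and touch it at \<open>w\<close>. Over a step \<open>h\<close> from \<open>w\<close> to
  \<open>w'\<close>, this bounds the increase of \<open>\<phi>1\<close> by \<open>p w h\<close> and the decrease of \<open>\<phi>2\<close> by \<open>- p w' h\<close>, with errors
  \<open>o(norm h)\<close>. Over \<open>N\<close> equal steps the terms \<open>p w h - p w' h\<close> telescope to \<open>O(1 / N)\<close>, and the errors add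
  up to \<open>N o(1 / N)\<close>.\<close>

lemma potentials_segment_le:
  fixes S :: "'a::euclidean_space set" and f' :: "'a \<times> 'a \<Rightarrow> ('a \<times> 'a) \<Rightarrow>\<^sub>L real"
  assumes "compact S" and cont: "continuous_on (S \<times> S) f'"
    and der: "\<And>z. z \<in> S \<times> S \<Longrightarrow> (c has_derivative blinfun_apply (f' z)) (at z within S \<times> S)"
    and le: "\<And>x y. x \<in> S \<Longrightarrow> y \<in> S \<Longrightarrow> \<phi>1 x + \<psi>1 y \<le> c (x, y)"
            "\<And>x y. x \<in> S \<Longrightarrow> y \<in> S \<Longrightarrow> \<phi>2 x + \<psi>2 y \<le> c (x, y)"
    and seg: "closed_segment a b \<subseteq> S"
    and contact: "\<And>w. w \<in> closed_segment a b \<Longrightarrow>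
            \<exists>y\<in>S. \<phi>1 w + \<psi>1 y = c (w, y) \<and> \<phi>2 w + \<psi>2 y = c (w, y)"
  shows "\<phi>1 b - \<phi>2 b \<le> \<phi>1 a - \<phi>2 a"
proof -
  have "compact (f' ` (S \<times> S))" using assms by (intro compact_continuous_image compact_Times)
  then obtain L where L: "\<And>z. z \<in> S \<times> S \<Longrightarrow> norm (f' z) \<le> L"
    using compact_imp_bounded[THEN bounded_iff[THEN iffD1]] by (metis imageI)
  have "a \<in> S" using seg by auto
  obtain ya where "ya \<in> S" using contact[of a] by auto
  have "L \<ge> 0" using L[of "(a, ya)"] \<open>a \<in> S\<close> \<open>ya \<in> S\<close> norm_ge_zero order_trans by blast
  have nrm: "norm (h, 0 :: 'a) = norm h" for h :: 'a by (simp add: norm_prod_def)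
  have uc: "uniformly_continuous_on (S \<times> S) f'"
    using assms by (intro compact_uniformly_continuous compact_Times)
  obtain Y where Y: "\<And>w. w \<in> closed_segment a b \<Longrightarrow> Y w \<in> S"
      "\<And>w. w \<in> closed_segment a b \<Longrightarrow> \<phi>1 w + \<psi>1 (Y w) = c (w, Y w)"
      "\<And>w. w \<in> closed_segment a b \<Longrightarrow> \<phi>2 w + \<psi>2 (Y w) = c (w, Y w)"
    using contact by metis
  define g where "g w = \<phi>1 w - \<phi>2 w" for w
  have small: "g b - g a \<le> (2 * L + 2) * norm (b - a) * e" if "e > 0" for e :: real
  proof -
    obtain d where d: "d > 0" "\<And>z z'. z \<in> S \<times> S \<Longrightarrow> z' \<in> S \<times> S \<Longrightarrow> dist z' z < d \<Longrightarrow> dist (f' z') (f' z) < e"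
      using uc \<open>e > 0\<close> unfolding uniformly_continuous_on_def by metis
    obtain N :: nat where N: "real N > max (1 / e) (norm (b - a) / d)" using reals_Archimedean2 by blast
    then have N1: "1 / e < N" "norm (b - a) / d < N" by auto
    have "0 < 1 / e" using \<open>e > 0\<close> by simp
    then have "N > 0" using N1(1) by linarith
    with N1 have N': "1 / N < e" "norm (b - a) / N < d" using \<open>e > 0\<close> \<open>d > 0\<close> by (auto simp: field_simps)
    define h where "h = (b - a) /\<^sub>R N"
    have nh: "norm h = norm (b - a) / N" unfolding h_def by (simp add: divide_inverse)
    define w where "w j = a + real j *\<^sub>R h" for j
    have w_seg: "w j \<in> closed_segment a b" if "j \<le> N" for j
    proof -
      have "w j = a + (j / N) *\<^sub>R (b - a)" unfolding w_def h_def by (simp add: divide_inverse)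
      also have "\<dots> = (1 - j / N) *\<^sub>R a + (j / N) *\<^sub>R b" by (simp add: algebra_simps)
      finally show ?thesis unfolding in_segment using that \<open>N > 0\<close> by (intro exI[of _ "j / N"]) auto
    qed
    have wN: "w N = b" "w 0 = a" unfolding w_def h_def using \<open>N > 0\<close> by simp_all
    define p where "p j = f' (w j, Y (w j)) (h, 0)" for j
    have step: "g (w (Suc j)) - g (w j) \<le> p j - p (Suc j) + 2 * e * norm h" if j: "j < N" for j
    proof -
      have ww: "w j \<in> closed_segment a b" "w (Suc j) \<in> closed_segment a b" using w_seg j by auto
      then have sub: "closed_segment (w j) (w (Suc j)) \<subseteq> closed_segment a b"
        by (simp add: subset_closed_segment)
      then have subS: "closed_segment (w j) (w (Suc j)) \<subseteq> S" using seg by blast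
      have dw: "w (Suc j) - w j = h" unfolding w_def by (simp add: algebra_simps)
      have est: "\<bar>f' (\<xi>, Y u) (h, 0) - f' (u, Y u) (h, 0)\<bar> \<le> e * norm h"
        if "u \<in> {w j, w (Suc j)}" "\<xi> \<in> closed_segment (w j) (w (Suc j))" for u \<xi>
      proof -
        have "dist \<xi> u \<le> norm h"
          using segment_bound[OF that(2)] that(1) dw by (auto simp: dist_norm norm_minus_commute)
        then have "dist (\<xi>, Y u) (u, Y u) < d" using nh N' by (simp add: dist_Pair_Pair)
        moreover have "(\<xi>, Y u) \<in> S \<times> S" "(u, Y u) \<in> S \<times> S" using that subS seg Y(1) ww by auto
        ultimately have "norm (f' (\<xi>, Y u) - f' (u, Y u)) < e" using d(2) by (simp add: dist_norm)
        then have "norm ((f' (\<xi>, Y u) - f' (u, Y u)) (h, 0)) \<le> e * norm h"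
          using norm_blinfun[of "f' (\<xi>, Y u) - f' (u, Y u)" "(h, 0)"]
            mult_right_mono[of "norm (f' (\<xi>, Y u) - f' (u, Y u))" e "norm h"] by (simp add: nrm)
        then show ?thesis by (simp add: blinfun.diff_left)
      qed
      obtain \<xi>1 where \<xi>1: "\<xi>1 \<in> closed_segment (w j) (w (Suc j))"
        "c (w (Suc j), Y (w j)) - c (w j, Y (w j)) = f' (\<xi>1, Y (w j)) (h, 0)"
        using segment_increment[OF der subS Y(1)[OF ww(1)]] dw by metis
      obtain \<xi>2 where \<xi>2: "\<xi>2 \<in> closed_segment (w j) (w (Suc j))"
        "c (w (Suc j), Y (w (Suc j))) - c (w j, Y (w (Suc j))) = f' (\<xi>2, Y (w (Suc j))) (h, 0)"
        using segment_increment[OF der subS Y(1)[OF ww(2)]] dw by metis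
      have wS: "w j \<in> S" "w (Suc j) \<in> S" using ww seg by auto
      have "\<phi>1 (w (Suc j)) - \<phi>1 (w j) \<le> c (w (Suc j), Y (w j)) - c (w j, Y (w j))"
        using le(1)[OF wS(2) Y(1)[OF ww(1)]] Y(2)[OF ww(1)] by linarith
      moreover have "\<phi>2 (w j) - \<phi>2 (w (Suc j)) \<le> c (w j, Y (w (Suc j))) - c (w (Suc j), Y (w (Suc j)))"
        using le(2)[OF wS(1) Y(1)[OF ww(2)]] Y(3)[OF ww(2)] by linarith
      moreover have "\<bar>f' (\<xi>1, Y (w j)) (h, 0) - p j\<bar> \<le> e * norm h"
        unfolding p_def by (rule est) (use \<xi>1 in auto)
      moreover have "\<bar>f' (\<xi>2, Y (w (Suc j))) (h, 0) - p (Suc j)\<bar> \<le> e * norm h"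
        unfolding p_def by (rule est) (use \<xi>2 in auto)
      ultimately show ?thesis using \<xi>1(2) \<xi>2(2) unfolding g_def by linarith
    qed
    have "g b - g a = (\<Sum>j<N. g (w (Suc j)) - g (w j))" 
      using sum_lessThan_telescope[of "\<lambda>j. g (w j)" N] wN by simp
    also have "\<dots> \<le> (\<Sum>j<N. p j - p (Suc j) + 2 * e * norm h)" by (intro sum_mono step) auto
    also have "\<dots> = p 0 - p N + N * (2 * e * norm h)"
      by (simp add: sum.distrib sum_lessThan_telescope')
    also have "\<dots> \<le> 2 * L * norm h + N * (2 * e * norm h)"
    proof -
      have "\<bar>p j\<bar> \<le> L * norm h" if "j \<le> N" for j
      proof -
        have "(w j, Y (w j)) \<in> S \<times> S" using w_seg[OF that] seg Y(1) by auto
        then have "norm (f' (w j, Y (w j))) * norm h \<le> L * norm h" by (intro mult_right_mono L) auto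
        then show ?thesis
          unfolding p_def using norm_blinfun[of "f' (w j, Y (w j))" "(h, 0)"] by (simp add: nrm)
      qed
      from this[of 0] this[of N] show ?thesis by auto
    qed
    also have "\<dots> = 2 * L * norm (b - a) * (1 / N) + 2 * e * norm (b - a)"
      unfolding nh using \<open>N > 0\<close> by simp
    also have "\<dots> \<le> 2 * L * norm (b - a) * e + 2 * e * norm (b - a)"
      using N'(1) \<open>L \<ge> 0\<close> by (intro add_right_mono mult_left_mono) auto
    finally show ?thesis by (simp add: algebra_simps)
  qed
  have "g b - g a \<le> 0"
  proof (rule field_le_epsilon)
    fix e :: real assume "e > 0"
    define K where "K = (2 * L + 2) * norm (b - a)"
    have "K \<ge> 0" unfolding K_def using \<open>L \<ge> 0\<close> by simp
    have "g b - g a \<le> K * (e / (K + 1))"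
      using small[of "e / (K + 1)"] \<open>e > 0\<close> \<open>K \<ge> 0\<close> unfolding K_def[symmetric] by simp
    also have "\<dots> \<le> 0 + e" using \<open>e > 0\<close> \<open>K \<ge> 0\<close> by (simp add: field_simps)
    finally show "g b - g a \<le> 0 + e" .
  qed
  then show ?thesis unfolding g_def by simp
qed

text \<open>The previous estimate, used in both directions, makes \<open>\<phi>1 - \<phi>2\<close> constant on segments inside the
  support.\<close>

lemma optimal_potentials_constant_on_component:
  fixes \<Omega> :: "'a::euclidean_space set"
  assumes "compact \<Omega>" and A3: "assumption_A3 \<Omega> c" and C1: "C1_on (\<Omega> \<times> \<Omega>) c"
    and \<mu>: "\<mu> \<in> borel_probs \<Omega>" and \<nu>: "\<nu> \<in> borel_probs \<Omega>"
    and opt: "optimal_pair \<Omega> c \<mu> \<nu> \<phi>1 \<psi>1" "optimal_pair \<Omega> c \<mu> \<nu> \<phi>2 \<psi>2"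
    and A: "A \<in> components (interior (msupport \<mu>))"
  obtains k where "\<And>x. x \<in> closure A \<Longrightarrow> \<phi>1 x - \<phi>2 x = k"
proof -
  have c: "continuous_on (\<Omega> \<times> \<Omega>) c" using A3 unfolding assumption_A3_def by blast
  obtain f' :: "'a \<times> 'a \<Rightarrow> ('a \<times> 'a) \<Rightarrow>\<^sub>L real" where f': "continuous_on (\<Omega> \<times> \<Omega>) f'"
    "\<And>z. z \<in> \<Omega> \<times> \<Omega> \<Longrightarrow> (c has_derivative blinfun_apply (f' z)) (at z within \<Omega> \<times> \<Omega>)"
    using C1 unfolding C1_on_def by blast
  have cp: "conj_pair \<Omega> c \<phi>1 \<psi>1" "conj_pair \<Omega> c \<phi>2 \<psi>2" using opt unfolding optimal_pair_def by simp_all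
  have supp: "msupport \<mu> \<subseteq> \<Omega>" using borel_probs_space[OF \<mu>] unfolding msupport_def by auto
  have seg: "\<phi>1 b - \<phi>2 b = \<phi>1 a - \<phi>2 a" if "closed_segment a b \<subseteq> msupport \<mu>" for a b
  proof -
    have ct: "\<exists>y\<in>\<Omega>. \<phi>1 w + \<psi>1 y = c (w, y) \<and> \<phi>2 w + \<psi>2 y = c (w, y)"
      if "w \<in> closed_segment a b" for w
      using optimal_pairs_common_contact[OF assms(1) \<mu> \<nu> c opt, of w]
        \<open>closed_segment a b \<subseteq> msupport \<mu>\<close> that by blast
    have sub: "closed_segment a b \<subseteq> \<Omega>" using that supp by blast
    show ?thesis
    proof (rule antisym)
      show "\<phi>1 b - \<phi>2 b \<le> \<phi>1 a - \<phi>2 a"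
        by (rule potentials_segment_le[OF assms(1) f' conj_pair_le[OF cp(1)] conj_pair_le[OF cp(2)] sub ct])
      have ct': "\<exists>y\<in>\<Omega>. \<phi>1 w + \<psi>1 y = c (w, y) \<and> \<phi>2 w + \<psi>2 y = c (w, y)"
        if "w \<in> closed_segment b a" for w using ct[of w] that by (simp add: closed_segment_commute)
      have sub': "closed_segment b a \<subseteq> \<Omega>" using sub by (simp add: closed_segment_commute)
      show "\<phi>1 a - \<phi>2 a \<le> \<phi>1 b - \<phi>2 b"
        by (rule potentials_segment_le[OF assms(1) f' conj_pair_le[OF cp(1)] conj_pair_le[OF cp(2)] sub' ct'])
    qed
  qed
  have sub: "A \<subseteq> msupport \<mu>" using in_components_subset[OF A] interior_subset by blast
  have "open A" using A open_components open_interior by blast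
  have "(\<lambda>x. \<phi>1 x - \<phi>2 x) constant_on A"
  proof (rule locally_constant_imp_constant[OF in_components_connected[OF A]])
    fix a assume "a \<in> A"
    then obtain e where e: "e > 0" "ball a e \<subseteq> A" using \<open>open A\<close> open_contains_ball by blast
    have "\<phi>1 x - \<phi>2 x = \<phi>1 a - \<phi>2 a" if "x \<in> ball a e" for x
    proof (rule seg)
      have "closed_segment a x \<subseteq> ball a e"
        using that e(1) by (intro closed_segment_subset convex_ball) auto
      then show "closed_segment a x \<subseteq> msupport \<mu>" using e(2) sub by blast
    qed
    moreover have "openin (top_of_set A) (ball a e)" using e(2) by (simp add: open_subset)
    moreover have "a \<in> ball a e" using e(1) by simp
    ultimately show "\<exists>T. openin (top_of_set A) T \<and> a \<in> T \<and> (\<forall>x\<in>T. \<phi>1 x - \<phi>2 x = \<phi>1 a - \<phi>2 a)"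
      by blast
  qed
  then obtain k where k: "\<And>x. x \<in> A \<Longrightarrow> \<phi>1 x - \<phi>2 x = k" unfolding constant_on_def by blast
  have "closure A \<subseteq> \<Omega>" using sub supp assms(1) by (intro closure_minimal compact_imp_closed) auto
  then have "continuous_on (closure A) (\<lambda>x. \<phi>1 x - \<phi>2 x)"
    by (intro continuous_intros continuous_on_subset[OF conj_pair_continuous_fst[OF assms(1) c cp(1)]]
        continuous_on_subset[OF conj_pair_continuous_fst[OF assms(1) c cp(2)]])
  from continuous_constant_on_closure[OF this k] that show thesis by blast
qed

text \<open>Contact on the support of an optimal plan transports the constant from \<open>A\<close> to its image, with the
  opposite sign; images that meet therefore carry the same constant.\<close>

lemma dual_potentials_on_linked_image:
  fixes \<Omega> :: "'a::euclidean_space set"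
  assumes "compact \<Omega>" and A3: "assumption_A3 \<Omega> c"
    and \<mu>: "\<mu> \<in> borel_probs \<Omega>" and \<nu>: "\<nu> \<in> borel_probs \<Omega>"
    and opt: "optimal_pair \<Omega> c \<mu> \<nu> \<phi>1 \<psi>1" "optimal_pair \<Omega> c \<mu> \<nu> \<phi>2 \<psi>2"
    and k: "\<And>x. x \<in> closure A \<Longrightarrow> \<phi>1 x - \<phi>2 x = k"
    and y: "y \<in> linked_image \<Omega> c \<mu> \<nu> A"
  shows "\<psi>1 y - \<psi>2 y = - k"
proof -
  have c: "continuous_on (\<Omega> \<times> \<Omega>) c" using A3 unfolding assumption_A3_def by blast
  have cp: "conj_pair \<Omega> c \<phi>1 \<psi>1" "conj_pair \<Omega> c \<phi>2 \<psi>2" using opt unfolding optimal_pair_def by simp_all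
  define Y where "Y = {y. \<exists>x \<in> closure A. \<exists>\<pi> \<in> optimal_plans \<Omega> c \<mu> \<nu>. (x, y) \<in> msupport \<pi>}"
  have "Y \<subseteq> \<Omega>"
  proof
    fix y assume "y \<in> Y"
    then obtain x \<pi> where p: "\<pi> \<in> optimal_plans \<Omega> c \<mu> \<nu>" "(x, y) \<in> msupport \<pi>" unfolding Y_def by blast
    then have "space \<pi> = \<Omega> \<times> \<Omega>"
      unfolding optimal_plans_def transport_plans_def using borel_probs_space by blast
    then show "y \<in> \<Omega>" using p(2) unfolding msupport_def by auto
  qed
  then have "closure Y \<subseteq> \<Omega>" using assms(1) by (intro closure_minimal compact_imp_closed) auto
  then have "continuous_on (closure Y) (\<lambda>y. \<psi>1 y - \<psi>2 y)"
    by (intro continuous_intros continuous_on_subset[OF conj_pair_continuous_snd[OF assms(1) c cp(1)]]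
        continuous_on_subset[OF conj_pair_continuous_snd[OF assms(1) c cp(2)]])
  moreover have "\<psi>1 y - \<psi>2 y = - k" if y: "y \<in> Y" for y
  proof -
    obtain x \<pi> where p: "x \<in> closure A" "\<pi> \<in> optimal_plans \<Omega> c \<mu> \<nu>" "(x, y) \<in> msupport \<pi>"
      using y unfolding Y_def by blast
    show ?thesis
      using k[OF p(1)] optimal_plan_contact[OF assms(1) \<mu> \<nu> c opt(1) p(2,3)]
        optimal_plan_contact[OF assms(1) \<mu> \<nu> c opt(2) p(2,3)] by linarith
  qed
  ultimately show ?thesis
    using continuous_constant_on_closure[of Y "\<lambda>y. \<psi>1 y - \<psi>2 y" "- k" y] y
    unfolding linked_image_def Y_def by blast
qed

theorem optimal_potential_unique:
  fixes \<Omega> :: "'a::euclidean_space set"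
  assumes "compact \<Omega>" and A3: "assumption_A3 \<Omega> c" and C1: "C1_on (\<Omega> \<times> \<Omega>) c"
    and \<mu>: "\<mu> \<in> borel_probs \<Omega>" and \<nu>: "\<nu> \<in> borel_probs \<Omega>"
    and opt: "optimal_pair \<Omega> c \<mu> \<nu> \<phi>1 \<psi>1" "optimal_pair \<Omega> c \<mu> \<nu> \<phi>2 \<psi>2"
    and supp: "msupport \<mu> = closure (interior (msupport \<mu>))"
    and link: "\<And>A B. A \<in> components (interior (msupport \<mu>)) \<Longrightarrow>
        B \<in> components (interior (msupport \<mu>)) \<Longrightarrow> linked \<Omega> c \<mu> \<nu> A B"
  obtains k where "\<And>x. x \<in> msupport \<mu> \<Longrightarrow> \<phi>1 x - \<phi>2 x = k"
proof -
  have c: "continuous_on (\<Omega> \<times> \<Omega>) c" using A3 unfolding assumption_A3_def by blast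
  have cp: "conj_pair \<Omega> c \<phi>1 \<psi>1" "conj_pair \<Omega> c \<phi>2 \<psi>2" using opt unfolding optimal_pair_def by simp_all
  let ?C = "components (interior (msupport \<mu>))"
  have "\<exists>k. \<forall>x\<in>closure A. \<phi>1 x - \<phi>2 x = k" if "A \<in> ?C" for A
    using optimal_potentials_constant_on_component[OF assms(1) A3 C1 \<mu> \<nu> opt that] by blast
  then obtain K where K: "\<And>A x. A \<in> ?C \<Longrightarrow> x \<in> closure A \<Longrightarrow> \<phi>1 x - \<phi>2 x = K A" by metis
  have K_link: "K A = K B" if AB: "A \<in> ?C" "B \<in> ?C" for A B
  proof -
    obtain Cs where Cs: "Cs \<noteq> []" "set Cs \<subseteq> ?C" "hd Cs = A" "last Cs = B"
      and meet: "\<And>j. Suc j < length Cs \<Longrightarrow>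
          linked_image \<Omega> c \<mu> \<nu> (Cs ! j) \<inter> linked_image \<Omega> c \<mu> \<nu> (Cs ! Suc j) \<noteq> {}"
      using link[OF AB] unfolding linked_def by blast
    have "K (Cs ! j) = K A" if "j < length Cs" for j
      using that
    proof (induction j)
      case 0
      then show ?case using Cs by (simp add: hd_conv_nth)
    next
      case (Suc j)
      then have in_C: "Cs ! j \<in> ?C" "Cs ! Suc j \<in> ?C" using Cs(2) nth_mem[of j Cs] nth_mem[of "Suc j" Cs] by auto
      obtain y where y: "y \<in> linked_image \<Omega> c \<mu> \<nu> (Cs ! j)" "y \<in> linked_image \<Omega> c \<mu> \<nu> (Cs ! Suc j)"
        using meet[OF Suc.prems] by blast
      have "- K (Cs ! j) = - K (Cs ! Suc j)"
        using dual_potentials_on_linked_image[OF assms(1) A3 \<mu> \<nu> opt K[OF in_C(1)] y(1)]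
          dual_potentials_on_linked_image[OF assms(1) A3 \<mu> \<nu> opt K[OF in_C(2)] y(2)] by simp
      then show ?case using Suc by simp
    qed
    from this[of "length Cs - 1"] show ?thesis using Cs by (simp add: last_conv_nth)
  qed
  obtain k where k: "\<And>A. A \<in> ?C \<Longrightarrow> K A = k" using K_link by (metis (full_types))
  have int: "\<phi>1 x - \<phi>2 x = k" if x: "x \<in> interior (msupport \<mu>)" for x
  proof -
    obtain A where "A \<in> ?C" "x \<in> A" using x Union_components[of "interior (msupport \<mu>)"] by blast
    then show ?thesis using K[of A x] k[of A] closure_subset by auto
  qed
  have "msupport \<mu> \<subseteq> \<Omega>" using borel_probs_space[OF \<mu>] unfolding msupport_def by auto
  then have "continuous_on (closure (interior (msupport \<mu>))) (\<lambda>x. \<phi>1 x - \<phi>2 x)"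
    unfolding supp[symmetric]
    by (intro continuous_intros continuous_on_subset[OF conj_pair_continuous_fst[OF assms(1) c cp(1)]]
        continuous_on_subset[OF conj_pair_continuous_fst[OF assms(1) c cp(2)]])
  from continuous_constant_on_closure[OF this int] supp that show thesis by blast
qed

section \<open>Differentiation of the densities\<close>

lemma borel_measurable_lebesgue_on:
  fixes g :: "'a::euclidean_space \<Rightarrow> real"
  assumes "\<Omega> \<in> sets borel" "g \<in> borel_measurable (restrict_space borel \<Omega>)"
  shows "g \<in> borel_measurable (lebesgue_on \<Omega>)"
proof -
  have "(\<lambda>x. indicator \<Omega> x *\<^sub>R g x) \<in> borel_measurable borel"
    using assms by (subst borel_measurable_restrict_space_iff[symmetric]) auto
  then have "(\<lambda>x. indicator \<Omega> x *\<^sub>R g x) \<in> borel_measurable lebesgue"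
    by (intro measurable_completion) simp
  then show ?thesis using assms(1) by (subst borel_measurable_restrict_space_iff) auto
qed

lemma lborel_on_eq_lebesgue_on:
  fixes g :: "'a::euclidean_space \<Rightarrow> real"
  assumes "\<Omega> \<in> sets borel" "g \<in> borel_measurable (restrict_space borel \<Omega>)"
  shows "integrable (restrict_space lborel \<Omega>) g \<longleftrightarrow> integrable (lebesgue_on \<Omega>) g"
    and "(\<integral>x. g x \<partial>(restrict_space lborel \<Omega>)) = (\<integral>x. g x \<partial>(lebesgue_on \<Omega>))"
proof -
  have m: "(\<lambda>x. indicator \<Omega> x *\<^sub>R g x) \<in> borel_measurable lborel"
    using borel_measurable_restrict_space_iff[of \<Omega> borel g] assms by simp
  show "integrable (restrict_space lborel \<Omega>) g \<longleftrightarrow> integrable (lebesgue_on \<Omega>) g"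
    using assms(1) integrable_completion[OF m] by (simp add: integrable_restrict_space)
  show "(\<integral>x. g x \<partial>(restrict_space lborel \<Omega>)) = (\<integral>x. g x \<partial>(lebesgue_on \<Omega>))"
    using assms(1) integral_completion[OF m] by (simp add: integral_restrict_space)
qed

lemma AE_lborel_on_iff:
  fixes \<Omega> :: "'a::euclidean_space set"
  assumes "\<Omega> \<in> sets borel"
  shows "(AE x in restrict_space lborel \<Omega>. P x) \<longleftrightarrow> (AE x in lebesgue_on \<Omega>. P x)"
  using assms by (simp add: AE_restrict_space_iff AE_completion_iff)

lemma density_on_integral:
  fixes g h :: "'a::euclidean_space \<Rightarrow> real"
  assumes \<Omega>: "compact \<Omega>" and g: "g \<in> borel_measurable (restrict_space borel \<Omega>)"
    and pos: "AE x in lebesgue_on \<Omega>. 0 \<le> g x"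
    and prob: "density_on \<Omega> g \<in> borel_probs \<Omega>" and h: "continuous_on \<Omega> h"
  shows "integrable (lebesgue_on \<Omega>) (\<lambda>x. g x * h x)"
    and "(\<integral>x. h x \<partial>(density_on \<Omega> g)) = (\<integral>x. g x * h x \<partial>(lebesgue_on \<Omega>))"
proof -
  have b: "\<Omega> \<in> sets borel" using \<Omega> by (simp add: borel_compact)
  have h': "h \<in> borel_measurable (restrict_space borel \<Omega>)"
    by (rule borel_measurable_continuous_on_restrict[OF h])
  have s: "sets (restrict_space lborel \<Omega>) = sets (restrict_space borel \<Omega>)"
    by (simp add: sets_restrict_space)
  have m: "g \<in> borel_measurable (restrict_space lborel \<Omega>)" "h \<in> borel_measurable (restrict_space lborel \<Omega>)"
    using g h' unfolding measurable_cong_sets[OF s refl] by auto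
  have gh: "(\<lambda>x. g x * h x) \<in> borel_measurable (restrict_space borel \<Omega>)" using g h' by simp
  have pos': "AE x in restrict_space lborel \<Omega>. 0 \<le> g x" using pos AE_lborel_on_iff[OF b] by blast
  show "integrable (lebesgue_on \<Omega>) (\<lambda>x. g x * h x)"
    using borel_probs_integrable[OF prob \<Omega> h] integrable_density[OF m(2,1) pos'] lborel_on_eq_lebesgue_on(1)[OF b gh]
    unfolding density_on_def by simp
  show "(\<integral>x. h x \<partial>(density_on \<Omega> g)) = (\<integral>x. g x * h x \<partial>(lebesgue_on \<Omega>))"
    using integral_density[OF m(2,1) pos'] lborel_on_eq_lebesgue_on(2)[OF b gh]
    unfolding density_on_def by simp
qed

text \<open>The measure is carried by its support, so the density can be positive off the support only on a null set.\<close>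

lemma density_zero_off_msupport:
  fixes g :: "'a::euclidean_space \<Rightarrow> real"
  assumes \<Omega>: "compact \<Omega>" and g: "g \<in> borel_measurable (restrict_space borel \<Omega>)"
    and pos: "AE x in lebesgue_on \<Omega>. 0 \<le> g x" and prob: "density_on \<Omega> g \<in> borel_probs \<Omega>"
  shows "AE x in lebesgue_on \<Omega>. x \<notin> msupport (density_on \<Omega> g) \<longrightarrow> g x = 0"
proof -
  have b: "\<Omega> \<in> sets borel" using \<Omega> by (simp add: borel_compact)
  have s: "sets (restrict_space lborel \<Omega>) = sets (restrict_space borel \<Omega>)"
    by (simp add: sets_restrict_space)
  have m: "g \<in> borel_measurable (restrict_space lborel \<Omega>)"
    using g unfolding measurable_cong_sets[OF s refl] .
  have "AE x in density_on \<Omega> g. x \<in> msupport (density_on \<Omega> g)" by (rule AE_in_msupport[OF prob])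
  then have "AE x in restrict_space lborel \<Omega>. 0 < ennreal (g x) \<longrightarrow> x \<in> msupport (density_on \<Omega> g)"
    using m by (subst (asm) density_on_def, subst (asm) AE_density) auto
  then have "AE x in lebesgue_on \<Omega>. 0 < ennreal (g x) \<longrightarrow> x \<in> msupport (density_on \<Omega> g)"
    using AE_lborel_on_iff[OF b] by blast
  with pos show ?thesis by eventually_elim (auto simp: ennreal_less_zero_iff)
qed

text \<open>\<open>D v\<close> is the derivative of the density in direction \<open>v\<close>. The mean value theorem bounds all difference
  quotients by \<open>\<eta> x * norm v\<close>, so dominated convergence makes the convergence hold in \<open>L\<^sup>1\<close>. Where the density
  vanishes at \<open>\<theta>\<^sub>0\<close>, the parameter \<open>\<theta>\<^sub>0\<close> is a minimum of a nonnegative function, and the derivative is 0.\<close>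

lemma density_derivative:
  fixes \<rho> :: "'a::euclidean_space \<Rightarrow> 'b::euclidean_space \<Rightarrow> real"
  assumes "compact \<Omega>" and A1: "assumption_A1 \<Omega> \<Theta> \<rho>" and A2: "assumption_A2 \<Omega> \<Theta> \<rho>" and "\<theta>\<^sub>0 \<in> \<Theta>"
  obtains \<delta> and D :: "'b \<Rightarrow> 'a \<Rightarrow> real" where "\<delta> > 0" "ball \<theta>\<^sub>0 \<delta> \<subseteq> \<Theta>"
    "\<And>v. integrable (lebesgue_on \<Omega>) (D v)"
    "\<And>v. ((\<lambda>s. \<integral>x. \<bar>(\<rho> x (\<theta>\<^sub>0 + s *\<^sub>R v) - \<rho> x \<theta>\<^sub>0) / s - D v x\<bar> \<partial>(lebesgue_on \<Omega>)) \<longlongrightarrow> 0)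
       (at_right 0)"
    "\<And>v w. AE x in lebesgue_on \<Omega>. D (v + w) x = D v x + D w x"
    "\<And>r v. AE x in lebesgue_on \<Omega>. D (r *\<^sub>R v) x = r * D v x"
    "\<And>v. AE x in lebesgue_on \<Omega>. \<rho> x \<theta>\<^sub>0 = 0 \<longrightarrow> D v x = 0"
proof -
  define M where "M = lebesgue_on \<Omega>"
  have b: "\<Omega> \<in> sets borel" using assms(1) by (simp add: borel_compact)
  have "open \<Theta>" using A1 unfolding assumption_A1_def by blast
  then obtain \<delta> where \<delta>: "\<delta> > 0" "ball \<theta>\<^sub>0 \<delta> \<subseteq> \<Theta>" using assms(4) open_contains_ball by blast
  have \<rho>m: "(\<lambda>x. \<rho> x \<theta>) \<in> borel_measurable M" if "\<theta> \<in> \<Theta>" for \<theta>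
    unfolding M_def using A1 that borel_measurable_lebesgue_on[OF b] unfolding assumption_A1_def by blast
  obtain \<eta> where \<eta>: "integrable M \<eta>"
    "AE x in M. \<forall>\<theta>\<in>\<Theta>. \<exists>D. (GDERIV (\<lambda>\<theta>'. \<rho> x \<theta>') \<theta> :> D) \<and> norm D \<le> \<eta> x"
    using A2 unfolding assumption_A2_def M_def by blast
  define good where "good x \<longleftrightarrow> (\<forall>\<theta>\<in>\<Theta>. \<exists>D. (GDERIV (\<lambda>\<theta>'. \<rho> x \<theta>') \<theta> :> D) \<and> norm D \<le> \<eta> x)" for x
  have good: "AE x in M. good x" using \<eta>(2) unfolding good_def .
  define G where "G x = (SOME D. (GDERIV (\<lambda>\<theta>'. \<rho> x \<theta>') \<theta>\<^sub>0 :> D) \<and> norm D \<le> \<eta> x)" for x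
  have G: "GDERIV (\<lambda>\<theta>'. \<rho> x \<theta>') \<theta>\<^sub>0 :> G x" "norm (G x) \<le> \<eta> x" if "good x" for x
  proof -
    have "\<exists>D. (GDERIV (\<lambda>\<theta>'. \<rho> x \<theta>') \<theta>\<^sub>0 :> D) \<and> norm D \<le> \<eta> x" using that assms(4) unfolding good_def by blast
    from someI_ex[OF this] show "GDERIV (\<lambda>\<theta>'. \<rho> x \<theta>') \<theta>\<^sub>0 :> G x" "norm (G x) \<le> \<eta> x"
      unfolding G_def by auto
  qed
  define q where "q v s x = (\<rho> x (\<theta>\<^sub>0 + s *\<^sub>R v) - \<rho> x \<theta>\<^sub>0) / s" for v s x
  have inb: "\<theta>\<^sub>0 + s *\<^sub>R v \<in> ball \<theta>\<^sub>0 \<delta>" if "0 < s" "s * norm v < \<delta>" for s v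
    using that by (simp add: dist_norm)
  have in\<Theta>: "\<theta>\<^sub>0 + s *\<^sub>R v \<in> \<Theta>" if "0 < s" "s * norm v < \<delta>" for s v
    using inb[OF that] \<delta>(2) by blast
  have qm: "q v s \<in> borel_measurable M" if "0 < s" "s * norm v < \<delta>" for s v
    unfolding q_def using \<rho>m[OF in\<Theta>[OF that]] \<rho>m[OF assms(4)] by measurable
  have qlim: "(\<lambda>n. q v (t n) x) \<longlonglongrightarrow> G x \<bullet> v" if "good x" "\<And>n. 0 < t n" "t \<longlonglongrightarrow> 0" for v x and t :: "nat \<Rightarrow> real"
  proof -
    have "((\<lambda>\<theta>'. \<rho> x \<theta>') has_derivative (\<lambda>h. h \<bullet> G x)) (at (\<theta>\<^sub>0 + 0 *\<^sub>R v))"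
      using G(1)[OF that(1)] unfolding gderiv_def by simp
    moreover have "((\<lambda>s. \<theta>\<^sub>0 + s *\<^sub>R v) has_derivative (\<lambda>s. s *\<^sub>R v)) (at 0)"
      by (auto intro!: derivative_eq_intros)
    ultimately have "((\<lambda>s. \<rho> x (\<theta>\<^sub>0 + s *\<^sub>R v)) has_derivative (\<lambda>s. (s *\<^sub>R v) \<bullet> G x)) (at 0)"
      by (rule has_derivative_compose[rotated])
    moreover have "(\<lambda>s. (s *\<^sub>R v) \<bullet> G x) = (*) (G x \<bullet> v)"
      by (simp add: fun_eq_iff inner_commute mult.commute)
    ultimately have "((\<lambda>s. \<rho> x (\<theta>\<^sub>0 + s *\<^sub>R v)) has_field_derivative (G x \<bullet> v)) (at 0)"
      unfolding has_field_derivative_def by simp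
    then have "(\<lambda>s. (\<rho> x (\<theta>\<^sub>0 + (0 + s) *\<^sub>R v) - \<rho> x (\<theta>\<^sub>0 + 0 *\<^sub>R v)) / s) \<midarrow>0\<rightarrow> G x \<bullet> v"
      unfolding DERIV_def .
    then have lim: "((\<lambda>s. q v s x) \<longlongrightarrow> G x \<bullet> v) (at 0)" unfolding q_def by simp
    have "filterlim t (at 0) sequentially"
      using that(2,3) unfolding filterlim_at by (auto intro!: always_eventually simp: less_imp_neq[symmetric])
    from filterlim_compose[OF lim this] show ?thesis .
  qed
  have qbound: "\<bar>q v s x\<bar> \<le> \<eta> x * norm v" if "good x" "0 < s" "s * norm v < \<delta>" for v s x
  proof -
    have "\<forall>\<theta>\<in>ball \<theta>\<^sub>0 \<delta>. \<exists>D. (GDERIV (\<lambda>\<theta>'. \<rho> x \<theta>') \<theta> :> D) \<and> norm D \<le> \<eta> x"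
      using that(1) \<delta>(2) unfolding good_def by blast
    then obtain d where d: "\<And>\<theta>. \<theta> \<in> ball \<theta>\<^sub>0 \<delta> \<Longrightarrow> GDERIV (\<lambda>\<theta>'. \<rho> x \<theta>') \<theta> :> d \<theta>"
      "\<And>\<theta>. \<theta> \<in> ball \<theta>\<^sub>0 \<delta> \<Longrightarrow> norm (d \<theta>) \<le> \<eta> x" by metis
    have "norm (\<rho> x (\<theta>\<^sub>0 + s *\<^sub>R v) - \<rho> x \<theta>\<^sub>0) \<le> \<eta> x * norm ((\<theta>\<^sub>0 + s *\<^sub>R v) - \<theta>\<^sub>0)"
    proof (rule differentiable_bound[where f' = "\<lambda>\<theta> h. h \<bullet> d \<theta>"])
      show "convex (ball \<theta>\<^sub>0 \<delta>)" by (rule convex_ball)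
      fix \<theta> assume \<theta>: "\<theta> \<in> ball \<theta>\<^sub>0 \<delta>"
      show "((\<lambda>\<theta>'. \<rho> x \<theta>') has_derivative (\<lambda>h. h \<bullet> d \<theta>)) (at \<theta> within ball \<theta>\<^sub>0 \<delta>)"
        using d(1)[OF \<theta>] unfolding gderiv_def by (rule has_derivative_at_withinI)
      show "onorm (\<lambda>h. h \<bullet> d \<theta>) \<le> \<eta> x"
      proof (rule onorm_le)
        fix h
        have "norm (h \<bullet> d \<theta>) \<le> norm h * norm (d \<theta>)" using Cauchy_Schwarz_ineq2 by simp
        also have "\<dots> \<le> norm h * \<eta> x" using d(2)[OF \<theta>] by (intro mult_left_mono) auto
        finally show "norm (h \<bullet> d \<theta>) \<le> \<eta> x * norm h" by (simp add: mult.commute)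
      qed
    qed (use inb[OF that(2,3)] \<delta>(1) in auto)
    then show ?thesis unfolding q_def using that(2) by (simp add: field_simps)
  qed
  \<comment> \<open>a null sequence of steps that stay in the ball around \<open>\<theta>\<^sub>0\<close> for every direction\<close>
  define S where "S v n = \<delta> / (2 * (1 + norm v) * (real n + 1))" for v :: 'b and n :: nat
  have S: "0 < S v n" "S v n * norm v < \<delta>" "S v \<longlonglongrightarrow> 0" for v n
  proof -
    have nv: "0 < 1 + norm v" by (simp add: add_pos_nonneg)
    then show "0 < S v n" unfolding S_def using \<delta>(1) by simp
    have "norm v < 2 * (1 + norm v) * (real n + 1)"
    proof -
      have "norm v < 2 * (1 + norm v) * 1" 
        using norm_ge_zero[of v] by (simp add: distrib_left add_nonneg_pos)
      also have "\<dots> \<le> 2 * (1 + norm v) * (real n + 1)" using nv by (intro mult_left_mono) auto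
      finally show ?thesis .
    qed
    then show "S v n * norm v < \<delta>" unfolding S_def using \<delta>(1) nv by (simp add: divide_less_eq)
    have "(\<lambda>n. \<delta> / (2 * (1 + norm v)) * inverse (real (Suc n))) \<longlonglongrightarrow> \<delta> / (2 * (1 + norm v)) * 0"
      by (intro tendsto_intros LIMSEQ_inverse_real_of_nat)
    then show "S v \<longlonglongrightarrow> 0" unfolding S_def by (simp add: divide_inverse mult.assoc add.commute)
  qed
  \<comment> \<open>a pointwise limit along one sequence, rather than the gradient itself, to have a measurable function\<close>
  define D where "D v x = lim (\<lambda>n. q v (S v n) x)" for v x
  have D: "D v x = G x \<bullet> v" if "good x" for v x
    unfolding D_def by (rule limI[OF qlim[OF that S(1,3)]])
  have Dm: "D v \<in> borel_measurable M" for v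
    unfolding D_def by (intro borel_measurable_lim_metric qm S)
  have Dbound: "\<bar>D v x\<bar> \<le> \<eta> x * norm v" if "good x" for v x
  proof -
    have "\<bar>G x \<bullet> v\<bar> \<le> norm (G x) * norm v" by (rule Cauchy_Schwarz_ineq2)
    also have "\<dots> \<le> \<eta> x * norm v" using G(2)[OF that] by (intro mult_right_mono) auto
    finally show ?thesis using D[OF that] by simp
  qed
  have \<eta>v: "integrable M (\<lambda>x. \<eta> x * norm v)" for v :: 'b using \<eta>(1) by simp
  show thesis
  proof (rule that[OF \<delta>, of D, folded M_def])
    fix v show "integrable M (D v)"
    proof (rule Bochner_Integration.integrable_bound[OF \<eta>v Dm])
      show "AE x in M. norm (D v x) \<le> norm (\<eta> x * norm v)"
        using good by eventually_elim (metis Dbound abs_ge_self order_trans real_norm_def)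
    qed
  next
    fix v :: 'b
    have nv: "0 < 1 + norm v" by (simp add: add_pos_nonneg)
    show "((\<lambda>s. \<integral>x. \<bar>(\<rho> x (\<theta>\<^sub>0 + s *\<^sub>R v) - \<rho> x \<theta>\<^sub>0) / s - D v x\<bar> \<partial>M) \<longlongrightarrow> 0) (at_right 0)"
    proof (rule tendsto_at_right_sequentially[of 0 "\<delta> / (1 + norm v)"])
      show "0 < \<delta> / (1 + norm v)" using \<delta>(1) nv by simp
      fix t :: "nat \<Rightarrow> real" assume t0: "\<And>n. 0 < t n" "\<And>n. t n < \<delta> / (1 + norm v)" "t \<longlonglongrightarrow> 0"
      have "t n * norm v < \<delta>" for n
      proof -
        have "t n * (1 + norm v) < \<delta>" using t0(2)[of n] nv by (simp add: pos_less_divide_eq)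
        then show ?thesis using t0(1)[of n] by (simp add: distrib_left)
      qed
      note t = t0(1) this t0(3)
      have "(\<lambda>n. \<integral>x. \<bar>q v (t n) x - D v x\<bar> \<partial>M) \<longlonglongrightarrow> (\<integral>x. 0 \<partial>M)"
      proof (rule integral_dominated_convergence[where w = "\<lambda>x. 2 * (\<eta> x * norm v)"])
        show "(\<lambda>x. \<bar>q v (t n) x - D v x\<bar>) \<in> borel_measurable M" for n
          using qm[OF t(1,2)] Dm by measurable
        show "integrable M (\<lambda>x. 2 * (\<eta> x * norm v))" using \<eta>v by simp
        show "AE x in M. (\<lambda>n. \<bar>q v (t n) x - D v x\<bar>) \<longlonglongrightarrow> 0"
          using good
        proof eventually_elim
          case (elim x)
          have "(\<lambda>n. \<bar>q v (t n) x - D v x\<bar>) \<longlonglongrightarrow> \<bar>G x \<bullet> v - D v x\<bar>"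
            by (intro tendsto_intros qlim[OF elim t(1,3)])
          then show ?case using D[OF elim] by simp
        qed
        show "AE x in M. norm \<bar>q v (t n) x - D v x\<bar> \<le> 2 * (\<eta> x * norm v)" for n
          using good
        proof eventually_elim
          case (elim x)
          show ?case using qbound[OF elim t(1,2), of n] Dbound[OF elim, of v] by simp
        qed
      qed simp
      then show "(\<lambda>n. \<integral>x. \<bar>(\<rho> x (\<theta>\<^sub>0 + t n *\<^sub>R v) - \<rho> x \<theta>\<^sub>0) / t n - D v x\<bar> \<partial>M) \<longlonglongrightarrow> 0"
        unfolding q_def by simp
    qed
  next
    fix v w show "AE x in M. D (v + w) x = D v x + D w x"
      using good by eventually_elim (simp add: D inner_add_right)
  next
    fix r v show "AE x in M. D (r *\<^sub>R v) x = r * D v x"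
      using good by eventually_elim (simp add: D)
  next
    fix v
    \<comment> \<open>nonnegativity holds almost everywhere for each parameter, hence simultaneously for countably many\<close>
    have nn: "AE x in M. \<forall>n. 0 \<le> \<rho> x (\<theta>\<^sub>0 + S w n *\<^sub>R w)" for w
      unfolding AE_all_countable using A1 in\<Theta>[OF S(1,2)] unfolding assumption_A1_def M_def by blast
    have sgn: "0 \<le> G x \<bullet> w" if "good x" "\<forall>n. 0 \<le> \<rho> x (\<theta>\<^sub>0 + S w n *\<^sub>R w)" "\<rho> x \<theta>\<^sub>0 = 0" for x w
      by (rule tendsto_lowerbound[OF qlim[OF that(1) S(1,3)[of w]]])
        (use that S(1) in \<open>auto simp: q_def intro!: always_eventually divide_nonneg_pos\<close>)
    show "AE x in M. \<rho> x \<theta>\<^sub>0 = 0 \<longrightarrow> D v x = 0"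
      using good nn[of v] nn[of "- v"]
    proof eventually_elim
      case (elim x)
      show ?case using sgn[OF elim(1,2)] sgn[OF elim(1,3)] D[OF elim(1)] by auto
    qed
  qed
qed

section \<open>Differentiability of the transport cost\<close>

lemma tendsto_from_subseq_limits:
  fixes X :: "nat \<Rightarrow> real"
  assumes "\<And>r :: nat \<Rightarrow> nat. strict_mono r \<Longrightarrow> \<exists>s. strict_mono s \<and> (\<lambda>n. X (r (s n))) \<longlonglongrightarrow> L"
  shows "X \<longlonglongrightarrow> L"
proof (rule ccontr)
  assume "\<not> X \<longlonglongrightarrow> L"
  then obtain e where e: "e > 0" "\<And>N. \<exists>n\<ge>N. e \<le> \<bar>X n - L\<bar>"
    unfolding lim_sequentially dist_real_def by (metis not_le)
  have "infinite {n. e \<le> \<bar>X n - L\<bar>}" unfolding infinite_nat_iff_unbounded_le using e(2) by blast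
  from infinite_enumerate[OF this] obtain r :: "nat \<Rightarrow> nat"
    where r: "strict_mono r" "\<And>n. e \<le> \<bar>X (r n) - L\<bar>" by auto
  obtain s where s: "strict_mono s" "(\<lambda>n. X (r (s n))) \<longlonglongrightarrow> L" using assms[OF r(1)] by blast
  from s(2) e(1) obtain n where "\<bar>X (r (s n)) - L\<bar> < e"
    unfolding lim_sequentially dist_real_def by blast
  with r(2)[of "s n"] show False by simp
qed

lemma integral_mult_uniform_limit:
  fixes Q H :: "nat \<Rightarrow> 'a \<Rightarrow> real"
  assumes H: "uniform_limit \<Omega> H h sequentially" and "\<Omega> = space M"
    and Qh: "\<And>n. integrable M (\<lambda>x. Q n x * H n x)" "\<And>n. integrable M (\<lambda>x. Q n x * h x)"
      "integrable M (\<lambda>x. q x * h x)" and Q: "\<And>n. integrable M (Q n)" and q: "integrable M q"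
    and L1: "(\<lambda>n. \<integral>x. \<bar>Q n x - q x\<bar> \<partial>M) \<longlonglongrightarrow> 0"
    and B: "\<And>x. x \<in> \<Omega> \<Longrightarrow> \<bar>h x\<bar> \<le> B"
  shows "(\<lambda>n. \<integral>x. Q n x * H n x \<partial>M) \<longlonglongrightarrow> (\<integral>x. q x * h x \<partial>M)"
proof -
  define K where "K = (\<integral>x. \<bar>q x\<bar> \<partial>M)"
  have "K \<ge> 0" unfolding K_def by simp
  have part1: "(\<lambda>n. (\<integral>x. Q n x * h x \<partial>M) - (\<integral>x. q x * h x \<partial>M)) \<longlonglongrightarrow> 0"
  proof (rule tendsto_0_le[OF L1, of _ "\<bar>B\<bar>"], rule always_eventually, rule allI)
    fix n
    have "\<bar>(\<integral>x. Q n x * h x \<partial>M) - (\<integral>x. q x * h x \<partial>M)\<bar> = \<bar>\<integral>x. Q n x * h x - q x * h x \<partial>M\<bar>"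
      using Qh by simp
    also have "\<dots> \<le> (\<integral>x. \<bar>Q n x * h x - q x * h x\<bar> \<partial>M)" by (rule integral_abs_bound)
    also have "\<dots> \<le> (\<integral>x. \<bar>Q n x - q x\<bar> * \<bar>B\<bar> \<partial>M)"
    proof (rule integral_mono)
      show "integrable M (\<lambda>x. \<bar>Q n x * h x - q x * h x\<bar>)" using Qh by simp
      show "integrable M (\<lambda>x. \<bar>Q n x - q x\<bar> * \<bar>B\<bar>)" using Q q by simp
      fix x assume "x \<in> space M"
      then have "\<bar>h x\<bar> \<le> \<bar>B\<bar>" using B assms(2) by force
      then have "\<bar>Q n x - q x\<bar> * \<bar>h x\<bar> \<le> \<bar>Q n x - q x\<bar> * \<bar>B\<bar>" by (intro mult_left_mono) auto
      then show "\<bar>Q n x * h x - q x * h x\<bar> \<le> \<bar>Q n x - q x\<bar> * \<bar>B\<bar>"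
        unfolding left_diff_distrib[symmetric] abs_mult .
    qed
    finally show "norm ((\<integral>x. Q n x * h x \<partial>M) - (\<integral>x. q x * h x \<partial>M)) \<le> norm (\<integral>x. \<bar>Q n x - q x\<bar> \<partial>M) * \<bar>B\<bar>"
      by simp
  qed
  have part2: "(\<lambda>n. (\<integral>x. Q n x * H n x \<partial>M) - (\<integral>x. Q n x * h x \<partial>M)) \<longlonglongrightarrow> 0"
  proof (rule LIMSEQ_I)
    fix e :: real assume "e > 0"
    define e' where "e' = e / (K + 2)"
    have "e' > 0" unfolding e'_def using \<open>e > 0\<close> \<open>K \<ge> 0\<close> by simp
    have "\<forall>\<^sub>F n in sequentially. \<forall>x\<in>\<Omega>. dist (H n x) (h x) < e'" by (rule uniform_limitD[OF H \<open>e' > 0\<close>])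
    moreover have "\<forall>\<^sub>F n in sequentially. dist (\<integral>x. \<bar>Q n x - q x\<bar> \<partial>M) 0 < 1"
      by (rule tendstoD[OF L1]) simp
    ultimately have "\<forall>\<^sub>F n in sequentially. norm ((\<integral>x. Q n x * H n x \<partial>M) - (\<integral>x. Q n x * h x \<partial>M) - 0) < e"
    proof eventually_elim
      case (elim n)
      have "\<bar>(\<integral>x. Q n x * H n x \<partial>M) - (\<integral>x. Q n x * h x \<partial>M)\<bar> = \<bar>\<integral>x. Q n x * H n x - Q n x * h x \<partial>M\<bar>"
        using Qh by simp
      also have "\<dots> \<le> (\<integral>x. \<bar>Q n x * H n x - Q n x * h x\<bar> \<partial>M)" by (rule integral_abs_bound)
      also have "\<dots> \<le> (\<integral>x. (\<bar>Q n x - q x\<bar> + \<bar>q x\<bar>) * e' \<partial>M)"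
      proof (rule integral_mono)
        show "integrable M (\<lambda>x. \<bar>Q n x * H n x - Q n x * h x\<bar>)" using Qh by simp
        show "integrable M (\<lambda>x. (\<bar>Q n x - q x\<bar> + \<bar>q x\<bar>) * e')" using Q q by simp
        fix x assume "x \<in> space M"
        then have "\<bar>H n x - h x\<bar> \<le> e'" using elim(1) assms(2) by (auto simp: dist_real_def less_imp_le)
        then have "\<bar>Q n x\<bar> * \<bar>H n x - h x\<bar> \<le> (\<bar>Q n x - q x\<bar> + \<bar>q x\<bar>) * e'"
          by (intro mult_mono) auto
        then show "\<bar>Q n x * H n x - Q n x * h x\<bar> \<le> (\<bar>Q n x - q x\<bar> + \<bar>q x\<bar>) * e'"
          unfolding right_diff_distrib[symmetric] abs_mult .
      qed
      also have "\<dots> = ((\<integral>x. \<bar>Q n x - q x\<bar> \<partial>M) + K) * e'"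
        unfolding K_def using Q q by simp
      also have "\<dots> \<le> (1 + K) * e'"
        using elim(2) \<open>e' > 0\<close> by (intro mult_right_mono) auto
      also have "\<dots> < e" unfolding e'_def using \<open>e > 0\<close> \<open>K \<ge> 0\<close> by (simp add: field_simps)
      finally show ?case by simp
    qed
    then show "\<exists>N. \<forall>n\<ge>N. norm ((\<integral>x. Q n x * H n x \<partial>M) - (\<integral>x. Q n x * h x \<partial>M) - 0) < e"
      unfolding eventually_sequentially .
  qed
  from tendsto_add[OF tendsto_add[OF part1 part2] tendsto_const[of "\<integral>x. q x * h x \<partial>M"]]
  show ?thesis by simp
qed

lemma integrable_mult_continuous:
  fixes q h :: "'a::euclidean_space \<Rightarrow> real"
  assumes "compact \<Omega>" "integrable (lebesgue_on \<Omega>) q" "continuous_on \<Omega> h"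
  shows "integrable (lebesgue_on \<Omega>) (\<lambda>x. q x * h x)"
proof -
  obtain B where B: "\<And>x. x \<in> \<Omega> \<Longrightarrow> \<bar>h x\<bar> \<le> B"
    using compact_imp_bounded[OF compact_continuous_image[OF assms(3,1)]]
    unfolding bounded_iff by auto
  have "h \<in> borel_measurable (lebesgue_on \<Omega>)"
    using assms(1) by (intro borel_measurable_lebesgue_on borel_measurable_continuous_on_restrict assms(3)) (simp add: borel_compact)
  then have m: "(\<lambda>x. q x * h x) \<in> borel_measurable (lebesgue_on \<Omega>)"
    using borel_measurable_integrable[OF assms(2)] by measurable
  have "norm (q x * h x) \<le> norm (q x * B)" if "x \<in> \<Omega>" for x
    unfolding norm_mult using B[OF that] by (intro mult_left_mono) auto
  then show ?thesis
    by (intro Bochner_Integration.integrable_bound[OF integrable_mult_left[OF assms(2), of B] m] AE_I2) simp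
qed

text \<open>The envelope argument. With \<open>Q n\<close> the difference quotient of the densities, a potential \<open>\<phi>0\<close> that is
  optimal at \<open>\<theta>\<^sub>0\<close> bounds the difference quotient of \<open>f\<close> from below by \<open>\<integral>x. Q n x * \<phi>0 x\<close>, and the
  potentials optimal at the nearby parameters bound it from above. Up to additive constants, the latter converge along a
  subsequence to a potential that is optimal at \<open>\<theta>\<^sub>0\<close>. It differs from \<open>\<phi>0\<close> by a constant on the
  support, and this difference is invisible to \<open>D v\<close>, which vanishes off the support and has mean 0.\<close>

theorem gateaux_differentiable_transport_cost:
  fixes \<Omega> :: "'a::euclidean_space set" and \<Theta> :: "'b::euclidean_space set"
  assumes \<Omega>: "compact \<Omega>" and \<nu>: "\<nu> \<in> borel_probs \<Omega>"
    and A1: "assumption_A1 \<Omega> \<Theta> \<rho>" and A2: "assumption_A2 \<Omega> \<Theta> \<rho>" and A3: "assumption_A3 \<Omega> c"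
    and f: "\<And>\<theta>. \<theta> \<in> \<Theta> \<Longrightarrow> f \<theta> = transport_cost \<Omega> c (density_on \<Omega> (\<lambda>x. \<rho> x \<theta>)) \<nu>"
    and \<theta>0: "\<theta>\<^sub>0 \<in> \<Theta>"
    and uniq: "\<And>\<phi>1 \<psi>1 \<phi>2 \<psi>2. optimal_pair \<Omega> c (density_on \<Omega> (\<lambda>x. \<rho> x \<theta>\<^sub>0)) \<nu> \<phi>1 \<psi>1 \<Longrightarrow>
        optimal_pair \<Omega> c (density_on \<Omega> (\<lambda>x. \<rho> x \<theta>\<^sub>0)) \<nu> \<phi>2 \<psi>2 \<Longrightarrow>
        \<exists>k. \<forall>x\<in>msupport (density_on \<Omega> (\<lambda>x. \<rho> x \<theta>\<^sub>0)). \<phi>1 x - \<phi>2 x = k"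
  shows "gateaux_differentiable f \<theta>\<^sub>0"
proof -
  define m where "m \<theta> = density_on \<Omega> (\<lambda>x. \<rho> x \<theta>)" for \<theta>
  define M where "M = lebesgue_on \<Omega>"
  have c: "continuous_on (\<Omega> \<times> \<Omega>) c" using A3 unfolding assumption_A3_def by blast
  have spM: "space M = \<Omega>" unfolding M_def by simp
  have dens: "(\<lambda>x. \<rho> x \<theta>) \<in> borel_measurable (restrict_space borel \<Omega>)"
      "AE x in lebesgue_on \<Omega>. 0 \<le> \<rho> x \<theta>" "m \<theta> \<in> borel_probs \<Omega>" if "\<theta> \<in> \<Theta>" for \<theta>
    using A1 that unfolding assumption_A1_def m_def by auto
  have mi: "integrable M (\<lambda>x. \<rho> x \<theta> * h x)" "(\<integral>x. h x \<partial>(m \<theta>)) = (\<integral>x. \<rho> x \<theta> * h x \<partial>M)"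
    if "\<theta> \<in> \<Theta>" "continuous_on \<Omega> h" for \<theta> h
    using density_on_integral[OF \<Omega> dens(1,2)[OF that(1)] dens(3)[OF that(1), unfolded m_def] that(2)]
    unfolding M_def m_def by auto
  have \<rho>i: "integrable M (\<lambda>x. \<rho> x \<theta>)" if "\<theta> \<in> \<Theta>" for \<theta>
    using mi(1)[OF that continuous_on_const[of \<Omega> 1]] by simp
  obtain \<delta> D where \<delta>: "\<delta> > 0" "ball \<theta>\<^sub>0 \<delta> \<subseteq> \<Theta>"
    and Di: "\<And>v. integrable M (D v)"
    and DL: "\<And>v. ((\<lambda>s. \<integral>x. \<bar>(\<rho> x (\<theta>\<^sub>0 + s *\<^sub>R v) - \<rho> x \<theta>\<^sub>0) / s - D v x\<bar> \<partial>M) \<longlongrightarrow> 0) (at_right 0)"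
    and D_add: "\<And>v w. AE x in M. D (v + w) x = D v x + D w x"
    and D_scale: "\<And>r v. AE x in M. D (r *\<^sub>R v) x = r * D v x"
    and D_zero: "\<And>v. AE x in M. \<rho> x \<theta>\<^sub>0 = 0 \<longrightarrow> D v x = 0"
    by (rule density_derivative[OF \<Omega> A1 A2 \<theta>0, folded M_def]) (rule that)
  obtain \<phi>0 \<psi>0 where opt0: "optimal_pair \<Omega> c (m \<theta>\<^sub>0) \<nu> \<phi>0 \<psi>0"
    using optimal_pair_exists[OF \<Omega> A3 dens(3)[OF \<theta>0] \<nu>] by blast
  have cp0: "conj_pair \<Omega> c \<phi>0 \<psi>0" using opt0 unfolding optimal_pair_def by simp
  note cont0 = conj_pair_continuous_fst[OF \<Omega> c cp0] conj_pair_continuous_snd[OF \<Omega> c cp0]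
  have DhI: "integrable M (\<lambda>x. D v x * h x)" if "continuous_on \<Omega> h" for v h
    using integrable_mult_continuous[OF \<Omega> Di[unfolded M_def] that] unfolding M_def .
  define f' where "f' v = (\<integral>x. D v x * \<phi>0 x \<partial>M)" for v
  have DhM: "(\<lambda>x. D v x * \<phi>0 x) \<in> borel_measurable M" for v
    using DhI[OF cont0(1)] by (rule borel_measurable_integrable)
  have "linear f'"
  proof (rule linearI)
    fix v w
    have "f' (v + w) = (\<integral>x. D v x * \<phi>0 x + D w x * \<phi>0 x \<partial>M)"
      unfolding f'_def
    proof (rule integral_cong_AE)
      show "AE x in M. D (v + w) x * \<phi>0 x = D v x * \<phi>0 x + D w x * \<phi>0 x"
        using D_add[of v w] by eventually_elim (simp add: distrib_right)
      show "(\<lambda>x. D v x * \<phi>0 x + D w x * \<phi>0 x) \<in> borel_measurable M" using DhM by measurable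
    qed (rule DhM)
    then show "f' (v + w) = f' v + f' w" unfolding f'_def using DhI[OF cont0(1)] by simp
  next
    fix r v
    have "f' (r *\<^sub>R v) = (\<integral>x. r * (D v x * \<phi>0 x) \<partial>M)"
      unfolding f'_def
    proof (rule integral_cong_AE)
      show "AE x in M. D (r *\<^sub>R v) x * \<phi>0 x = r * (D v x * \<phi>0 x)"
        using D_scale[of r v] by eventually_elim simp
      show "(\<lambda>x. r * (D v x * \<phi>0 x)) \<in> borel_measurable M" using DhM by measurable
    qed (rule DhM)
    then show "f' (r *\<^sub>R v) = r *\<^sub>R f' v" unfolding f'_def by simp
  qed
  moreover have "((\<lambda>t. (f (\<theta>\<^sub>0 + t *\<^sub>R v) - f \<theta>\<^sub>0) / t) \<longlongrightarrow> f' v) (at_right 0)" for v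
  proof -
    have limit: "(\<lambda>n. (f (\<theta>\<^sub>0 + t n *\<^sub>R v) - f \<theta>\<^sub>0) / t n) \<longlonglongrightarrow> f' v"
      if t: "\<And>n. 0 < t n" "\<And>n. t n * norm v < \<delta>" "t \<longlonglongrightarrow> 0" for t
    proof (rule tendsto_from_subseq_limits)
      fix r0 :: "nat \<Rightarrow> nat" assume r0: "strict_mono r0"
      define \<tau> where "\<tau> n = t (r0 n)" for n
      have \<tau>: "0 < \<tau> n" "\<tau> n * norm v < \<delta>" "\<tau> \<longlonglongrightarrow> 0" for n
        using t LIMSEQ_subseq_LIMSEQ[OF t(3) r0] unfolding \<tau>_def o_def by auto
      define \<theta> where "\<theta> n = \<theta>\<^sub>0 + \<tau> n *\<^sub>R v" for n
      define Q where "Q n x = (\<rho> x (\<theta> n) - \<rho> x \<theta>\<^sub>0) / \<tau> n" for n x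
      have \<theta>\<Theta>: "\<theta> n \<in> \<Theta>" for n
      proof -
        have "\<theta> n \<in> ball \<theta>\<^sub>0 \<delta>" unfolding \<theta>_def using \<tau>(1,2)[of n] by (simp add: dist_norm)
        then show ?thesis using \<delta>(2) by blast
      qed
      have QI: "integrable M (Q n)" for n unfolding Q_def using \<rho>i[OF \<theta>\<Theta>] \<rho>i[OF \<theta>0] by simp
      have QhI: "integrable M (\<lambda>x. Q n x * h x)" if "continuous_on \<Omega> h" for n h
        using integrable_mult_continuous[OF \<Omega> QI[unfolded M_def] that] unfolding M_def .
      have Qh: "(\<integral>x. Q n x * h x \<partial>M) = ((\<integral>x. h x \<partial>(m (\<theta> n))) - (\<integral>x. h x \<partial>(m \<theta>\<^sub>0))) / \<tau> n"
        if h: "continuous_on \<Omega> h" for n h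
      proof -
        have "(\<integral>x. Q n x * h x \<partial>M) = (\<integral>x. (\<rho> x (\<theta> n) * h x - \<rho> x \<theta>\<^sub>0 * h x) / \<tau> n \<partial>M)"
          unfolding Q_def by (simp add: left_diff_distrib)
        then show ?thesis using mi[OF \<theta>\<Theta> h] mi[OF \<theta>0 h] by simp
      qed
      have L1: "(\<lambda>n. \<integral>x. \<bar>Q n x - D v x\<bar> \<partial>M) \<longlonglongrightarrow> 0"
      proof -
        have "filterlim \<tau> (at_right 0) sequentially"
          using \<tau>(1,3) unfolding filterlim_at by (auto intro!: always_eventually simp: less_imp_neq[symmetric])
        from filterlim_compose[OF DL this] show ?thesis unfolding Q_def \<theta>_def .
      qed
      have QDlim: "(\<lambda>n. \<integral>x. Q (r n) x * H n x \<partial>M) \<longlonglongrightarrow> (\<integral>x. D v x * h x \<partial>M)"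
        if H: "uniform_limit \<Omega> H h sequentially" "\<And>n. continuous_on \<Omega> (H n)"
          and h: "continuous_on \<Omega> h" and r: "strict_mono r"
        for H h and r :: "nat \<Rightarrow> nat"
      proof -
        obtain B where B: "\<And>x. x \<in> \<Omega> \<Longrightarrow> \<bar>h x\<bar> \<le> B"
          using compact_imp_bounded[OF compact_continuous_image[OF h \<Omega>]] unfolding bounded_iff by auto
        show ?thesis
          by (rule integral_mult_uniform_limit[OF H(1) spM[symmetric] QhI[OF H(2)] QhI[OF h]
              DhI[OF h] QI Di _ B])
            (use LIMSEQ_subseq_LIMSEQ[OF L1 r] in \<open>simp add: o_def\<close>)
      qed
      have QDlim': "(\<lambda>n. \<integral>x. Q n x * h x \<partial>M) \<longlonglongrightarrow> (\<integral>x. D v x * h x \<partial>M)" if "continuous_on \<Omega> h" for h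
        
        using QDlim[of "\<lambda>_. h" h "\<lambda>n. n"] that by (simp add: strict_mono_def uniform_limit_sequentially_iff)
      have weak: "(\<lambda>n. \<integral>x. h x \<partial>(m (\<theta> n))) \<longlonglongrightarrow> (\<integral>x. h x \<partial>(m \<theta>\<^sub>0))" if h: "continuous_on \<Omega> h"
        for h :: "'a \<Rightarrow> real"
      proof -
        have "(\<integral>x. h x \<partial>(m (\<theta> n))) = (\<integral>x. h x \<partial>(m \<theta>\<^sub>0)) + \<tau> n * (\<integral>x. Q n x * h x \<partial>M)" for n
          using Qh[OF h, of n] \<tau>(1)[of n] by simp
        moreover have "(\<lambda>n. (\<integral>x. h x \<partial>(m \<theta>\<^sub>0)) + \<tau> n * (\<integral>x. Q n x * h x \<partial>M))
            \<longlonglongrightarrow> (\<integral>x. h x \<partial>(m \<theta>\<^sub>0)) + 0 * (\<integral>x. D v x * h x \<partial>M)"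
          by (intro tendsto_intros \<tau>(3) QDlim'[OF h])
        ultimately show ?thesis by simp
      qed
      \<comment> \<open>differences of probability densities have integral 0\<close>
      have Q_mean: "(\<integral>x. Q n x * k \<partial>M) = 0" for n k
      proof -
        interpret a: prob_space "m (\<theta> n)" by (rule borel_probs_prob[OF dens(3)[OF \<theta>\<Theta>]])
        interpret b: prob_space "m \<theta>\<^sub>0" by (rule borel_probs_prob[OF dens(3)[OF \<theta>0]])
        show ?thesis using Qh[OF continuous_on_const[of \<Omega> k], of n] by (simp add: a.prob_space b.prob_space)
      qed
      have D_mean: "(\<integral>x. D v x * k \<partial>M) = 0" for k
        using QDlim'[OF continuous_on_const[of \<Omega> k]] unfolding Q_mean
        by (rule LIMSEQ_unique[OF _ tendsto_const])
      have "\<exists>\<phi> \<psi>. conj_pair \<Omega> c \<phi> \<psi> \<and>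
          transport_cost \<Omega> c (m (\<theta> n)) \<nu> \<le> (\<integral>x. \<phi> x \<partial>(m (\<theta> n))) + (\<integral>y. \<psi> y \<partial>\<nu>) + 0" for n
      proof -
        obtain \<phi> \<psi> where "optimal_pair \<Omega> c (m (\<theta> n)) \<nu> \<phi> \<psi>"
          by (rule optimal_pair_exists[OF \<Omega> A3 dens(3)[OF \<theta>\<Theta>] \<nu>])
        then show ?thesis unfolding optimal_pair_def by (intro exI[of _ \<phi>] exI[of _ \<psi>]) simp
      qed
      then obtain \<Phi> \<Psi> where pairs: "\<And>n. conj_pair \<Omega> c (\<Phi> n) (\<Psi> n)"
        "\<And>n. transport_cost \<Omega> c (m (\<theta> n)) \<nu> \<le> (\<integral>x. \<Phi> n x \<partial>(m (\<theta> n))) + (\<integral>y. \<Psi> n y \<partial>\<nu>) + 0"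
        by metis
      note cont = conj_pair_continuous_fst[OF \<Omega> c pairs(1)] conj_pair_continuous_snd[OF \<Omega> c pairs(1)]
      obtain \<phi> \<psi> and k :: "nat \<Rightarrow> real" and r :: "nat \<Rightarrow> nat" where r: "strict_mono r"
        and opt: "optimal_pair \<Omega> c (m \<theta>\<^sub>0) \<nu> \<phi> \<psi>"
        and lim: "uniform_limit \<Omega> (\<lambda>n x. \<Phi> (r n) x - k n) \<phi> sequentially"
        by (rule optimal_pair_limit[where \<epsilon> = "\<lambda>_. 0", OF \<Omega> A3 dens(3)[OF \<theta>0] \<nu> dens(3)[OF \<theta>\<Theta>] weak
              pairs tendsto_const], assumption) (rule that)
      have "conj_pair \<Omega> c \<phi> \<psi>" using opt unfolding optimal_pair_def by simp
      note cont\<phi> = conj_pair_continuous_fst[OF \<Omega> c this]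
      have same: "(\<integral>x. D v x * \<phi> x \<partial>M) = f' v"
      proof -
        have "\<exists>k. \<forall>x\<in>msupport (m \<theta>\<^sub>0). \<phi> x - \<phi>0 x = k"
          using uniq[OF opt[unfolded m_def] opt0[unfolded m_def]] unfolding m_def .
        then obtain \<kappa> where \<kappa>: "\<And>x. x \<in> msupport (m \<theta>\<^sub>0) \<Longrightarrow> \<phi> x - \<phi>0 x = \<kappa>"
          by blast
        have "AE x in M. x \<notin> msupport (m \<theta>\<^sub>0) \<longrightarrow> \<rho> x \<theta>\<^sub>0 = 0"
          using density_zero_off_msupport[OF \<Omega> dens(1,2)[OF \<theta>0] dens(3)[OF \<theta>0, unfolded m_def]]
          unfolding M_def m_def .
        then have "AE x in M. D v x * \<phi> x = D v x * \<phi>0 x + D v x * \<kappa>"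
          using D_zero[of v]
        proof eventually_elim
          case (elim x)
          show ?case
          proof (cases "x \<in> msupport (m \<theta>\<^sub>0)")
            case True
            then have "\<phi> x = \<phi>0 x + \<kappa>" using \<kappa>[OF True] by simp
            then show ?thesis by (simp add: distrib_left)
          next
            case False
            then show ?thesis using elim by simp
          qed
        qed
        then have "(\<integral>x. D v x * \<phi> x \<partial>M) = (\<integral>x. D v x * \<phi>0 x + D v x * \<kappa> \<partial>M)"
          using DhI[OF cont\<phi>, THEN borel_measurable_integrable] DhM Di[THEN borel_measurable_integrable]
          by (intro integral_cong_AE) auto
        also have "\<dots> = f' v + (\<integral>x. D v x * \<kappa> \<partial>M)"
          unfolding f'_def using DhI[OF cont0(1)] Di by simp
        finally show ?thesis using D_mean by simp
      qed
      define X where "X n = (f (\<theta> n) - f \<theta>\<^sub>0) / \<tau> n" for n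
      have fn: "f (\<theta> n) = transport_cost \<Omega> c (m (\<theta> n)) \<nu>" for n using f[OF \<theta>\<Theta>] unfolding m_def .
      have f0: "f \<theta>\<^sub>0 = transport_cost \<Omega> c (m \<theta>\<^sub>0) \<nu>" using f[OF \<theta>0] unfolding m_def .
      have lower: "(\<integral>x. Q n x * \<phi>0 x \<partial>M) \<le> X n" for n
      proof -
        have "(\<integral>x. \<phi>0 x \<partial>(m (\<theta> n))) + (\<integral>y. \<psi>0 y \<partial>\<nu>) \<le> f (\<theta> n)"
          unfolding fn by (rule weak_duality[OF \<Omega> dens(3)[OF \<theta>\<Theta>] \<nu> c cont0 conj_pair_le[OF cp0]])
        moreover have "f \<theta>\<^sub>0 = (\<integral>x. \<phi>0 x \<partial>(m \<theta>\<^sub>0)) + (\<integral>y. \<psi>0 y \<partial>\<nu>)"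
          using opt0 unfolding f0 optimal_pair_def by simp
        ultimately show ?thesis
          unfolding X_def Qh[OF cont0(1)] using \<tau>(1)[of n] by (intro divide_right_mono) auto
      qed
      have upper: "X n \<le> (\<integral>x. Q n x * (\<Phi> n x - k') \<partial>M)" for n k'
      proof -
        have "(\<integral>x. \<Phi> n x \<partial>(m \<theta>\<^sub>0)) + (\<integral>y. \<Psi> n y \<partial>\<nu>) \<le> f \<theta>\<^sub>0"
          unfolding f0 by (rule weak_duality[OF \<Omega> dens(3)[OF \<theta>0] \<nu> c cont conj_pair_le[OF pairs(1)]])
        then have "f (\<theta> n) - f \<theta>\<^sub>0 \<le> (\<integral>x. \<Phi> n x \<partial>(m (\<theta> n))) - (\<integral>x. \<Phi> n x \<partial>(m \<theta>\<^sub>0))"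
          using pairs(2)[of n] unfolding fn by linarith
        then have "X n \<le> (\<integral>x. Q n x * \<Phi> n x \<partial>M)"
          unfolding X_def Qh[OF cont(1)] using \<tau>(1)[of n] by (intro divide_right_mono) auto
        moreover have "(\<integral>x. Q n x * (\<Phi> n x - k') \<partial>M) = (\<integral>x. Q n x * \<Phi> n x \<partial>M) - (\<integral>x. Q n x * k' \<partial>M)"
          using QhI[OF cont(1)] QI by (simp add: right_diff_distrib)
        ultimately show ?thesis by (simp only: Q_mean diff_0_right)
      qed
      have "(\<lambda>n. X (r n)) \<longlonglongrightarrow> f' v"
      proof (rule tendsto_sandwich)
        show "\<forall>\<^sub>F n in sequentially. (\<integral>x. Q (r n) x * \<phi>0 x \<partial>M) \<le> X (r n)" using lower by simp
        show "\<forall>\<^sub>F n in sequentially. X (r n) \<le> (\<integral>x. Q (r n) x * (\<Phi> (r n) x - k n) \<partial>M)" using upper by simp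
        show "(\<lambda>n. \<integral>x. Q (r n) x * \<phi>0 x \<partial>M) \<longlonglongrightarrow> f' v"
          unfolding f'_def using LIMSEQ_subseq_LIMSEQ[OF QDlim'[OF cont0(1)] r] by (simp add: o_def)
        show "(\<lambda>n. \<integral>x. Q (r n) x * (\<Phi> (r n) x - k n) \<partial>M) \<longlonglongrightarrow> f' v"
          unfolding same[symmetric] by (rule QDlim[OF lim _ cont\<phi> r]) (intro continuous_intros cont)
      qed
      then show "\<exists>s. strict_mono s \<and> (\<lambda>n. (f (\<theta>\<^sub>0 + t (r0 (s n)) *\<^sub>R v) - f \<theta>\<^sub>0) / t (r0 (s n))) \<longlonglongrightarrow> f' v"
        using r unfolding X_def \<theta>_def \<tau>_def by blast
    qed
    define b where "b = \<delta> / (1 + norm v)"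
    have nv: "0 < 1 + norm v" by (simp add: add_pos_nonneg)
    show ?thesis
    proof (rule tendsto_at_right_sequentially[of 0 b])
      show "0 < b" unfolding b_def using \<delta>(1) nv by simp
      fix S :: "nat \<Rightarrow> real" assume S: "\<And>n. 0 < S n" "\<And>n. S n < b" "S \<longlonglongrightarrow> 0"
      have "S n * norm v < \<delta>" for n
      proof -
        have "S n * (1 + norm v) < \<delta>" using S(2)[of n] nv unfolding b_def by (simp add: pos_less_divide_eq)
        then show ?thesis using S(1)[of n] by (simp add: distrib_left)
      qed
      then show "(\<lambda>n. (f (\<theta>\<^sub>0 + S n *\<^sub>R v) - f \<theta>\<^sub>0) / S n) \<longlonglongrightarrow> f' v"
        by (rule limit[OF S(1) _ S(3)])
    qed
  qed
  ultimately show ?thesis unfolding gateaux_differentiable_def by blast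
qed

text \<open>The interior of the closure of \<open>U\<close> lies between \<open>U\<close> and its closure, so it is connected.\<close>

lemma unique_component_interior_closure:
  fixes U :: "'a::euclidean_space set"
  assumes "open U" "connected U" "A \<in> components (interior (closure U))" "B \<in> components (interior (closure U))"
  shows "A = B"
proof -
  have "U \<subseteq> interior (closure U)" using assms(1) closure_subset by (rule interior_maximal[rotated])
  then have "connected (interior (closure U))"
    using connected_intermediate_closure[OF assms(2)] interior_subset by blast
  then show ?thesis using assms(3,4) by (metis connected_eq_components_subset_sing singletonD subsetD)
qed

theorem corollary4p6:
  fixes \<Omega> :: "'a::euclidean_space set"
    and \<Theta> :: "'b::euclidean_space set"
    and \<rho> :: "'a \<Rightarrow> 'b \<Rightarrow> real"
    and \<rho>star :: "'a measure"
    and c :: "'a \<times> 'a \<Rightarrow> real"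
    and \<theta>\<^sub>0 :: 'b
    and f :: "'b \<Rightarrow> real"
  assumes "compact \<Omega>"
    and "\<rho>star \<in> borel_probs \<Omega>"
    and "assumption_A1 \<Omega> \<Theta> \<rho>"
    and "assumption_A2 \<Omega> \<Theta> \<rho>"
    and "assumption_A3 \<Omega> c"
    and "C1_on (\<Omega> \<times> \<Omega>) c"
    and "\<And>\<theta>. \<theta> \<in> \<Theta> \<Longrightarrow> f \<theta> = transport_cost \<Omega> c (density_on \<Omega> (\<lambda>x. \<rho> x \<theta>)) \<rho>star"
    and "\<theta>\<^sub>0 \<in> \<Theta>"
  shows "(let \<mu> = density_on \<Omega> (\<lambda>x. \<rho> x \<theta>\<^sub>0) in
            msupport \<mu> = closure (interior (msupport \<mu>)) \<and>
            (\<forall>A \<in> components (interior (msupport \<mu>)). \<forall>B \<in> components (interior (msupport \<mu>)).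
               linked \<Omega> c \<mu> \<rho>star A B)
            \<longrightarrow> gateaux_differentiable f \<theta>\<^sub>0)
       \<and> ((\<exists>U. open U \<and> connected U \<and> msupport (density_on \<Omega> (\<lambda>x. \<rho> x \<theta>\<^sub>0)) = closure U)
            \<longrightarrow> gateaux_differentiable f \<theta>\<^sub>0)"
proof -
  define \<mu> where "\<mu> = density_on \<Omega> (\<lambda>x. \<rho> x \<theta>\<^sub>0)"
  have \<mu>: "\<mu> \<in> borel_probs \<Omega>" using assms(3,8) unfolding assumption_A1_def \<mu>_def by blast
  have main: "gateaux_differentiable f \<theta>\<^sub>0"
    if supp: "msupport \<mu> = closure (interior (msupport \<mu>))"
      and link: "\<And>A B. A \<in> components (interior (msupport \<mu>)) \<Longrightarrow>
        B \<in> components (interior (msupport \<mu>)) \<Longrightarrow> linked \<Omega> c \<mu> \<rho>star A B"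
  proof (rule gateaux_differentiable_transport_cost[OF assms(1-5,7,8), folded \<mu>_def])
    fix \<phi>1 \<psi>1 \<phi>2 \<psi>2
    assume "optimal_pair \<Omega> c \<mu> \<rho>star \<phi>1 \<psi>1" "optimal_pair \<Omega> c \<mu> \<rho>star \<phi>2 \<psi>2"
    from optimal_potential_unique[OF assms(1,5,6) \<mu> assms(2) this supp link]
    show "\<exists>k. \<forall>x\<in>msupport \<mu>. \<phi>1 x - \<phi>2 x = k" by blast
  qed
  have "gateaux_differentiable f \<theta>\<^sub>0" if U: "open U" "connected U" "msupport \<mu> = closure U" for U
  proof (rule main)
    have "U \<subseteq> interior (closure U)" using U(1) closure_subset by (rule interior_maximal[rotated])
    then show "msupport \<mu> = closure (interior (msupport \<mu>))"
      unfolding U(3) by (metis closure_closure closure_mono interior_subset subset_antisym)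
    fix A B assume AB: "A \<in> components (interior (msupport \<mu>))" "B \<in> components (interior (msupport \<mu>))"
    then have "A = B" using unique_component_interior_closure[OF U(1,2)] unfolding U(3) by blast
    \<comment> \<open>a single component is linked to itself by the chain of length one\<close>
    then show "linked \<Omega> c \<mu> \<rho>star A B" unfolding linked_def using AB by (intro exI[of _ "[A]"]) simp
  qed
  with main show ?thesis unfolding Let_def \<mu>_def by blast
qed

end
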